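(* The geodesics of the Kähler metric $\mathbb{G}$ on $\mathbb{L}(\mathbb{H}^3)$ are generated by the 1-parameter subgroups of the isometry group of $\mathbb{G}$ (that is, every geodesic of $\mathbb{G}$ is an integral curve of a Killing vector field of $\mathbb{G}$). A ruled surface generated by a (non-constant) geodesic of $\mathbb{G}$ is a minimal surface in $\mathbb{H}^3$, and the geodesic is null with respect to $\mathbb{G}$ if and only if the ruled surface is totally geodesic in $\mathbb{H}^3$.
   Context: Hyperbolic 3-space $\mathbb{H}^3$ is the upper half-space $\{(x^0,x^1,x^2)\in\mathbb{R}^3: x^0>0\}$ with metric $g=((dx^0)^2+(dx^1)^2+(dx^2)^2)/(x^0)^2$, oriented by $dx^0\wedge dx^1\wedge dx^2$. $\mathbb{L}(\mathbb{H}^3)$ is the smooth 4-manifold of oriented geodesics of $\mathbb{H}^3$ (the quotient of the unit tangent bundle by the geodesic flow). For an oriented geodesic $\gamma$ (parameterised by arc length), $T_\gamma\mathbb{L}(\mathbb{H}^3)$ is identified with the 4-dimensional real vector space $\mathcal{J}^\perp(\gamma)$ of Jacobi fields along $\gamma$ orthogonal to $\gamma$, by the isomorphism $h$ sending a tangent vector $\mathbb{X}$ to the projection, orthogonal to $\dot\gamma$, of the variation field of any variation of $\gamma$ through oriented unit-speed geodesics representing $\mathbb{X}$. Let $\mathcal{R}_\gamma$ be rotation through $+90^\circ$ about $\dot\gamma$ (so $(\dot\gamma,v,\mathcal{R}_\gamma v)$ is positively oriented for unit $v\perp\dot\gamma$); it maps $\mathcal{J}^\perp(\gamma)$ to itself.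 Define $$\mathbb{J}=h^{-1}\circ\mathcal{R}_\gamma\circ h,\qquad \Omega(\mathbb{X},\mathbb{Y})=g(h(\mathbb{X}),\nabla_{\dot\gamma}h(\mathbb{Y}))-g(h(\mathbb{Y}),\nabla_{\dot\gamma}h(\mathbb{X})),\qquad \mathbb{G}(\cdot,\cdot)=\Omega(\mathbb{J}\cdot,\cdot)$$ (the expression for $\Omega$ is constant along $\gamma$). $\mathbb{G}$ is a neutral-signature Kähler metric on $\mathbb{L}(\mathbb{H}^3)$. A curve in $\mathbb{L}(\mathbb{H}^3)$ is a 1-parameter family of oriented geodesics $\gamma_s$ of $\mathbb{H}^3$; the surface $(r,s)\mapsto\gamma_s(r)$ in $\mathbb{H}^3$ that it sweeps out is the ruled surface generated by the curve. "Minimal" (zero mean curvature) and "totally geodesic" (zero second fundamental form) refer to the points where this map is an immersion. A geodesic $c$ of $\mathbb{G}$ is null if $\mathbb{G}(\dot c,\dot c)=0$. *)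

theory Defs
  imports "HOL-Analysis.Analysis"
begin

primrec Ck_on :: "nat \<Rightarrow> 'a::euclidean_space set \<Rightarrow> ('a \<Rightarrow> 'b::euclidean_space) \<Rightarrow> bool" where
  "Ck_on 0 S f \<longleftrightarrow> continuous_on S f"
| "Ck_on (Suc k) S f \<longleftrightarrow> (\<forall>x\<in>S. f differentiable (at x)) \<and>
     (\<forall>v. Ck_on k S (\<lambda>x. frechet_derivative f (at x) v))"

definition smooth_on :: "'a::euclidean_space set \<Rightarrow> ('a \<Rightarrow> 'b::euclidean_space) \<Rightarrow> bool" where
  "smooth_on S f \<longleftrightarrow> (\<forall>k. Ck_on k S f)"

definition velocity :: "(real \<Rightarrow> 'a::euclidean_space) \<Rightarrow> real \<Rightarrow> 'a" where
  "velocity \<gamma> t = vector_derivative \<gamma> (at t)"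

text \<open>A metric is given by its value \<open>g x u v\<close> at a point \<open>x\<close> on two tangent vectors; it is
  always a nondegenerate symmetric bilinear form where it is used.\<close>

type_synonym 'a metric = "'a \<Rightarrow> 'a \<Rightarrow> 'a \<Rightarrow> real"

text \<open>The Levi-Civita connection is \<open>\<nabla>\<^sub>u V = D\<^sub>u V + \<Gamma>(u, V)\<close>; the bilinear map \<open>\<Gamma>\<close> is determined by the
  Koszul formula for constant vector fields \<open>u, v, z\<close>.\<close>

definition christoffel :: "'a::euclidean_space metric \<Rightarrow> 'a \<Rightarrow> 'a \<Rightarrow> 'a \<Rightarrow> 'a" where
  "christoffel g x u v = (THE w. \<forall>z. g x w z =
     (frechet_derivative (\<lambda>y. g y v z) (at x) u
      + frechet_derivative (\<lambda>y. g y u z) (at x) v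
      - frechet_derivative (\<lambda>y. g y u v) (at x) z) / 2)"

text \<open>Sign convention: \<open>R(u,v)w = \<nabla>\<^sub>u\<nabla>\<^sub>v w - \<nabla>\<^sub>v\<nabla>\<^sub>u w - \<nabla>\<^bsub>[u,v]\<^esub> w\<close>.\<close>

definition curvature :: "'a::euclidean_space metric \<Rightarrow> 'a \<Rightarrow> 'a \<Rightarrow> 'a \<Rightarrow> 'a \<Rightarrow> 'a" where
  "curvature g x u v w =
     frechet_derivative (\<lambda>y. christoffel g y v w) (at x) u
     - frechet_derivative (\<lambda>y. christoffel g y u w) (at x) v
     + christoffel g x u (christoffel g x v w) - christoffel g x v (christoffel g x u w)"

definition covariant_along ::
    "'a::euclidean_space metric \<Rightarrow> (real \<Rightarrow> 'a) \<Rightarrow> (real \<Rightarrow> 'a) \<Rightarrow> real \<Rightarrow> 'a" where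
  "covariant_along g \<gamma> W t = velocity W t + christoffel g (\<gamma> t) (velocity \<gamma> t) (W t)"

definition geodesic_on :: "'a::euclidean_space metric \<Rightarrow> real set \<Rightarrow> (real \<Rightarrow> 'a) \<Rightarrow> bool" where
  "geodesic_on g I \<gamma> \<longleftrightarrow> smooth_on I \<gamma> \<and>
     (\<forall>t\<in>I. covariant_along g \<gamma> (velocity \<gamma>) t = 0)"

text \<open>The last condition is the vanishing of the Lie derivative of \<open>g\<close> along \<open>X\<close>.\<close>

definition killing_on :: "'a::euclidean_space metric \<Rightarrow> 'a set \<Rightarrow> ('a \<Rightarrow> 'a) \<Rightarrow> bool" where
  "killing_on g U X \<longleftrightarrow> smooth_on U X \<and>
     (\<forall>x\<in>U. \<forall>u v. frechet_derivative (\<lambda>y. g y u v) (at x) (X x)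
        + g x (frechet_derivative X (at x) u) v
        + g x u (frechet_derivative X (at x) v) = 0)"

text \<open>The index type \<open>3\<close> has the elements \<open>0, 1, 2\<close> (with \<open>3 = 0\<close>), so \<open>x $ 0\<close>, \<open>x $ 1\<close>, \<open>x $ 2\<close> are
  the three coordinates.\<close>

definition hyp3 :: "(real^3) set" where
  "hyp3 = {x. x $ 0 > 0}"

definition hyp_metric :: "(real^3) metric" where
  "hyp_metric x u v = (u \<bullet> v) / (x $ 0)\<^sup>2"

definition unit_geodesic :: "(real \<Rightarrow> real^3) \<Rightarrow> bool" where
  "unit_geodesic \<gamma> \<longleftrightarrow> geodesic_on hyp_metric UNIV \<gamma> \<and>
     (\<forall>t. \<gamma> t \<in> hyp3 \<and> hyp_metric (\<gamma> t) (velocity \<gamma> t) (velocity \<gamma> t) = 1)"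

text \<open>An oriented geodesic is an orbit of the geodesic flow in the unit tangent bundle, whose
  points are the pairs of a base point and a unit vector.\<close>

type_synonym oriented_geodesic = "((real^3) \<times> (real^3)) set"

definition orbit_of :: "(real \<Rightarrow> real^3) \<Rightarrow> oriented_geodesic" where
  "orbit_of \<gamma> = range (\<lambda>t. (\<gamma> t, velocity \<gamma> t))"

definition LH3 :: "oriented_geodesic set" where
  "LH3 = {orbit_of \<gamma> | \<gamma>. unit_geodesic \<gamma>}"

definition perp_jacobi :: "(real \<Rightarrow> real^3) \<Rightarrow> (real \<Rightarrow> real^3) set" where
  "perp_jacobi \<gamma> = {W. smooth_on UNIV W \<and>
     (\<forall>t. hyp_metric (\<gamma> t) (W t) (velocity \<gamma> t) = 0 \<and>
        covariant_along hyp_metric \<gamma> (covariant_along hyp_metric \<gamma> W) t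
        + curvature hyp_metric (\<gamma> t) (W t) (velocity \<gamma> t) (velocity \<gamma> t) = 0)}"

text \<open>For \<open>v\<close> of hyperbolic length 1, i.e. Euclidean length \<open>x $ 0\<close>, the scaled cross product
  is the rotation through \<open>+90\<close> degrees about \<open>v\<close> on the complement of \<open>v\<close>. As \<open>cross3\<close> is
  adapted to the ordering \<open>1, 2, 3 = 0\<close> of the indices, a cyclic permutation of \<open>0, 1, 2\<close>, the
  orientation is that of \<open>dx\<^sup>0 \<and> dx\<^sup>1 \<and> dx\<^sup>2\<close>.\<close>

definition rot90 :: "real^3 \<Rightarrow> real^3 \<Rightarrow> real^3 \<Rightarrow> real^3" where
  "rot90 x v w = (1 / x $ 0) *\<^sub>R cross3 v w"

text \<open>The following three definitions are read on the tangent space of the space of oriented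
  geodesics through its identification with the orthogonal Jacobi fields. The value of
  \<open>L_Omega\<close> on Jacobi fields does not depend on the point of the geodesic, which is taken to
  be the one with parameter \<open>0\<close>.\<close>

definition L_J :: "(real \<Rightarrow> real^3) \<Rightarrow> (real \<Rightarrow> real^3) \<Rightarrow> (real \<Rightarrow> real^3)" where
  "L_J \<gamma> W = (\<lambda>t. rot90 (\<gamma> t) (velocity \<gamma> t) (W t))"

definition L_Omega :: "(real \<Rightarrow> real^3) \<Rightarrow> (real \<Rightarrow> real^3) \<Rightarrow> (real \<Rightarrow> real^3) \<Rightarrow> real" where
  "L_Omega \<gamma> V W =
     hyp_metric (\<gamma> 0) (V 0) (covariant_along hyp_metric \<gamma> W 0)
     - hyp_metric (\<gamma> 0) (W 0) (covariant_along hyp_metric \<gamma> V 0)"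

definition L_G :: "(real \<Rightarrow> real^3) \<Rightarrow> (real \<Rightarrow> real^3) \<Rightarrow> (real \<Rightarrow> real^3) \<Rightarrow> real" where
  "L_G \<gamma> V W = L_Omega \<gamma> (L_J \<gamma> V) W"

text \<open>\<open>jacobi_of \<Phi> u \<xi>\<close> is the isomorphism \<open>h\<close> of the tangent space with the orthogonal Jacobi
  fields, applied to the image of the coordinate vector \<open>\<xi>\<close> at \<open>u\<close> under the family
  \<open>u \<mapsto> \<Phi> u\<close> of unit speed geodesics: the variation field, projected orthogonally to the
  geodesic \<open>\<Phi> u\<close>.\<close>

definition jacobi_of ::
    "(real^4 \<Rightarrow> real \<Rightarrow> real^3) \<Rightarrow> real^4 \<Rightarrow> real^4 \<Rightarrow> real \<Rightarrow> real^3" where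
  "jacobi_of \<Phi> u \<xi> t =
     (let W = frechet_derivative (\<lambda>w. \<Phi> w t) (at u) \<xi>; \<tau> = velocity (\<Phi> u) t
      in W - hyp_metric (\<Phi> u t) W \<tau> *\<^sub>R \<tau>)"

text \<open>The local parametrisations, i.e. the inverses of the charts, of the quotient of the unit
  tangent bundle by the geodesic flow: injective immersions of open subsets of \<open>\<real>\<^sup>4\<close> that lift
  to smooth families of unit speed geodesics.\<close>

definition local_param :: "(real^4) set \<Rightarrow> (real^4 \<Rightarrow> real \<Rightarrow> real^3) \<Rightarrow> bool" where
  "local_param U \<Phi> \<longleftrightarrow> open U \<and> smooth_on (U \<times> UNIV) (\<lambda>(u, t). \<Phi> u t) \<and>
     (\<forall>u\<in>U. unit_geodesic (\<Phi> u)) \<and>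
     inj_on (\<lambda>u. orbit_of (\<Phi> u)) U \<and>
     (\<forall>u\<in>U. inj (jacobi_of \<Phi> u))"

definition chart_metric :: "(real^4 \<Rightarrow> real \<Rightarrow> real^3) \<Rightarrow> (real^4) metric" where
  "chart_metric \<Phi> u \<xi> \<eta> = L_G (\<Phi> u) (jacobi_of \<Phi> u \<xi>) (jacobi_of \<Phi> u \<eta>)"

definition chart_domain ::
    "(real^4) set \<Rightarrow> (real^4 \<Rightarrow> real \<Rightarrow> real^3) \<Rightarrow> real set \<Rightarrow> (real \<Rightarrow> oriented_geodesic) \<Rightarrow> real set" where
  "chart_domain U \<Phi> I c = {s \<in> I. c s \<in> (\<lambda>u. orbit_of (\<Phi> u)) ` U}"

definition chart_curve ::
    "(real^4) set \<Rightarrow> (real^4 \<Rightarrow> real \<Rightarrow> real^3) \<Rightarrow> (real \<Rightarrow> oriented_geodesic) \<Rightarrow> real \<Rightarrow> real^4" where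
  "chart_curve U \<Phi> c s = inv_into U (\<lambda>u. orbit_of (\<Phi> u)) (c s)"

text \<open>A geodesic of the Kaehler metric, defined on an open interval. Openness of the chart
  domains is continuity of the curve.\<close>

definition L_geodesic :: "real set \<Rightarrow> (real \<Rightarrow> oriented_geodesic) \<Rightarrow> bool" where
  "L_geodesic I c \<longleftrightarrow> open I \<and> is_interval I \<and> c ` I \<subseteq> LH3 \<and>
     (\<forall>U \<Phi>. local_param U \<Phi> \<longrightarrow>
        open (chart_domain U \<Phi> I c) \<and>
        geodesic_on (chart_metric \<Phi>) (chart_domain U \<Phi> I c) (chart_curve U \<Phi> c))"

definition L_null :: "real set \<Rightarrow> (real \<Rightarrow> oriented_geodesic) \<Rightarrow> bool" where
  "L_null I c \<longleftrightarrow> (\<forall>U \<Phi>. local_param U \<Phi> \<longrightarrow>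
     (\<forall>s\<in>chart_domain U \<Phi> I c.
        chart_metric \<Phi> (chart_curve U \<Phi> c s)
          (velocity (chart_curve U \<Phi> c) s) (velocity (chart_curve U \<Phi> c) s) = 0))"

text \<open>A vector field on the space of oriented geodesics assigns to every oriented geodesic an
  orthogonal Jacobi field along it. Since the orbits partition the unit tangent bundle, this
  is a single function \<open>V\<close> on the unit tangent bundle whose restriction to every orbit
  is such a Jacobi field; values of \<open>V\<close> elsewhere are irrelevant. Then \<open>chart_field \<Phi> V\<close> is
  the coordinate expression of the vector field, whose smoothness is part of \<open>killing_on\<close>.\<close>

definition chart_field ::
    "(real^4 \<Rightarrow> real \<Rightarrow> real^3) \<Rightarrow> ((real^3) \<times> (real^3) \<Rightarrow> real^3) \<Rightarrow> real^4 \<Rightarrow> real^4" where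
  "chart_field \<Phi> V u = (THE \<xi>. \<forall>t. jacobi_of \<Phi> u \<xi> t = V (\<Phi> u t, velocity (\<Phi> u) t))"

definition L_killing_field :: "((real^3) \<times> (real^3) \<Rightarrow> real^3) \<Rightarrow> bool" where
  "L_killing_field V \<longleftrightarrow>
     (\<forall>\<gamma>. unit_geodesic \<gamma> \<longrightarrow> (\<lambda>t. V (\<gamma> t, velocity \<gamma> t)) \<in> perp_jacobi \<gamma>) \<and>
     (\<forall>U \<Phi>. local_param U \<Phi> \<longrightarrow> killing_on (chart_metric \<Phi>) U (chart_field \<Phi> V))"

definition L_integral_curve ::
    "((real^3) \<times> (real^3) \<Rightarrow> real^3) \<Rightarrow> real set \<Rightarrow> (real \<Rightarrow> oriented_geodesic) \<Rightarrow> bool" where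
  "L_integral_curve V I c \<longleftrightarrow> (\<forall>U \<Phi>. local_param U \<Phi> \<longrightarrow>
     (\<forall>s\<in>chart_domain U \<Phi> I c.
        (chart_curve U \<Phi> c has_vector_derivative chart_field \<Phi> V (chart_curve U \<Phi> c s)) (at s)))"

definition ruled_surface ::
    "real set \<Rightarrow> (real \<Rightarrow> oriented_geodesic) \<Rightarrow> (real \<times> real \<Rightarrow> real^3) \<Rightarrow> bool" where
  "ruled_surface I c f \<longleftrightarrow> smooth_on (UNIV \<times> I) f \<and>
     (\<forall>s\<in>I. unit_geodesic (\<lambda>r. f (r, s)) \<and> orbit_of (\<lambda>r. f (r, s)) = c s)"

definition immersion_at :: "(real \<times> real \<Rightarrow> real^3) \<Rightarrow> real \<times> real \<Rightarrow> bool" where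
  "immersion_at f p \<longleftrightarrow> inj (frechet_derivative f (at p))"

text \<open>The coordinate vector fields are \<open>f\<^sub>r\<close> and \<open>f\<^sub>s\<close>. Since the hyperbolic metric is conformal to
  the Euclidean one, their cross product, rescaled to Euclidean length \<open>x $ 0\<close>, is a unit
  normal of the surface.\<close>

definition unit_normal :: "(real \<times> real \<Rightarrow> real^3) \<Rightarrow> real \<times> real \<Rightarrow> real^3" where
  "unit_normal f p =
     (let n = cross3 (frechet_derivative f (at p) (1, 0)) (frechet_derivative f (at p) (0, 1))
      in (f p $ 0 / norm n) *\<^sub>R n)"

definition first_form ::
    "(real \<times> real \<Rightarrow> real^3) \<Rightarrow> real \<times> real \<Rightarrow> real \<times> real \<Rightarrow> real \<times> real \<Rightarrow> real" where
  "first_form f p a b =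
     hyp_metric (f p) (frechet_derivative f (at p) a) (frechet_derivative f (at p) b)"

definition second_form ::
    "(real \<times> real \<Rightarrow> real^3) \<Rightarrow> real \<times> real \<Rightarrow> real \<times> real \<Rightarrow> real \<times> real \<Rightarrow> real" where
  "second_form f p a b =
     hyp_metric (f p)
       (frechet_derivative (\<lambda>q. frechet_derivative f (at q) b) (at p) a
        + christoffel hyp_metric (f p)
            (frechet_derivative f (at p) a) (frechet_derivative f (at p) b))
       (unit_normal f p)"

text \<open>Half the trace of the second fundamental form with respect to the first.\<close>

definition mean_curvature :: "(real \<times> real \<Rightarrow> real^3) \<Rightarrow> real \<times> real \<Rightarrow> real" where
  "mean_curvature f p =
     (let d1 = (1, 0); d2 = (0, 1);
          E = first_form f p d1 d1; F = first_form f p d1 d2; G = first_form f p d2 d2;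
          e = second_form f p d1 d1; m = second_form f p d1 d2; n = second_form f p d2 d2
      in (E * n - 2 * F * m + G * e) / (2 * (E * G - F\<^sup>2)))"

definition minimal_surface :: "(real \<times> real) set \<Rightarrow> (real \<times> real \<Rightarrow> real^3) \<Rightarrow> bool" where
  "minimal_surface S f \<longleftrightarrow> (\<forall>p\<in>S. immersion_at f p \<longrightarrow> mean_curvature f p = 0)"

definition totally_geodesic :: "(real \<times> real) set \<Rightarrow> (real \<times> real \<Rightarrow> real^3) \<Rightarrow> bool" where
  "totally_geodesic S f \<longleftrightarrow>
     (\<forall>p\<in>S. immersion_at f p \<longrightarrow> (\<forall>a b. second_form f p a b = 0))"

end

theory Submission
  imports Defs
begin

text \<open>
  To an oriented geodesic corresponds the infinitesimal translation along it, an element \<open>m\<close> of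
  \<open>sl(2, \<complex>)\<close> with \<open>\<langle>m, m\<rangle> = 1\<close> for the suitably normalised complex Killing form. This identifies the
  space of oriented geodesics with the complex sphere \<open>\<langle>m, m\<rangle> = 1\<close>. The orthogonal Jacobi field of a
  tangent vector \<open>w\<close> is the restriction of the Killing field of \<open>[m, w]\<close>, the complex structure becomes
  \<open>w \<mapsto> -\<i> [m, w]\<close> and the metric the imaginary part of \<open>\<langle>w, w'\<rangle>\<close>. Its geodesics are therefore the curves with
  \<open>m''\<close> a complex multiple of \<open>m\<close>, for which \<open>a = [m, m']\<close> is constant and \<open>m' = [m, a]\<close>; so they are integral
  curves of the Killing field generated by \<open>a\<close>.

  Along the ruled surface of such a curve the variation field is the Killing field \<open>K\<close> of \<open>a\<close> up to
  a multiple \<open>\<mu>\<close> of the direction \<open>T\<close> of the rulings, and both \<open>K\<close> and the rotation part \<open>R\<close> of \<open>a\<close> are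
  orthogonal to \<open>T\<close>. Hence \<open>\<nabla>\<^sub>K K = R \<times> K\<close> is parallel to \<open>T\<close>, which makes the mean curvature vanish, and the mixed
  coefficient of the second fundamental form is a multiple of \<open>R \<bullet> K\<close>, that is of \<open>Im \<langle>a, a\<rangle>\<close>, which is up to
  sign the square length of the velocity of the curve.
\<close>

section \<open>Smooth maps\<close>

text \<open>At a point \<open>x\<close> an element of sl(2, C) splits into the value K and the
  rotation R of its Killing field, and K + iR is complex linear in it. Since \<Omega> pairs fields
  with derivatives, and the derivative of K is governed by R, only products of a K with an R survive
  in the metric; this is why the imaginary part of the form appears. Tangent spaces of the complex
  sphere are closed under multiplication by i, which recovers the whole complex form wherever
  nondegeneracy is needed. As the sphere lies in a flat space, the connection in any chart is a
  tangential projection, and no Christoffel symbol of the metric is computed in coordinates. Curves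
  of oriented geodesics can be differentiated only inside charts, so a chart around every geodesic
  has to be produced. The charts consist of the geodesics crossing a horosphere
  \<open>x $ 0 = e\<close> transversally. The reciprocal height y satisfies y'' = y along every
  geodesic, which yields such a crossing, the explicit parametrisation and the uniqueness of
  geodesics.\<close>

lemma Ck_on_SucD:
  assumes "Ck_on (Suc k) S f"
  shows "\<And>x. x \<in> S \<Longrightarrow> (f has_derivative frechet_derivative f (at x)) (at x)"
    and "Ck_on k S (\<lambda>x. frechet_derivative f (at x) v)"
  using assms by (auto simp: frechet_derivative_works)

lemma Ck_on_cong:
  assumes "open S" "\<And>x. x \<in> S \<Longrightarrow> f x = g x" "Ck_on k S f"
  shows "Ck_on k S g"
  using assms(2,3)
proof (induction k arbitrary: f g)
  case 0
  then show ?case by (simp cong: continuous_on_cong_simp)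
next
  case (Suc k)
  have diff: "g differentiable (at x)" if "x \<in> S" for x
    using Suc.prems that \<open>open S\<close> unfolding differentiable_def Ck_on.simps
    by (metis has_derivative_transform_within_open)
  have "frechet_derivative f (at x) = frechet_derivative g (at x)" if "x \<in> S" for x
    by (rule frechet_derivative_transform_within_open[of f x S g]) (use Suc.prems that \<open>open S\<close> in auto)
  then have "Ck_on k S (\<lambda>x. frechet_derivative g (at x) v)" for v
    using Suc.IH[OF _ Ck_on_SucD(2)[OF Suc.prems(2), of v]] by simp
  with diff show ?case by simp
qed

lemma Ck_on_Suc_imp_Ck_on: "Ck_on (Suc k) S f \<Longrightarrow> Ck_on k S f"
proof (induction k arbitrary: f)
  case 0
  then show ?case
    by (auto intro!: continuous_at_imp_continuous_on differentiable_imp_continuous_within)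
qed auto

text \<open>By uniqueness of derivatives an explicitly computed one may replace the
  \<open>frechet_derivative\<close> in the recursion of \<open>Ck_on\<close>. This is the induction
  step of the closure proofs that follow.\<close>

lemma Ck_on_SucI:
  assumes "open S" "\<And>x. x \<in> S \<Longrightarrow> (f has_derivative f' x) (at x)" "\<And>v. Ck_on k S (\<lambda>x. f' x v)"
  shows "Ck_on (Suc k) S f"
proof -
  have "f' x = frechet_derivative f (at x)" if "x \<in> S" for x
    using assms(2)[OF that] by (rule frechet_derivative_at)
  then have "Ck_on k S (\<lambda>x. frechet_derivative f (at x) v)" for v
    by (intro Ck_on_cong[OF assms(1) _ assms(3)[of v]]) auto
  then show ?thesis using assms(2) by (auto simp: differentiable_def)
qed

lemma Ck_on_const: "Ck_on k S (\<lambda>x. c)"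
  by (induction k arbitrary: c) auto

lemma Ck_on_bounded_linear:
  assumes "open S" "bounded_linear L" "Ck_on k S f"
  shows "Ck_on k S (\<lambda>x. L (f x))"
  using assms(3)
proof (induction k arbitrary: f)
  case 0
  then show ?case using assms(2) by (auto intro: bounded_linear.continuous_on)
next
  case (Suc k)
  note * = Ck_on_SucD[OF Suc.prems]
  show ?case
    by (rule Ck_on_SucI[OF assms(1) bounded_linear.has_derivative[OF assms(2) *(1)]])
       (auto intro: Suc.IH *(2))
qed

lemma Ck_on_add:
  assumes "open S" "Ck_on k S f" "Ck_on k S g"
  shows "Ck_on k S (\<lambda>x. f x + g x)"
  using assms(2,3)
proof (induction k arbitrary: f g)
  case 0
  then show ?case by (auto intro: continuous_intros)
next
  case (Suc k)
  show ?case
    by (rule Ck_on_SucI[OF assms(1) has_derivative_add[OF Ck_on_SucD(1)[OF Suc.prems(1)] Ck_on_SucD(1)[OF Suc.prems(2)]]], assumption+)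
       (rule Suc.IH[OF Ck_on_SucD(2)[OF Suc.prems(1)] Ck_on_SucD(2)[OF Suc.prems(2)]])
qed

lemma Ck_on_bilinear:
  assumes "open S" "bounded_bilinear B" "Ck_on k S f" "Ck_on k S g"
  shows "Ck_on k S (\<lambda>x. B (f x) (g x))"
  using assms(3,4)
proof (induction k arbitrary: f g)
  case 0
  then show ?case using assms(2) by (auto intro: bounded_bilinear.continuous_on)
next
  case (Suc k)
  show ?case
    by (rule Ck_on_SucI[OF assms(1) bounded_bilinear.FDERIV[OF assms(2) Ck_on_SucD(1)[OF Suc.prems(1)] Ck_on_SucD(1)[OF Suc.prems(2)]]], assumption+)
       (rule Ck_on_add[OF assms(1)
          Suc.IH[OF Ck_on_Suc_imp_Ck_on[OF Suc.prems(1)] Ck_on_SucD(2)[OF Suc.prems(2)]]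
          Suc.IH[OF Ck_on_SucD(2)[OF Suc.prems(1)] Ck_on_Suc_imp_Ck_on[OF Suc.prems(2)]]])
qed

lemma Ck_on_sum:
  assumes "open S" "\<And>i. i \<in> A \<Longrightarrow> Ck_on k S (f i)"
  shows "Ck_on k S (\<lambda>x. \<Sum>i\<in>A. f i x)"
  using assms(2)
  by (induction A rule: infinite_finite_induct) (auto intro: Ck_on_const Ck_on_add[OF assms(1)])

lemma Ck_on_componentwise:
  assumes "open S" "\<And>b. b \<in> Basis \<Longrightarrow> Ck_on k S (\<lambda>x. f x \<bullet> b)"
  shows "Ck_on k S f"
proof -
  have "Ck_on k S (\<lambda>x. \<Sum>b\<in>Basis. (f x \<bullet> b) *\<^sub>R b)"
    by (intro Ck_on_sum assms Ck_on_bounded_linear[OF assms(1) bounded_linear_scaleR_left])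
  then show ?thesis by (simp add: euclidean_representation)
qed

text \<open>The derivative of 1/f is built from 1/f and f', so the induction hypothesis on 1/f
  itself gains one order. The square root and the exponential below bootstrap in the same
  way.\<close>

lemma Ck_on_inverse:
  fixes f :: "'a::euclidean_space \<Rightarrow> real"
  assumes "open S" "Ck_on k S f" "\<And>x. x \<in> S \<Longrightarrow> f x \<noteq> 0"
  shows "Ck_on k S (\<lambda>x. inverse (f x))"
  using assms(2)
proof (induction k)
  case 0
  then show ?case using assms(3) by (auto intro!: continuous_intros)
next
  case (Suc k)
  have "Ck_on k S (\<lambda>x. inverse (f x))"
    using Suc.IH Ck_on_Suc_imp_Ck_on[OF Suc.prems] by blast
  then have "Ck_on k S (\<lambda>x. - (inverse (f x) * frechet_derivative f (at x) v * inverse (f x)))" for v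
    using Ck_on_SucD(2)[OF Suc.prems, of v]
    by (intro Ck_on_bounded_linear[OF assms(1) bounded_linear_minus[OF bounded_linear_ident]]
        Ck_on_bilinear[OF assms(1) bounded_bilinear_mult]) auto
  then show ?case
    by (intro Ck_on_SucI[OF assms(1) Deriv.has_derivative_inverse[OF assms(3) Ck_on_SucD(1)[OF Suc.prems]]]) auto
qed

lemma Ck_on_sqrt:
  fixes f :: "'a::euclidean_space \<Rightarrow> real"
  assumes "open S" "Ck_on k S f" "\<And>x. x \<in> S \<Longrightarrow> f x > 0"
  shows "Ck_on k S (\<lambda>x. sqrt (f x))"
  using assms(2)
proof (induction k)
  case 0
  then show ?case using assms(3) by (auto intro!: continuous_intros)
next
  case (Suc k)
  have "Ck_on k S (\<lambda>x. sqrt (f x))"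
    using Suc.IH Ck_on_Suc_imp_Ck_on[OF Suc.prems] by blast
  then have "Ck_on k S (\<lambda>x. inverse (sqrt (f x)))"
    using assms(3) by (intro Ck_on_inverse[OF assms(1)]) force+
  then have "Ck_on k S (\<lambda>x. frechet_derivative f (at x) v * (inverse (sqrt (f x)) / 2))" for v
    using Ck_on_SucD(2)[OF Suc.prems, of v]
    by (intro Ck_on_bilinear[OF assms(1) bounded_bilinear_mult] 
        Ck_on_bounded_linear[OF assms(1) bounded_linear_divide]) auto
  moreover have "((\<lambda>x. sqrt (f x)) has_derivative
      (\<lambda>v. frechet_derivative f (at x) v * (inverse (sqrt (f x)) / 2))) (at x)" if "x \<in> S" for x
    using has_derivative_real_sqrt[OF assms(3)[OF that] Ck_on_SucD(1)[OF Suc.prems that]]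
    by (simp add: field_simps)
  ultimately show ?case
    by (rule Ck_on_SucI[OF assms(1), rotated])
qed

lemma Ck_on_exp:
  fixes f :: "'a::euclidean_space \<Rightarrow> real"
  assumes "open S" "Ck_on k S f"
  shows "Ck_on k S (\<lambda>x. exp (f x))"
  using assms(2)
proof (induction k)
  case 0
  then show ?case by (auto intro!: continuous_intros)
next
  case (Suc k)
  have "Ck_on k S (\<lambda>x. exp (f x))"
    using Suc.IH Ck_on_Suc_imp_Ck_on[OF Suc.prems] by blast
  then have "Ck_on k S (\<lambda>x. exp (f x) * frechet_derivative f (at x) v)" for v
    using Ck_on_SucD(2)[OF Suc.prems, of v]
    by (intro Ck_on_bilinear[OF assms(1) bounded_bilinear_mult]) auto
  moreover have "((\<lambda>x. exp (f x)) has_derivative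
      (\<lambda>v. exp (f x) * frechet_derivative f (at x) v)) (at x)" if "x \<in> S" for x
    using has_derivative_exp[OF Ck_on_SucD(1)[OF Suc.prems that]] by (simp add: mult.commute)
  ultimately show ?case
    by (rule Ck_on_SucI[OF assms(1), rotated])
qed

text \<open>The inner derivative \<open>A\<close> is constant, so the induction hypothesis applies
  directly to the directional derivatives of \<open>f\<close>. The rule serves to freeze one
  variable of a family and to shift the parameter of a geodesic.\<close>

lemma Ck_on_affine:
  assumes "open S" "open T" "bounded_linear A" "\<And>y. y \<in> T \<Longrightarrow> b + A y \<in> S" "Ck_on k S f"
  shows "Ck_on k T (\<lambda>y. f (b + A y))"
  using assms(5)
proof (induction k arbitrary: f)
  case 0
  have "continuous_on T (\<lambda>y. b + A y)"
    by (intro continuous_on_add continuous_on_const linear_continuous_on assms(3))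
  with 0 show ?case using assms(4)
    by (auto intro: continuous_on_compose2[of S f])
next
  case (Suc k)
  have "((\<lambda>y. b + A y) has_derivative A) (at y)" for y
    using has_derivative_add[OF has_derivative_const bounded_linear_imp_has_derivative[OF assms(3)]] by simp
  then have "((\<lambda>y. f (b + A y)) has_derivative (\<lambda>v. frechet_derivative f (at (b + A y)) (A v))) (at y)"
    if "y \<in> T" for y
    by (rule has_derivative_compose[OF _ Ck_on_SucD(1)[OF Suc.prems]]) (use that assms(4) in auto)
  then show ?case
    by (rule Ck_on_SucI[OF assms(2)]) (auto intro: Suc.IH Ck_on_SucD(2)[OF Suc.prems])
qed

lemma smooth_on_cong:
  "smooth_on S f \<Longrightarrow> open S \<Longrightarrow> (\<And>x. x \<in> S \<Longrightarrow> f x = g x) \<Longrightarrow> smooth_on S g"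
  unfolding smooth_on_def using Ck_on_cong by blast

lemma smooth_on_const: "smooth_on S (\<lambda>x. c)"
  unfolding smooth_on_def by (auto intro: Ck_on_const)

lemma smooth_on_bounded_linear:
  "bounded_linear L \<Longrightarrow> open S \<Longrightarrow> smooth_on S f \<Longrightarrow> smooth_on S (\<lambda>x. L (f x))"
  unfolding smooth_on_def by (auto intro: Ck_on_bounded_linear)

lemma smooth_on_bilinear:
  "bounded_bilinear B \<Longrightarrow> open S \<Longrightarrow> smooth_on S f \<Longrightarrow> smooth_on S g \<Longrightarrow> smooth_on S (\<lambda>x. B (f x) (g x))"
  unfolding smooth_on_def by (auto intro: Ck_on_bilinear)

lemma smooth_on_componentwise:
  "open S \<Longrightarrow> (\<And>b. b \<in> Basis \<Longrightarrow> smooth_on S (\<lambda>x. f x \<bullet> b)) \<Longrightarrow> smooth_on S f"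
  unfolding smooth_on_def by (auto intro: Ck_on_componentwise)

lemma smooth_on_affine:
  "bounded_linear A \<Longrightarrow> open S \<Longrightarrow> open T \<Longrightarrow> (\<And>y. y \<in> T \<Longrightarrow> b + A y \<in> S) \<Longrightarrow> smooth_on S f
    \<Longrightarrow> smooth_on T (\<lambda>y. f (b + A y))"
  unfolding smooth_on_def by (auto intro: Ck_on_affine)

lemma Ck_on_ident: "Ck_on k S (\<lambda>x. x)"
  by (cases k) (auto intro: Ck_on_const)

lemma smooth_on_ident: "smooth_on S (\<lambda>x. x)"
  unfolding smooth_on_def by (auto intro: Ck_on_ident)

lemma smooth_on_add: "open S \<Longrightarrow> smooth_on S f \<Longrightarrow> smooth_on S g \<Longrightarrow> smooth_on S (\<lambda>x. f x + g x)"
  unfolding smooth_on_def by (auto intro: Ck_on_add)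

lemma smooth_on_minus: "open S \<Longrightarrow> smooth_on S f \<Longrightarrow> smooth_on S (\<lambda>x. - f x)"
  by (intro smooth_on_bounded_linear[OF bounded_linear_minus[OF bounded_linear_ident]])

lemma smooth_on_diff: "open S \<Longrightarrow> smooth_on S f \<Longrightarrow> smooth_on S g \<Longrightarrow> smooth_on S (\<lambda>x. f x - g x)"
  using smooth_on_add[of S f "\<lambda>x. - g x"] smooth_on_minus by auto

lemmas smooth_on_mult = smooth_on_bilinear[OF bounded_bilinear_mult]
lemmas smooth_on_scaleR = smooth_on_bilinear[OF bounded_bilinear_scaleR]
lemmas smooth_on_inner = smooth_on_bilinear[OF bounded_bilinear_inner]
lemmas smooth_on_vec_nth = smooth_on_bounded_linear[OF bounded_linear_vec_nth]
lemmas smooth_on_fst = smooth_on_bounded_linear[OF bounded_linear_fst]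
lemmas smooth_on_snd = smooth_on_bounded_linear[OF bounded_linear_snd]

lemma smooth_on_Pair:
  "open S \<Longrightarrow> smooth_on S f \<Longrightarrow> smooth_on S g \<Longrightarrow> smooth_on S (\<lambda>x. (f x, g x))"
  using smooth_on_add[of S "\<lambda>x. (f x, 0)" "\<lambda>x. (0, g x)"]
    smooth_on_bounded_linear[OF bounded_linear_Pair[OF bounded_linear_ident bounded_linear_zero], of S f]
    smooth_on_bounded_linear[OF bounded_linear_Pair[OF bounded_linear_zero bounded_linear_ident], of S g]
  by simp

lemma smooth_on_vec:
  fixes f :: "'a::euclidean_space \<Rightarrow> real^'n"
  assumes "open S" "\<And>i. smooth_on S (\<lambda>x. f x $ i)"
  shows "smooth_on S f"
  by (rule smooth_on_componentwise) (use assms in \<open>auto simp: Basis_vec_def inner_axis\<close>)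

lemma smooth_on_sum:
  "open S \<Longrightarrow> (\<And>i. i \<in> A \<Longrightarrow> smooth_on S (f i)) \<Longrightarrow> smooth_on S (\<lambda>x. \<Sum>i\<in>A. f i x)"
  unfolding smooth_on_def by (auto intro: Ck_on_sum)

lemma smooth_on_prod:
  fixes f :: "'i \<Rightarrow> 'a::euclidean_space \<Rightarrow> real"
  assumes "open S" "\<And>i. i \<in> A \<Longrightarrow> smooth_on S (f i)"
  shows "smooth_on S (\<lambda>x. \<Prod>i\<in>A. f i x)"
  using assms(2)
  by (induction A rule: infinite_finite_induct) (auto intro: smooth_on_const smooth_on_mult assms(1))

lemma smooth_on_power:
  "open S \<Longrightarrow> smooth_on S f \<Longrightarrow> smooth_on S (\<lambda>x. f x ^ n)" for f :: "'a::euclidean_space \<Rightarrow> real"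
  by (induction n) (auto intro: smooth_on_const smooth_on_mult)

lemma smooth_on_inverse:
  "open S \<Longrightarrow> smooth_on S f \<Longrightarrow> (\<And>x. x \<in> S \<Longrightarrow> f x \<noteq> 0) \<Longrightarrow> smooth_on S (\<lambda>x. inverse (f x))"
  for f :: "'a::euclidean_space \<Rightarrow> real"
  unfolding smooth_on_def by (auto intro: Ck_on_inverse)

lemma smooth_on_divide:
  "open S \<Longrightarrow> smooth_on S f \<Longrightarrow> smooth_on S g \<Longrightarrow> (\<And>x. x \<in> S \<Longrightarrow> g x \<noteq> 0) \<Longrightarrow> smooth_on S (\<lambda>x. f x / g x)"
  for f :: "'a::euclidean_space \<Rightarrow> real"
  unfolding divide_inverse by (intro smooth_on_mult smooth_on_inverse)

lemma smooth_on_sqrt: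
  "open S \<Longrightarrow> smooth_on S f \<Longrightarrow> (\<And>x. x \<in> S \<Longrightarrow> f x > 0) \<Longrightarrow> smooth_on S (\<lambda>x. sqrt (f x))"
  for f :: "'a::euclidean_space \<Rightarrow> real"
  unfolding smooth_on_def by (auto intro: Ck_on_sqrt)

lemma smooth_on_exp:
  "open S \<Longrightarrow> smooth_on S f \<Longrightarrow> smooth_on S (\<lambda>x. exp (f x))" for f :: "'a::euclidean_space \<Rightarrow> real"
  unfolding smooth_on_def by (auto intro: Ck_on_exp)

lemma smooth_on_imp_differentiable: "smooth_on S f \<Longrightarrow> x \<in> S \<Longrightarrow> f differentiable (at x)"
  unfolding smooth_on_def by (metis Ck_on.simps(2))

lemma smooth_on_has_derivative:
  "smooth_on S f \<Longrightarrow> x \<in> S \<Longrightarrow> (f has_derivative frechet_derivative f (at x)) (at x)"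
  using smooth_on_imp_differentiable frechet_derivative_works by blast

lemma smooth_on_frechet_derivative:
  "smooth_on S f \<Longrightarrow> smooth_on S (\<lambda>x. frechet_derivative f (at x) v)"
  unfolding smooth_on_def by (metis Ck_on.simps(2))

lemma velocity_eqI: "(f has_vector_derivative f') (at t) \<Longrightarrow> velocity f t = f'"
  unfolding velocity_def by (rule vector_derivative_at)

lemma smooth_on_has_vector_derivative:
  "smooth_on S f \<Longrightarrow> t \<in> S \<Longrightarrow> (f has_vector_derivative velocity f t) (at t)"
  unfolding velocity_def
  by (metis vector_derivative_works smooth_on_imp_differentiable)

lemma velocity_eq_frechet:
  "smooth_on S f \<Longrightarrow> t \<in> S \<Longrightarrow> velocity f t = frechet_derivative f (at t) 1"
  unfolding velocity_def
  by (simp add: frechet_derivative_eq_vector_derivative smooth_on_imp_differentiable)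

lemma smooth_on_velocity: "smooth_on S f \<Longrightarrow> open S \<Longrightarrow> smooth_on S (velocity f)"
  by (rule smooth_on_cong[OF smooth_on_frechet_derivative[of S f 1]]) (auto simp: velocity_eq_frechet)

lemma frechet_derivative_eqI: "(f has_derivative f') (at x) \<Longrightarrow> frechet_derivative f (at x) = f'"
  by (metis frechet_derivative_at)

section \<open>Symmetry of second derivatives; smooth solutions of linear equations\<close>

text \<open>Two applications of the mean value theorem: in direction \<open>u\<close> to the
  difference of \<open>f\<close> across the step \<open>h *\<^sub>R v\<close>, then in direction
  \<open>v\<close> to the resulting difference of derivatives.\<close>

lemma second_difference:
  fixes f :: "'a::euclidean_space \<Rightarrow> real"
  assumes "smooth_on S f" "h > 0"
    and S: "\<And>s t. s \<in> {0..h} \<Longrightarrow> t \<in> {0..h} \<Longrightarrow> x + s *\<^sub>R u + t *\<^sub>R v \<in> S"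
  shows "\<exists>s\<in>{0..h}. \<exists>t\<in>{0..h}.
    f (x + h *\<^sub>R u + h *\<^sub>R v) - f (x + h *\<^sub>R u) - f (x + h *\<^sub>R v) + f x =
    h * (h * frechet_derivative (\<lambda>y. frechet_derivative f (at y) u) (at (x + s *\<^sub>R u + t *\<^sub>R v)) v)"
proof -
  let ?D = "\<lambda>y. frechet_derivative f (at y) u"
  have du: "((\<lambda>s. g (y + s *\<^sub>R w)) has_field_derivative frechet_derivative g (at (y + s *\<^sub>R w)) w) (at s)"
    if "smooth_on S g" "y + s *\<^sub>R w \<in> S" for g :: "'a \<Rightarrow> real" and y w s
  proof -
    have *: "((\<lambda>s. y + s *\<^sub>R w) has_derivative (\<lambda>r. r *\<^sub>R w)) (at s)"
      by (auto intro!: derivative_eq_intros)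
    have g: "(g has_derivative frechet_derivative g (at (y + s *\<^sub>R w))) (at (y + s *\<^sub>R w))"
      using that smooth_on_has_derivative by blast
    have "((\<lambda>s. g (y + s *\<^sub>R w)) has_derivative (\<lambda>r. frechet_derivative g (at (y + s *\<^sub>R w)) (r *\<^sub>R w))) (at s)"
      by (rule has_derivative_compose[OF * g])
    then show ?thesis
      using linear_cmul[OF has_derivative_linear[OF g]]
      by (simp add: has_field_derivative_def mult.commute[of _ "frechet_derivative g _ w"])
  qed
  have 1: "((\<lambda>s. f (x + s *\<^sub>R u + h *\<^sub>R v) - f (x + s *\<^sub>R u)) has_field_derivative
      ?D (x + s *\<^sub>R u + h *\<^sub>R v) - ?D (x + s *\<^sub>R u)) (at s)" if "0 \<le> s" "s \<le> h" for s
    using DERIV_diff[OF du[OF assms(1), of "x + h *\<^sub>R v" s u] du[OF assms(1), of x s u]]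
      S[of s 0] S[of s h] that assms(2) by (simp add: algebra_simps)
  obtain s where s: "0 < s" "s < h" and
    eq1: "f (x + h *\<^sub>R u + h *\<^sub>R v) - f (x + h *\<^sub>R u) - (f (x + 0 *\<^sub>R u + h *\<^sub>R v) - f (x + 0 *\<^sub>R u)) =
      (h - 0) * (?D (x + s *\<^sub>R u + h *\<^sub>R v) - ?D (x + s *\<^sub>R u))"
    using MVT2[OF assms(2) 1] by auto
  have 2: "((\<lambda>t. ?D (x + s *\<^sub>R u + t *\<^sub>R v)) has_field_derivative
      frechet_derivative ?D (at (x + s *\<^sub>R u + t *\<^sub>R v)) v) (at t)" if "0 \<le> t" "t \<le> h" for t
    by (rule du[OF smooth_on_frechet_derivative[OF assms(1)]]) (use S s that in auto)
  obtain t where t: "0 < t" "t < h" and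
    eq2: "?D (x + s *\<^sub>R u + h *\<^sub>R v) - ?D (x + s *\<^sub>R u + 0 *\<^sub>R v) =
      (h - 0) * frechet_derivative ?D (at (x + s *\<^sub>R u + t *\<^sub>R v)) v"
    using MVT2[OF assms(2) 2] by auto
  show ?thesis
    using eq1 eq2 s t by (intro bexI[of _ s] bexI[of _ t]) auto
qed

text \<open>The second difference is symmetric in \<open>u\<close> and \<open>v\<close>, so the two
  mixed derivatives agree at suitable points arbitrarily close to \<open>x\<close>; continuity
  excludes a gap at \<open>x\<close>.\<close>

lemma frechet_derivative_symmetric_real:
  fixes f :: "'a::euclidean_space \<Rightarrow> real"
  assumes "smooth_on S f" "open S" "x \<in> S"
  shows "frechet_derivative (\<lambda>y. frechet_derivative f (at y) u) (at x) v =
    frechet_derivative (\<lambda>y. frechet_derivative f (at y) v) (at x) u"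
proof (rule ccontr)
  let ?D = "\<lambda>u v y. frechet_derivative (\<lambda>y. frechet_derivative f (at y) u) (at y) v"
  assume neq: "?D u v x \<noteq> ?D v u x"
  define e where "e = \<bar>?D u v x - ?D v u x\<bar> / 2"
  have e: "e > 0" using neq by (simp add: e_def)
  have "\<exists>d>0. \<forall>y. dist y x < d \<longrightarrow> y \<in> S \<and> dist (?D u v y) (?D u v x) < e" for u v
  proof -
    have "isCont (?D u v) x"
      using smooth_on_imp_differentiable[OF smooth_on_frechet_derivative[OF smooth_on_frechet_derivative[OF assms(1)]] assms(3)]
      by (rule differentiable_imp_continuous_within)
    then obtain d1 where d1: "d1 > 0" "\<And>y. dist y x < d1 \<Longrightarrow> dist (?D u v y) (?D u v x) < e"
      using e by (auto simp: continuous_at_eps_delta)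
    obtain d2 where d2: "d2 > 0" "\<And>y. dist y x < d2 \<Longrightarrow> y \<in> S"
      using assms(2,3) by (auto simp: open_dist)
    show ?thesis using d1 d2 by (intro exI[of _ "min d1 d2"]) auto
  qed
  note cont = this
  obtain d1 where d1: "d1 > 0" "\<And>y. dist y x < d1 \<Longrightarrow> y \<in> S \<and> dist (?D u v y) (?D u v x) < e"
    using cont[of u v] by blast
  obtain d2 where d2: "d2 > 0" "\<And>y. dist y x < d2 \<Longrightarrow> y \<in> S \<and> dist (?D v u y) (?D v u x) < e"
    using cont[of v u] by blast
  \<comment> \<open>Small enough for the parallelogram with sides \<open>h *\<^sub>R u\<close> and
    \<open>h *\<^sub>R v\<close> to stay in both balls; the summand 1 avoids a zero denominator and
    makes the bounds strict.\<close>
  define h where "h = min d1 d2 / (norm u + norm v + 1)"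
  have h: "h > 0" "h * (norm u + norm v) < d1" "h * (norm u + norm v) < d2"
  proof -
    have p: "norm u + norm v + 1 > 0" by (smt (verit) norm_ge_zero)
    show "h > 0" using d1 d2 p by (simp add: h_def)
    have "h * (norm u + norm v + 1) = min d1 d2" using p by (simp add: h_def)
    with \<open>h > 0\<close> show "h * (norm u + norm v) < d1" "h * (norm u + norm v) < d2"
      by (auto simp: algebra_simps)
  qed
  have near: "dist (x + s *\<^sub>R u + t *\<^sub>R v) x \<le> h * (norm u + norm v)"
    if "s \<in> {0..h}" "t \<in> {0..h}" for s t
  proof -
    have "dist (x + s *\<^sub>R u + t *\<^sub>R v) x = norm (s *\<^sub>R u + t *\<^sub>R v)" by (simp add: dist_norm)
    also have "\<dots> \<le> s * norm u + t * norm v" using that norm_triangle_ineq[of "s *\<^sub>R u" "t *\<^sub>R v"] by simp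
    also have "\<dots> \<le> h * norm u + h * norm v"
      using that by (intro add_mono mult_right_mono) auto
    finally show ?thesis by (simp add: algebra_simps)
  qed
  obtain s t where st: "s \<in> {0..h}" "t \<in> {0..h}"
    "f (x + h *\<^sub>R u + h *\<^sub>R v) - f (x + h *\<^sub>R u) - f (x + h *\<^sub>R v) + f x = h * (h * ?D u v (x + s *\<^sub>R u + t *\<^sub>R v))"
    using second_difference[OF assms(1) h(1), of x u v] near d1 h by (meson le_less_trans)
  have near': "dist (x + s *\<^sub>R v + t *\<^sub>R u) x \<le> h * (norm u + norm v)"
    if "s \<in> {0..h}" "t \<in> {0..h}" for s t
    using near[OF that(2,1)] by (simp add: algebra_simps)
  obtain s' t' where st': "s' \<in> {0..h}" "t' \<in> {0..h}"
    "f (x + h *\<^sub>R v + h *\<^sub>R u) - f (x + h *\<^sub>R v) - f (x + h *\<^sub>R u) + f x = h * (h * ?D v u (x + s' *\<^sub>R v + t' *\<^sub>R u))"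
    using second_difference[OF assms(1) h(1), of x v u] near' d1 h by (meson le_less_trans)
  have "h * (h * ?D u v (x + s *\<^sub>R u + t *\<^sub>R v)) = h * (h * ?D v u (x + s' *\<^sub>R v + t' *\<^sub>R u))"
    unfolding st(3)[symmetric] st'(3)[symmetric] by (simp add: algebra_simps)
  then have "?D u v (x + s *\<^sub>R u + t *\<^sub>R v) = ?D v u (x + s' *\<^sub>R v + t' *\<^sub>R u)"
    using h(1) by simp
  moreover have "dist (?D u v (x + s *\<^sub>R u + t *\<^sub>R v)) (?D u v x) < e"
    using d1(2) near[OF st(1,2)] h(2) by (meson le_less_trans)
  moreover have "dist (?D v u (x + s' *\<^sub>R v + t' *\<^sub>R u)) (?D v u x) < e"
    using d2(2) near'[OF st'(1,2)] h(3) by (meson le_less_trans)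
  moreover have "p = q \<Longrightarrow> \<bar>p - P\<bar> < \<bar>P - Q\<bar> / 2 \<Longrightarrow> \<bar>q - Q\<bar> < \<bar>P - Q\<bar> / 2 \<Longrightarrow> False" for p q P Q :: real
    by (smt (verit) field_sum_of_halves)
  ultimately show False unfolding e_def dist_real_def by blast
qed

lemma frechet_derivative_bounded_linear:
  assumes "bounded_linear L" "f differentiable (at x)"
  shows "frechet_derivative (\<lambda>y. L (f y)) (at x) u = L (frechet_derivative f (at x) u)"
proof -
  have "(f has_derivative frechet_derivative f (at x)) (at x)"
    using assms(2) by (simp add: frechet_derivative_works)
  from bounded_linear.has_derivative[OF assms(1) this] show ?thesis
    by (simp add: frechet_derivative_eqI)
qed

lemma frechet_derivative_symmetric:
  fixes f :: "'a::euclidean_space \<Rightarrow> 'b::euclidean_space"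
  assumes f: "smooth_on S f" and S: "open S" "x \<in> S"
  shows "frechet_derivative (\<lambda>y. frechet_derivative f (at y) u) (at x) v =
    frechet_derivative (\<lambda>y. frechet_derivative f (at y) v) (at x) u"
proof (rule euclidean_eqI)
  fix b :: 'b assume "b \<in> Basis"
  have *: "frechet_derivative (\<lambda>y. frechet_derivative (\<lambda>z. f z \<bullet> b) (at y) u) (at x) v =
    frechet_derivative (\<lambda>y. frechet_derivative f (at y) u) (at x) v \<bullet> b" for u v
  proof -
    have "frechet_derivative (\<lambda>y. frechet_derivative (\<lambda>z. f z \<bullet> b) (at y) u) (at x)
        = frechet_derivative (\<lambda>y. frechet_derivative f (at y) u \<bullet> b) (at x)"
      by (rule frechet_derivative_transform_within_open[of _ _ S])
        (use S smooth_on_inner[OF S(1) f smooth_on_const]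
          frechet_derivative_bounded_linear[OF bounded_linear_inner_left smooth_on_imp_differentiable[OF f]]
          in \<open>auto intro: smooth_on_imp_differentiable smooth_on_frechet_derivative\<close>)
    moreover have "frechet_derivative (\<lambda>y. frechet_derivative f (at y) u \<bullet> b) (at x) v
        = frechet_derivative (\<lambda>y. frechet_derivative f (at y) u) (at x) v \<bullet> b"
      by (rule frechet_derivative_bounded_linear[OF bounded_linear_inner_left])
        (auto intro: smooth_on_imp_differentiable[OF _ S(2)] smooth_on_frechet_derivative[OF f])
    ultimately show ?thesis by simp
  qed
  show "frechet_derivative (\<lambda>y. frechet_derivative f (at y) u) (at x) v \<bullet> b =
    frechet_derivative (\<lambda>y. frechet_derivative f (at y) v) (at x) u \<bullet> b"
    using frechet_derivative_symmetric_real[OF smooth_on_inner[OF S(1) f smooth_on_const] S, of b u v]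
    by (simp add: *)
qed

text \<open>The normal equations have the Gram matrix of the columns of \<open>L x\<close>, which is
  invertible because its quadratic form is the square norm of \<open>L x v\<close>. Cramer's rule
  then writes the solution as a quotient of smooth determinants. This gives smoothness of the
  coordinate expressions of Killing fields.\<close>

lemma Gram_solution_smooth:
  fixes L :: "'a::euclidean_space \<Rightarrow> real^'n \<Rightarrow> 'b::euclidean_space" and X :: "'a \<Rightarrow> real^'n"
  assumes S: "open S" and L: "\<And>x. x \<in> S \<Longrightarrow> linear (L x)" "\<And>x. x \<in> S \<Longrightarrow> inj (L x)"
    and smooth: "\<And>v. smooth_on S (\<lambda>x. L x v)" "smooth_on S b"
    and X: "\<And>x. x \<in> S \<Longrightarrow> L x (X x) = b x"
  shows "smooth_on S X"
proof -
  define A :: "'a \<Rightarrow> real^'n^'n" where "A x = (\<chi> i j. L x (axis i 1) \<bullet> L x (axis j 1))" for x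
  define c :: "'a \<Rightarrow> real^'n" where "c x = (\<chi> i. L x (axis i 1) \<bullet> b x)" for x
  have Lsum: "L x v = (\<Sum>j\<in>UNIV. v $ j *\<^sub>R L x (axis j 1))" if "x \<in> S" for x v
  proof -
    have "L x v = L x (\<Sum>j\<in>UNIV. v $ j *\<^sub>R axis j 1)"
      by (simp add: basis_expansion flip: scalar_mult_eq_scaleR)
    then show ?thesis using L(1)[OF that] by (simp add: linear_sum linear_cmul)
  qed
  have AX: "(A x *v v) $ i = L x (axis i 1) \<bullet> L x v" if "x \<in> S" for x v i
    unfolding Lsum[OF that, of v]
    by (simp add: A_def matrix_vector_mult_def inner_sum_right mult.commute)
  have det: "det (A x) \<noteq> 0" if x: "x \<in> S" for x
  proof -
    have "v = 0" if "A x *v v = 0" for v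
    proof -
      have "L x v \<bullet> w = (\<Sum>j\<in>UNIV. v $ j * (L x (axis j 1) \<bullet> w))" for w
        by (subst Lsum[OF x]) (simp add: inner_sum_left)
      then have "L x v \<bullet> L x v = (\<Sum>j\<in>UNIV. v $ j * (A x *v v) $ j)"
        by (simp add: AX[OF x])
      then have "L x v = 0" using that by simp
      then show "v = 0" using L[OF x] by (metis injD linear_0)
    qed
    then show ?thesis
      by (metis det_nz_iff_inj injI inj_matrix_vector_mult invertible_det_nz linear_injective_0 matrix_vector_mul_linear matrix_left_invertible_ker invertible_left_inverse)
  qed
  have eq: "X x = (\<chi> k. det (\<chi> i j. if j = k then c x $ i else A x $ i $ j) / det (A x))" if "x \<in> S" for x
  proof (subst cramer[symmetric, OF det[OF that]])
    show "A x *v X x = c x" using AX[OF that, of "X x"] X[OF that] by (simp add: vec_eq_iff c_def)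
  qed
  have smooth_det: "smooth_on S (\<lambda>x. det (M x))" if "\<And>i j. smooth_on S (\<lambda>x. M x $ i $ j)" for M :: "'a \<Rightarrow> real^'n^'n"
    unfolding det_def by (intro smooth_on_sum smooth_on_mult smooth_on_prod smooth_on_const S that)
  have A: "smooth_on S (\<lambda>x. A x $ i $ j)" for i j
    unfolding A_def by (simp add: smooth_on_inner smooth S)
  have c: "smooth_on S (\<lambda>x. c x $ i)" for i
    unfolding c_def by (simp add: smooth_on_inner smooth S)
  show ?thesis
  proof (rule smooth_on_vec[OF S])
    fix k
    have "smooth_on S (\<lambda>x. det (\<chi> i j. if j = k then c x $ i else A x $ i $ j) / det (A x))"
    proof (intro smooth_on_divide smooth_det S A det)
      show "smooth_on S (\<lambda>x. (\<chi> i j. if j = k then c x $ i else A x $ i $ j) $ i $ j)" for i j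
        by (cases "j = k") (simp_all add: A c)
    qed
    then show "smooth_on S (\<lambda>x. X x $ k)"
      by (rule smooth_on_cong[OF _ S]) (simp add: eq)
  qed
qed

section \<open>Killing fields of hyperbolic space\<close>

text \<open>\<open>(\<alpha>, \<beta>, \<gamma>)\<close> stands for the holomorphic vector field \<open>(\<alpha> + \<beta>\<zeta> + \<gamma>\<zeta>\<^sup>2) \<partial>\<^sub>\<zeta>\<close> on the boundary sphere,
  \<open>\<zeta> = x\<^sup>1 + \<i> x\<^sup>2\<close>, whose extension to a Killing field of hyperbolic space is \<open>killing\<close>. The bracket is
  that of vector fields and \<open>kform\<close> is the polarised discriminant, a multiple of the Killing form.\<close>

type_synonym sl2 = "complex \<times> complex \<times> complex"

definition horiz :: "real^3 \<Rightarrow> complex" where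
  "horiz x = Complex (x $ 1) (x $ 2)"

definition height_vec :: "real \<Rightarrow> complex \<Rightarrow> real^3" where
  "height_vec r z = (\<chi> i. if i = 0 then r else if i = 1 then Re z else Im z)"

definition cscale :: "complex \<Rightarrow> sl2 \<Rightarrow> sl2" where
  "cscale c = (\<lambda>(\<alpha>, \<beta>, \<gamma>). (c * \<alpha>, c * \<beta>, c * \<gamma>))"

definition kform :: "sl2 \<Rightarrow> sl2 \<Rightarrow> complex" where
  "kform = (\<lambda>(\<alpha>, \<beta>, \<gamma>) (\<alpha>', \<beta>', \<gamma>'). \<beta> * \<beta>' - 2 * \<alpha> * \<gamma>' - 2 * \<gamma> * \<alpha>')"

definition bracket :: "sl2 \<Rightarrow> sl2 \<Rightarrow> sl2" where
  "bracket = (\<lambda>(\<alpha>, \<beta>, \<gamma>) (\<alpha>', \<beta>', \<gamma>').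
    (\<alpha> * \<beta>' - \<beta> * \<alpha>', 2 * (\<alpha> * \<gamma>' - \<gamma> * \<alpha>'), \<beta> * \<gamma>' - \<gamma> * \<beta>'))"

definition killing :: "sl2 \<Rightarrow> real^3 \<Rightarrow> real^3" where
  "killing = (\<lambda>(\<alpha>, \<beta>, \<gamma>) x. height_vec (x $ 0 * Re (\<beta> + 2 * \<gamma> * horiz x))
    (\<alpha> + \<beta> * horiz x + \<gamma> * (horiz x)\<^sup>2 - cnj \<gamma> * of_real ((x $ 0)\<^sup>2)))"

text \<open>The covariant derivative of the Killing field of \<open>a\<close> at \<open>x\<close> is the rotation
  \<open>X \<mapsto> rotor a x \<times> X\<close>, up to the conformal factor: see \<open>killing_has_derivative\<close>.\<close>

definition rotor :: "sl2 \<Rightarrow> real^3 \<Rightarrow> real^3" where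
  "rotor a = killing (cscale (- \<i>) a)"

text \<open>The infinitesimal translation along the geodesic through \<open>x\<close> with unit velocity \<open>v\<close>, determined by
  its value \<open>v\<close> and its vanishing rotation part at \<open>x\<close>.\<close>

definition momentum :: "real^3 \<Rightarrow> real^3 \<Rightarrow> sl2" where
  "momentum x v =
    (let h = horiz x; b = of_real (v $ 0 / x $ 0); g = - cnj (horiz v) / of_real (2 * (x $ 0)\<^sup>2)
     in (horiz v / 2 - b * h + g * h\<^sup>2, b - 2 * g * h, g))"

text \<open>The Christoffel map of a conformally flat metric with factor exp(2\<phi>), namely
  d\<phi>(u) v + d\<phi>(v) u - (u . v) grad \<phi>, for \<phi> = - ln \<open>x $ 0\<close>.\<close>

definition hyp_Gamma :: "real^3 \<Rightarrow> real^3 \<Rightarrow> real^3 \<Rightarrow> real^3" where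
  "hyp_Gamma x u v = (- 1 / x $ 0) *\<^sub>R (u $ 0 *\<^sub>R v + v $ 0 *\<^sub>R u - (u \<bullet> v) *\<^sub>R axis 0 1)"

lemma three_eq_zero [simp]: "(3::3) = 0" by simp

lemma vec3_eq_iff: "x = y \<longleftrightarrow> x $ 0 = y $ 0 \<and> x $ 1 = y $ 1 \<and> x $ 2 = y $ 2" for x y :: "'a^3"
  by (auto simp: vec_eq_iff forall_3)

lemma height_vec_nth [simp]: "height_vec r z $ 0 = r" "height_vec r z $ 1 = Re z" "height_vec r z $ 2 = Im z"
  by (simp_all add: height_vec_def)

lemma inner_vec3: "x \<bullet> y = x $ 0 * y $ 0 + x $ 1 * y $ 1 + x $ 2 * y $ 2" for x y :: "real^3"
  by (simp add: inner_vec_def sum_3)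

lemma cross3_nth [simp]:
  "cross3 x y $ 0 = x $ 1 * y $ 2 - x $ 2 * y $ 1"
  "cross3 x y $ 1 = x $ 2 * y $ 0 - x $ 0 * y $ 2"
  "cross3 x y $ 2 = x $ 0 * y $ 1 - x $ 1 * y $ 0"
  by (simp_all add: cross3_def flip: three_eq_zero)

lemma horiz_sel [simp]: "Re (horiz x) = x $ 1" "Im (horiz x) = x $ 2"
  by (simp_all add: horiz_def)

lemma axis0_nth [simp]: "axis 0 (1::real) $ (0::3) = 1" "axis 0 (1::real) $ (1::3) = 0" "axis 0 (1::real) $ (2::3) = 0"
  by (simp_all add: axis_def)

lemma sl2_eq_iff: "a = b \<longleftrightarrow> fst a = fst b \<and> fst (snd a) = fst (snd b) \<and> snd (snd a) = snd (snd b)" for a b :: sl2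
  by (auto simp: prod_eq_iff)

lemmas sl2_simps = cscale_def kform_def bracket_def killing_def rotor_def split_beta

lemma killing_linear:
  "killing (a + b) x = killing a x + killing b x" "killing (a - b) x = killing a x - killing b x"
  "killing (r *\<^sub>R a) x = r *\<^sub>R killing a x" "killing 0 x = 0" "killing (- a) x = - killing a x"
  by (simp_all add: killing_def split_beta vec3_eq_iff algebra_simps)

lemma cscale_linear:
  "cscale c (a + b) = cscale c a + cscale c b" "cscale c (a - b) = cscale c a - cscale c b"
  "cscale c (r *\<^sub>R a) = r *\<^sub>R cscale c a" "cscale c 0 = 0" "cscale c (- a) = - cscale c a"
  by (simp_all add: cscale_def split_beta algebra_simps zero_prod_def)

text \<open>Equivalently, \<open>killing a x\<close> + i \<open>rotor a x\<close> is complex linear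
  in \<open>a\<close>. Up to powers of \<open>x $ 0\<close>, the identities below say that this map
  into C^3 turns \<open>kform\<close> into the complex dot product and \<open>bracket\<close> into i
  times the cross product.\<close>

lemma killing_cscale: "killing (cscale c a) x = Re c *\<^sub>R killing a x - Im c *\<^sub>R rotor a x"
  by (simp add: sl2_simps vec3_eq_iff power2_eq_square algebra_simps)

lemma rotor_cscale: "rotor (cscale c a) x = Re c *\<^sub>R rotor a x + Im c *\<^sub>R killing a x"
  by (simp add: sl2_simps vec3_eq_iff power2_eq_square algebra_simps)

lemma killing_momentum: "x $ 0 > 0 \<Longrightarrow> killing (momentum x v) x = v"
  by (simp add: killing_def momentum_def Let_def vec3_eq_iff power2_eq_square field_simps)

lemma rotor_momentum: "x $ 0 > 0 \<Longrightarrow> rotor (momentum x v) x = 0"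
  by (simp add: rotor_def cscale_def killing_def momentum_def Let_def vec3_eq_iff power2_eq_square field_simps)

lemma Im_kform: "(x $ 0)\<^sup>2 * Im (kform a b) = killing a x \<bullet> rotor b x + rotor a x \<bullet> killing b x"
  by (simp add: sl2_simps inner_vec3 power2_eq_square) algebra

lemma Re_kform: "(x $ 0)\<^sup>2 * Re (kform a b) = killing a x \<bullet> killing b x - rotor a x \<bullet> rotor b x"
  by (simp add: sl2_simps inner_vec3 power2_eq_square) algebra

lemma killing_bracket: "x $ 0 *\<^sub>R killing (bracket a b) x = - (cross3 (killing a x) (rotor b x) + cross3 (rotor a x) (killing b x))"
  by (simp add: sl2_simps vec3_eq_iff power2_eq_square) algebra

text \<open>The double cross product formula. If \<open>kform m m = 1\<close>, it makes
  \<open>bracket m\<close> an involution on the complement of \<open>m\<close>, the fact behind most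
  computations below.\<close>

lemma bracket_bracket: "bracket a (bracket a b) = cscale (kform a a) b - cscale (kform a b) a"
  by (simp add: sl2_simps sl2_eq_iff algebra_simps)

lemma kform_bracket: "kform (bracket a b) c = - kform b (bracket a c)"
  by (simp add: sl2_simps algebra_simps)

lemma kform_bracket_left [simp]: "kform a (bracket a b) = 0"
  by (simp add: sl2_simps algebra_simps)

lemma kform_commute: "kform a b = kform b a"
  by (simp add: sl2_simps algebra_simps)

lemma bracket_self [simp]: "bracket a a = 0"
  by (simp add: sl2_simps algebra_simps zero_prod_def)

lemma bracket_cscale: "bracket (cscale c a) b = cscale c (bracket a b)" "bracket a (cscale c b) = cscale c (bracket a b)"
  by (simp_all add: sl2_simps algebra_simps)

lemma kform_cscale: "kform (cscale c a) b = c * kform a b" "kform a (cscale c b) = c * kform a b"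
  by (simp_all add: sl2_simps algebra_simps)

lemma cscale_0_1 [simp]: "cscale 0 a = 0" "cscale 1 a = a"
  by (simp_all add: sl2_simps zero_prod_def)

lemma kform_nondegenerate:
  assumes "\<And>b. kform a b = 0"
  shows "a = 0"
  using assms[of "(1, 0, 0)"] assms[of "(0, 1, 0)"] assms[of "(0, 0, 1)"]
  by (simp add: kform_def split_beta sl2_eq_iff)

text \<open>A Killing field is determined by its first-order data at one point; here both parts of
  \<open>kform a b\<close> are read off at \<open>x\<close>. It lifts identities at a point of the
  half-space to identities in \<open>sl2\<close>.\<close>

lemma killing_rotor_eq_0:
  assumes "x $ 0 > 0" "killing a x = 0" "rotor a x = 0"
  shows "a = 0"
proof (rule kform_nondegenerate)
  fix b show "kform a b = 0"
    using Im_kform[of x a b] Re_kform[of x a b] assms by (simp add: complex_eq_iff)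
qed

lemma hyp_Gamma_linear:
  "hyp_Gamma x (u + u') v = hyp_Gamma x u v + hyp_Gamma x u' v" "hyp_Gamma x u (v + v') = hyp_Gamma x u v + hyp_Gamma x u v'"
  "hyp_Gamma x (r *\<^sub>R u) v = r *\<^sub>R hyp_Gamma x u v" "hyp_Gamma x u (r *\<^sub>R v) = r *\<^sub>R hyp_Gamma x u v"
  "hyp_Gamma x 0 v = 0" "hyp_Gamma x u 0 = 0"
  by (simp_all add: hyp_Gamma_def vec3_eq_iff inner_vec3 algebra_simps)

lemma bounded_linear_horiz: "bounded_linear horiz"
  by (intro linear_conv_bounded_linear[THEN iffD1] linearI) (simp_all add: complex_eq_iff)

lemma bounded_linear_height_vec: "bounded_linear (\<lambda>p. height_vec (fst p) (snd p))"
  by (intro linear_conv_bounded_linear[THEN iffD1] linearI) (simp_all add: vec3_eq_iff)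

lemma height_vec_has_derivative:
  assumes "(r has_derivative r') (at y)" "(z has_derivative z') (at y)"
  shows "((\<lambda>y. height_vec (r y) (z y)) has_derivative (\<lambda>\<xi>. height_vec (r' \<xi>) (z' \<xi>))) (at y)"
  using bounded_linear.has_derivative[OF bounded_linear_height_vec has_derivative_Pair[OF assms]] by simp

text \<open>For constant \<open>A\<close> this is the covariant formula of the Killing equation,
  with the connection term moved to the right. The element may vary with \<open>y\<close> so that
  the rule also applies to the momentum of a varying geodesic.\<close>

lemma killing_has_derivative:
  assumes A: "(A has_derivative A') (at y)" and f: "(f has_derivative f') (at y)" and "f y $ 0 \<noteq> 0"
  shows "((\<lambda>y. killing (A y) (f y)) has_derivative (\<lambda>\<xi>. killing (A' \<xi>) (f y)
    + ((1 / f y $ 0) *\<^sub>R cross3 (rotor (A y) (f y)) (f' \<xi>) - hyp_Gamma (f y) (f' \<xi>) (killing (A y) (f y))))) (at y)"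
proof -
  note [derivative_intros] = bounded_linear.has_derivative[OF bounded_linear_horiz]
    bounded_linear.has_derivative[OF bounded_linear_vec_nth] has_derivative_cnj
  have "((\<lambda>y. killing (A y) (f y)) has_derivative (\<lambda>\<xi>. height_vec
     (f' \<xi> $ 0 * Re (fst (snd (A y)) + 2 * snd (snd (A y)) * horiz (f y))
       + f y $ 0 * Re (fst (snd (A' \<xi>)) + 2 * snd (snd (A' \<xi>)) * horiz (f y) + 2 * snd (snd (A y)) * horiz (f' \<xi>)))
     (fst (A' \<xi>) + fst (snd (A' \<xi>)) * horiz (f y) + fst (snd (A y)) * horiz (f' \<xi>)
       + snd (snd (A' \<xi>)) * (horiz (f y))\<^sup>2 + snd (snd (A y)) * (2 * horiz (f y) * horiz (f' \<xi>))
       - cnj (snd (snd (A' \<xi>))) * of_real ((f y $ 0)\<^sup>2)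
       - cnj (snd (snd (A y))) * of_real (2 * f y $ 0 * f' \<xi> $ 0)))) (at y)"
    unfolding killing_def split_beta
    by (rule has_derivative_eq_rhs, rule height_vec_has_derivative)
      (rule derivative_eq_intros A f refl | simp add: algebra_simps)+
  moreover have "height_vec
     (f' \<xi> $ 0 * Re (fst (snd (A y)) + 2 * snd (snd (A y)) * horiz (f y))
       + f y $ 0 * Re (fst (snd (A' \<xi>)) + 2 * snd (snd (A' \<xi>)) * horiz (f y) + 2 * snd (snd (A y)) * horiz (f' \<xi>)))
     (fst (A' \<xi>) + fst (snd (A' \<xi>)) * horiz (f y) + fst (snd (A y)) * horiz (f' \<xi>)
       + snd (snd (A' \<xi>)) * (horiz (f y))\<^sup>2 + snd (snd (A y)) * (2 * horiz (f y) * horiz (f' \<xi>))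
       - cnj (snd (snd (A' \<xi>))) * of_real ((f y $ 0)\<^sup>2)
       - cnj (snd (snd (A y))) * of_real (2 * f y $ 0 * f' \<xi> $ 0))
    = killing (A' \<xi>) (f y)
    + ((1 / f y $ 0) *\<^sub>R cross3 (rotor (A y) (f y)) (f' \<xi>) - hyp_Gamma (f y) (f' \<xi>) (killing (A y) (f y)))" for \<xi>
    using assms(3)
    by (simp add: sl2_simps hyp_Gamma_def vec3_eq_iff inner_vec3 power2_eq_square field_simps)
  ultimately show ?thesis by simp
qed

section \<open>Connection and curvature of the half-space\<close>

lemma hyp3_iff [simp]: "x \<in> hyp3 \<longleftrightarrow> x $ 0 > 0"
  by (simp add: hyp3_def)

lemma open_vec0_pos: "open {x::real^3. x $ 0 > 0}"
  by (intro open_Collect_less continuous_intros)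

lemma vec_nth_has_derivative:
  "(f has_derivative f') F \<Longrightarrow> ((\<lambda>y. f y $ i) has_derivative (\<lambda>\<xi>. f' \<xi> $ i)) F"
  by (rule bounded_linear.has_derivative[OF bounded_linear_vec_nth])

lemma christoffel_eqI:
  assumes "\<And>z. g x w z = (frechet_derivative (\<lambda>y. g y v z) (at x) u
      + frechet_derivative (\<lambda>y. g y u z) (at x) v
      - frechet_derivative (\<lambda>y. g y u v) (at x) z) / 2"
    and "\<And>w w'. (\<And>z. g x w z = g x w' z) \<Longrightarrow> w = w'"
  shows "christoffel g x u v = w"
  unfolding christoffel_def using assms by (intro the_equality) (blast, metis)

lemma frechet_hyp_metric:
  assumes "x $ 0 > 0"
  shows "frechet_derivative (\<lambda>y. hyp_metric y v z) (at x) u = - 2 * (v \<bullet> z) * u $ 0 / (x $ 0) ^ 3"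
proof -
  have "((\<lambda>y. hyp_metric y v z) has_derivative (\<lambda>u. - 2 * (v \<bullet> z) * u $ 0 / (x $ 0) ^ 3)) (at x)"
    unfolding hyp_metric_def using assms
    by (auto intro!: derivative_eq_intros vec_nth_has_derivative
        simp: fun_eq_iff field_simps power2_eq_square power3_eq_cube power4_eq_xxxx)
  then show ?thesis by (simp add: frechet_derivative_eqI)
qed

lemma christoffel_hyp: 
  assumes "x $ 0 > 0"
  shows "christoffel hyp_metric x u v = hyp_Gamma x u v"
proof (rule christoffel_eqI)
  fix z
  show "hyp_metric x (hyp_Gamma x u v) z = (frechet_derivative (\<lambda>y. hyp_metric y v z) (at x) u
      + frechet_derivative (\<lambda>y. hyp_metric y u z) (at x) v
      - frechet_derivative (\<lambda>y. hyp_metric y u v) (at x) z) / 2"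
    using assms
    by (simp add: frechet_hyp_metric) (simp add: hyp_metric_def hyp_Gamma_def inner_vec3 field_simps power2_eq_square power3_eq_cube)
next
  fix w w' assume "\<And>z. hyp_metric x w z = hyp_metric x w' z"
  then have "w \<bullet> z = w' \<bullet> z" for z using assms by (simp add: hyp_metric_def)
  then show "w = w'" by (metis vector_eq_rdot)
qed

lemma frechet_christoffel_hyp:
  assumes "x $ 0 > 0"
  shows "frechet_derivative (\<lambda>y. christoffel hyp_metric y v w) (at x) u = - (u $ 0 / x $ 0) *\<^sub>R hyp_Gamma x v w"
proof -
  have "((\<lambda>y. hyp_Gamma y v w) has_derivative (\<lambda>u. - (u $ 0 / x $ 0) *\<^sub>R hyp_Gamma x v w)) (at x)"
    unfolding hyp_Gamma_def using assms
    by (auto intro!: derivative_eq_intros vec_nth_has_derivative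
        simp: fun_eq_iff vec3_eq_iff inner_vec3 field_simps power2_eq_square)
  then have "((\<lambda>y. christoffel hyp_metric y v w) has_derivative (\<lambda>u. - (u $ 0 / x $ 0) *\<^sub>R hyp_Gamma x v w)) (at x)"
    by (rule has_derivative_transform_within_open[OF _ open_vec0_pos])
      (use assms in \<open>auto simp: christoffel_hyp\<close>)
  then show ?thesis by (simp add: frechet_derivative_eqI)
qed

text \<open>In constant curvature -1 one has R(w, v)v = -(g(v, v) w - g(w, v) v), so orthogonal
  Jacobi fields are the orthogonal solutions of W'' = W.\<close>

lemma curvature_hyp:
  assumes x: "x $ 0 > 0" and v: "hyp_metric x v v = 1" and w: "hyp_metric x w v = 0"
  shows "curvature hyp_metric x w v v = - w"
proof -
  have vv: "v $ 0 * v $ 0 + v $ 1 * v $ 1 + v $ 2 * v $ 2 = x $ 0 * x $ 0"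
    using x v by (simp add: hyp_metric_def inner_vec3 power2_eq_square)
  have wv: "w $ 0 * v $ 0 + w $ 1 * v $ 1 + w $ 2 * v $ 2 = 0"
    using x w by (simp add: hyp_metric_def inner_vec3)
  have "(x $ 0 * x $ 0) *\<^sub>R curvature hyp_metric x w v v =
     - ((v \<bullet> v) *\<^sub>R w - (w \<bullet> v) *\<^sub>R v)"
    unfolding curvature_def frechet_christoffel_hyp[OF x] christoffel_hyp[OF x]
    using x by (simp add: hyp_Gamma_def vec3_eq_iff inner_vec3 field_simps)
  also have "\<dots> = (x $ 0 * x $ 0) *\<^sub>R (- w)"
    using vv wv by (simp add: inner_vec3)
  finally show ?thesis using x by (simp only: scaleR_cancel_left) simp
qed

lemma covariant_along_hyp:
  "\<gamma> t $ 0 > 0 \<Longrightarrow> covariant_along hyp_metric \<gamma> W t = velocity W t + hyp_Gamma (\<gamma> t) (velocity \<gamma> t) (W t)"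
  by (simp add: covariant_along_def christoffel_hyp)

section \<open>The conserved momentum of a geodesic\<close>

lemma bounded_linear_cscale: "bounded_linear (cscale c)"
  by (intro linear_conv_bounded_linear[THEN iffD1] linearI) (simp_all add: cscale_linear)

lemma kform_linear:
  "kform (a + b) c = kform a c + kform b c" "kform (a - b) c = kform a c - kform b c" "kform (- a) c = - kform a c"
  "kform a (b + c) = kform a b + kform a c" "kform a (b - c) = kform a b - kform a c" "kform a (- b) = - kform a b"
  "kform (r *\<^sub>R a) b = r *\<^sub>R kform a b" "kform a (r *\<^sub>R b) = r *\<^sub>R kform a b" "kform 0 a = 0" "kform a 0 = 0"
  by (simp_all add: kform_def split_beta algebra_simps)

lemma bracket_linear:
  "bracket (a + b) c = bracket a c + bracket b c" "bracket a (b + c) = bracket a b + bracket a c" "bracket a (b - c) = bracket a b - bracket a c"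
  "bracket (r *\<^sub>R a) b = r *\<^sub>R bracket a b" "bracket a (r *\<^sub>R b) = r *\<^sub>R bracket a b" "bracket 0 a = 0" "bracket a 0 = 0"
  by (simp_all add: bracket_def split_beta sl2_eq_iff algebra_simps)

lemma cscale_cscale: "cscale c (cscale d a) = cscale (c * d) a"
  by (simp add: sl2_simps algebra_simps)

lemma cscale_minus1: "cscale (-1) a = - a"
  by (simp add: sl2_simps uminus_prod_def)

text \<open>The rotation part of the momentum vanishes at \<open>x\<close>, so pairing with it reads
  off the components along \<open>v\<close> of both parts of \<open>b\<close>. Orthogonality to the
  momentum thus makes both parts orthogonal to the geodesic.\<close>

lemma kform_momentum:
  assumes "x $ 0 > 0"
  shows "Re (kform (momentum x v) b) = hyp_metric x v (killing b x)" "Im (kform (momentum x v) b) = hyp_metric x v (rotor b x)"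
  using Re_kform[of x "momentum x v" b] Im_kform[of x "momentum x v" b] assms
  by (simp_all add: killing_momentum rotor_momentum hyp_metric_def field_simps)

lemma kform_momentum_self: "x $ 0 > 0 \<Longrightarrow> hyp_metric x v v = 1 \<Longrightarrow> kform (momentum x v) (momentum x v) = 1"
  by (simp add: complex_eq_iff kform_momentum killing_momentum rotor_momentum) (simp add: hyp_metric_def)

text \<open>Bracketing with the momentum is covariant differentiation along the geodesic on the
  value part and, seen through the rotation part, the rotation by 90 degrees of the value. The
  second equation is the first for -i \<open>a\<close>.\<close>

lemma killing_bracket_momentum:
  assumes "x $ 0 > 0"
  shows "killing (bracket (momentum x v) a) x = (1 / x $ 0) *\<^sub>R cross3 (rotor a x) v"
    and "rotor (bracket (momentum x v) a) x = - (1 / x $ 0) *\<^sub>R cross3 (killing a x) v"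
proof -
  have *: "killing (bracket (momentum x v) a) x = (1 / x $ 0) *\<^sub>R cross3 (rotor a x) v" for a
  proof -
    have "x $ 0 *\<^sub>R killing (bracket (momentum x v) a) x = cross3 (rotor a x) v"
      using killing_bracket[of x "momentum x v" a] assms by (simp add: killing_momentum rotor_momentum cross_skew[of v])
    then have "(1 / x $ 0) *\<^sub>R x $ 0 *\<^sub>R killing (bracket (momentum x v) a) x = (1 / x $ 0) *\<^sub>R cross3 (rotor a x) v" by simp
    then show ?thesis using assms by simp
  qed
  show "killing (bracket (momentum x v) a) x = (1 / x $ 0) *\<^sub>R cross3 (rotor a x) v" by (rule *)
  show "rotor (bracket (momentum x v) a) x = - (1 / x $ 0) *\<^sub>R cross3 (killing a x) v"
    using *[of "cscale (- \<i>) a"]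
    by (simp add: rotor_def bracket_cscale cscale_cscale cscale_minus1 killing_linear vec3_eq_iff algebra_simps)
qed

text \<open>Obtained by differentiating \<open>killing (momentum x v) x = v\<close> and \<open>rotor (momentum x v) x = 0\<close>.\<close>

lemma momentum_has_derivative:
  assumes f: "(f has_derivative f') (at y)" and g: "(g has_derivative g') (at y)"
    and m: "((\<lambda>y. momentum (f y) (g y)) has_derivative w) (at y)" and pos: "f y $ 0 > 0"
  shows "killing (w \<xi>) (f y) = g' \<xi> + hyp_Gamma (f y) (f' \<xi>) (g y)"
    and "rotor (w \<xi>) (f y) = (1 / f y $ 0) *\<^sub>R cross3 (g y) (f' \<xi>)"
proof -
  have "isCont (\<lambda>z. f z $ 0) y"
    using vec_nth_has_derivative[OF f] has_derivative_continuous by blast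
  then have ev: "eventually (\<lambda>z. f z $ 0 > 0) (at y)"
    using pos by (simp add: isCont_def order_tendsto_iff)
  have *: "(h has_derivative D) (at y)" if "((\<lambda>z. killing (c (momentum (f z) (g z))) (f z)) has_derivative D) (at y)"
    "\<And>z. f z $ 0 > 0 \<Longrightarrow> killing (c (momentum (f z) (g z))) (f z) = h z" for h c D
    by (rule has_derivative_transform_eventually[OF that(1)])
      (use ev pos that(2) in \<open>auto elim: eventually_mono\<close>)
  have 1: "(g has_derivative (\<lambda>\<xi>. killing (w \<xi>) (f y) + ((1 / f y $ 0) *\<^sub>R cross3 (rotor (momentum (f y) (g y)) (f y)) (f' \<xi>)
     - hyp_Gamma (f y) (f' \<xi>) (killing (momentum (f y) (g y)) (f y))))) (at y)"
    by (rule *[where c = "\<lambda>a. a", OF killing_has_derivative[OF m f]]) (use pos in \<open>auto simp: killing_momentum\<close>)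
  then have "g' \<xi> = killing (w \<xi>) (f y) - hyp_Gamma (f y) (f' \<xi>) (g y)"
    using has_derivative_unique[OF g 1] pos by (simp add: killing_momentum rotor_momentum)
  then show "killing (w \<xi>) (f y) = g' \<xi> + hyp_Gamma (f y) (f' \<xi>) (g y)" by simp
  have m': "((\<lambda>y. cscale (- \<i>) (momentum (f y) (g y))) has_derivative (\<lambda>\<xi>. cscale (- \<i>) (w \<xi>))) (at y)"
    by (rule bounded_linear.has_derivative[OF bounded_linear_cscale m])
  have 2: "((\<lambda>z. 0) has_derivative (\<lambda>\<xi>. killing (cscale (- \<i>) (w \<xi>)) (f y)
     + ((1 / f y $ 0) *\<^sub>R cross3 (rotor (cscale (- \<i>) (momentum (f y) (g y))) (f y)) (f' \<xi>)
     - hyp_Gamma (f y) (f' \<xi>) (killing (cscale (- \<i>) (momentum (f y) (g y))) (f y))))) (at y)"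
    by (rule *[where c = "cscale (- \<i>)", OF killing_has_derivative[OF m' f]])
      (use pos in \<open>auto simp: rotor_momentum simp flip: rotor_def\<close>)
  have "0 = rotor (w \<xi>) (f y) + (1 / f y $ 0) *\<^sub>R cross3 (- g y) (f' \<xi>)"
    using fun_cong[OF has_derivative_unique[OF has_derivative_const 2], of \<xi>] pos
    by (simp add: killing_momentum rotor_momentum rotor_cscale hyp_Gamma_linear flip: rotor_def)
  then show "rotor (w \<xi>) (f y) = (1 / f y $ 0) *\<^sub>R cross3 (g y) (f' \<xi>)"
    by (simp add: vec3_eq_iff algebra_simps)
qed

lemma smooth_on_momentum:
  assumes S: "open S" and f: "smooth_on S f" and g: "smooth_on S g" and pos: "\<And>x. x \<in> S \<Longrightarrow> f x $ 0 > 0"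
  shows "smooth_on S (\<lambda>x. momentum (f x) (g x))"
proof -
  \<comment> \<open>Reciprocals are handled by a rule for real functions, so the complex quotients
    become real scalings.\<close>
  have eq1: "of_real (v $ 0 / x $ 0) = (v $ 0 * inverse (x $ 0)) *\<^sub>R (1::complex)" for x v :: "real^3"
    by (simp add: scaleR_conv_of_real field_simps)
  have eq2: "- cnj (horiz v) / of_real (2 * (x $ 0)\<^sup>2) = inverse (2 * (x $ 0)\<^sup>2) *\<^sub>R (- cnj (horiz v))" for x v :: "real^3"
    by (simp add: scaleR_conv_of_real field_simps)
  show ?thesis unfolding momentum_def Let_def eq1 eq2 unfolding power2_eq_square
    by (intro smooth_on_bounded_linear[OF bounded_linear_divide] smooth_on_Pair smooth_on_add smooth_on_diff smooth_on_mult smooth_on_scaleR smooth_on_const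
        smooth_on_inverse smooth_on_bounded_linear[OF bounded_linear_horiz] smooth_on_vec_nth
        smooth_on_bounded_linear[OF bounded_linear_cnj] smooth_on_minus S f g) (use pos in \<open>auto simp: less_le\<close>)
qed

lemma smooth_on_killing:
  assumes S: "open S" and f: "smooth_on S f"
  shows "smooth_on S (\<lambda>x. killing a (f x))"
proof -
  have "smooth_on S (\<lambda>x. (f x $ 0 * Re (fst (snd a) + 2 * snd (snd a) * horiz (f x)),
    fst a + fst (snd a) * horiz (f x) + snd (snd a) * (horiz (f x) * horiz (f x))
      - cnj (snd (snd a)) * of_real (f x $ 0 * f x $ 0)))"
    by (intro smooth_on_Pair smooth_on_add smooth_on_diff smooth_on_mult smooth_on_const
        smooth_on_bounded_linear[OF bounded_linear_horiz] smooth_on_vec_nth S f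
        smooth_on_bounded_linear[OF bounded_linear_of_real] smooth_on_bounded_linear[OF bounded_linear_Re])
  from smooth_on_bounded_linear[OF bounded_linear_height_vec S this] show ?thesis
    by (simp add: killing_def split_beta power2_eq_square)
qed

lemma unit_geodesicD:
  assumes "unit_geodesic \<gamma>"
  shows "smooth_on UNIV \<gamma>" "\<gamma> t $ 0 > 0" "hyp_metric (\<gamma> t) (velocity \<gamma> t) (velocity \<gamma> t) = 1"
    "(\<gamma> has_vector_derivative velocity \<gamma> t) (at t)"
    "(velocity \<gamma> has_vector_derivative - hyp_Gamma (\<gamma> t) (velocity \<gamma> t) (velocity \<gamma> t)) (at t)"
proof -
  show s: "smooth_on UNIV \<gamma>" and p: "\<gamma> t $ 0 > 0" and "hyp_metric (\<gamma> t) (velocity \<gamma> t) (velocity \<gamma> t) = 1"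
    using assms by (auto simp: unit_geodesic_def geodesic_on_def)
  show "(\<gamma> has_vector_derivative velocity \<gamma> t) (at t)"
    using s smooth_on_has_vector_derivative by blast
  have "velocity (velocity \<gamma>) t = - hyp_Gamma (\<gamma> t) (velocity \<gamma> t) (velocity \<gamma> t)"
    using assms p by (auto simp: unit_geodesic_def geodesic_on_def covariant_along_hyp eq_neg_iff_add_eq_0)
  then show "(velocity \<gamma> has_vector_derivative - hyp_Gamma (\<gamma> t) (velocity \<gamma> t) (velocity \<gamma> t)) (at t)"
    using smooth_on_has_vector_derivative[OF smooth_on_velocity[OF s]] by (metis UNIV_I open_UNIV)
qed

text \<open>A conservation law: the value part of the derivative vanishes by the geodesic equation
  and the rotation part is the cross product of the velocity with itself.\<close>

lemma momentum_geodesic: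
  assumes "unit_geodesic \<gamma>"
  shows "momentum (\<gamma> t) (velocity \<gamma> t) = momentum (\<gamma> s) (velocity \<gamma> s)"
proof -
  let ?m = "\<lambda>t. momentum (\<gamma> t) (velocity \<gamma> t)"
  note \<gamma> = unit_geodesicD[OF assms]
  have smooth: "smooth_on UNIV ?m"
    by (intro smooth_on_momentum smooth_on_velocity \<gamma> open_UNIV)
  have "(?m has_vector_derivative 0) (at t)" for t
  proof -
    have m: "(?m has_derivative frechet_derivative ?m (at t)) (at t)"
      using smooth_on_has_derivative[OF smooth] by simp
    note * = momentum_has_derivative[OF \<gamma>(4)[unfolded has_vector_derivative_def]
        \<gamma>(5)[unfolded has_vector_derivative_def] m \<gamma>(2), of 1]
    have "frechet_derivative ?m (at t) 1 = 0"
      by (rule killing_rotor_eq_0[OF \<gamma>(2)[of t]]) (use * in simp_all)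
    then show ?thesis
      using smooth_on_has_vector_derivative[OF smooth, of t] velocity_eq_frechet[OF smooth, of t] by simp
  qed
  then have "\<exists>c. \<forall>x. ?m x = c"
    using has_vector_derivative_zero_constant[of UNIV ?m] by (metis convex_UNIV has_vector_derivative_at_within UNIV_I)
  then show ?thesis by metis
qed

text \<open>The momentum may be taken at any parameter \<open>s\<close>, so differentiating the
  restriction of a Killing field gives the restriction of one fixed Killing field and can be
  iterated.\<close>

lemma killing_along_geodesic:
  assumes "unit_geodesic \<gamma>"
  shows "smooth_on UNIV (\<lambda>t. killing a (\<gamma> t))"
    and "covariant_along hyp_metric \<gamma> (\<lambda>t. killing a (\<gamma> t)) t = killing (bracket (momentum (\<gamma> s) (velocity \<gamma> s)) a) (\<gamma> t)"
proof -
  note \<gamma> = unit_geodesicD[OF assms]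
  show "smooth_on UNIV (\<lambda>t. killing a (\<gamma> t))" by (intro smooth_on_killing \<gamma> open_UNIV)
  have "((\<lambda>t. killing a (\<gamma> t)) has_vector_derivative (1 / \<gamma> t $ 0) *\<^sub>R cross3 (rotor a (\<gamma> t)) (velocity \<gamma> t)
      - hyp_Gamma (\<gamma> t) (velocity \<gamma> t) (killing a (\<gamma> t))) (at t)"
    unfolding has_vector_derivative_def
    by (rule has_derivative_eq_rhs[OF killing_has_derivative[OF has_derivative_const \<gamma>(4)[unfolded has_vector_derivative_def]]])
      (use \<gamma>(2)[of t] in \<open>auto simp: fun_eq_iff killing_linear hyp_Gamma_linear cross_mult_right algebra_simps\<close>)
  from velocity_eqI[OF this]
  show "covariant_along hyp_metric \<gamma> (\<lambda>t. killing a (\<gamma> t)) t = killing (bracket (momentum (\<gamma> s) (velocity \<gamma> s)) a) (\<gamma> t)"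
    by (simp add: covariant_along_hyp \<gamma> momentum_geodesic[OF assms, of s t] killing_bracket_momentum(1))
qed

text \<open>The vector field that the flow of \<open>a\<close> induces on oriented geodesics: it
  moves a geodesic with variation field \<open>killing a\<close>, of which h keeps the orthogonal
  part.\<close>

definition killing_projection :: "sl2 \<Rightarrow> (real^3) \<times> (real^3) \<Rightarrow> real^3" where
  "killing_projection a = (\<lambda>(x, v). killing a x - hyp_metric x (killing a x) v *\<^sub>R v)"

text \<open>Only the real part of the coefficient acts at \<open>x\<close>, because the rotation
  part of the momentum vanishes there. The imaginary part is included to make the new element
  orthogonal to the momentum for the complex form.\<close>

lemma killing_projection_eq:
  assumes "x $ 0 > 0"
  shows "killing_projection a (x, v) = killing (a - cscale (kform (momentum x v) a) (momentum x v)) x"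
  using assms
  by (simp add: killing_projection_def killing_linear killing_cscale killing_momentum rotor_momentum kform_momentum hyp_metric_def inner_commute)

text \<open>Covariant differentiation along the geodesic is \<open>bracket m\<close>, an involution
  on the complement of \<open>m\<close>; hence W'' = W.\<close>

lemma killing_projection_jacobi:
  assumes "unit_geodesic \<gamma>"
  shows "(\<lambda>t. killing_projection a (\<gamma> t, velocity \<gamma> t)) \<in> perp_jacobi \<gamma>"
proof -
  note \<gamma> = unit_geodesicD[OF assms]
  define m where "m = momentum (\<gamma> 0) (velocity \<gamma> 0)"
  have m: "momentum (\<gamma> t) (velocity \<gamma> t) = m" for t using momentum_geodesic[OF assms] m_def by blast
  define b where "b = a - cscale (kform m a) m"
  have mm: "kform m m = 1" unfolding m_def by (rule kform_momentum_self[OF \<gamma>(2,3)])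
  have mb: "kform m b = 0"
    using mm by (simp add: b_def kform_linear kform_cscale)
  have W: "(\<lambda>t. killing_projection a (\<gamma> t, velocity \<gamma> t)) = (\<lambda>t. killing b (\<gamma> t))"
    by (simp add: killing_projection_eq \<gamma> m b_def)
  have perp: "hyp_metric (\<gamma> t) (killing b (\<gamma> t)) (velocity \<gamma> t) = 0" for t
    using kform_momentum(1)[OF \<gamma>(2), of t "velocity \<gamma> t" b] mb
    by (simp add: m hyp_metric_def inner_commute)
  have cov: "covariant_along hyp_metric \<gamma> (\<lambda>t. killing b (\<gamma> t)) = (\<lambda>t. killing (bracket m b) (\<gamma> t))" for b
    using killing_along_geodesic(2)[OF assms, of b _ 0] by (auto simp: m_def)
  have "bracket m (bracket m b) = b" by (simp add: bracket_bracket mm mb)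
  then show ?thesis
    unfolding W perp_jacobi_def
    by (simp add: perp cov killing_along_geodesic(1)[OF assms] curvature_hyp[OF \<gamma>(2,3) perp])
qed

section \<open>The metric on the space of geodesics\<close>

lemma bounded_bilinear_kform: "bounded_bilinear kform"
  by (intro bilinear_conv_bounded_bilinear[THEN iffD1])
    (auto simp: bilinear_def linear_iff kform_linear)

lemma bounded_bilinear_bracket: "bounded_bilinear bracket"
  by (intro bilinear_conv_bounded_bilinear[THEN iffD1])
    (auto simp: bilinear_def linear_iff bracket_linear)

text \<open>A quarter turn about \<open>v\<close> followed by the opposite one: only the component
  along \<open>v\<close> is lost.\<close>

lemma hyp_double_cross:
  assumes "x $ 0 > 0" "hyp_metric x v v = 1"
  shows "(1 / x $ 0) *\<^sub>R cross3 ((1 / x $ 0) *\<^sub>R cross3 v w) v = w - hyp_metric x w v *\<^sub>R v"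
proof -
  have vv: "v \<bullet> v = (x $ 0)\<^sup>2" using assms by (simp add: hyp_metric_def field_simps)
  have "(1 / x $ 0) *\<^sub>R cross3 ((1 / x $ 0) *\<^sub>R cross3 v w) v
      = (1 / (x $ 0)\<^sup>2) *\<^sub>R ((v \<bullet> v) *\<^sub>R w - (w \<bullet> v) *\<^sub>R v)"
    by (simp add: vec3_eq_iff inner_vec3 power2_eq_square algebra_simps)
  then show ?thesis using assms(1) by (simp add: vv hyp_metric_def algebra_simps)
qed

text \<open>Rotation sends \<open>a\<close> to -i times \<open>bracket m a\<close>, and
  differentiating gives back -i \<open>a\<close>, whose value is \<open>rotor a\<close>. The two
  terms of \<Omega> become the two summands of \<open>Im_kform\<close>.\<close>

lemma L_G_killing:
  assumes \<gamma>: "unit_geodesic \<gamma>" and m: "m = momentum (\<gamma> 0) (velocity \<gamma> 0)" and "kform m a = 0" "kform m b = 0"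
  shows "L_G \<gamma> (\<lambda>t. killing a (\<gamma> t)) (\<lambda>t. killing b (\<gamma> t)) = - Im (kform a b)"
proof -
  note D = unit_geodesicD[OF \<gamma>]
  define x v where "x = \<gamma> 0" and "v = velocity \<gamma> 0"
  have x: "x $ 0 > 0" and vv: "v \<bullet> v = (x $ 0)\<^sup>2"
    using D(2,3)[of 0] by (auto simp: x_def v_def hyp_metric_def field_simps)
  have mx: "m = momentum x v" by (simp add: m x_def v_def)
  have m_t: "momentum (\<gamma> t) (velocity \<gamma> t) = m" for t using momentum_geodesic[OF \<gamma>] m by blast
  have mm: "kform m m = 1" unfolding m by (rule kform_momentum_self[OF D(2,3)])
  have J: "L_J \<gamma> (\<lambda>t. killing a (\<gamma> t)) = (\<lambda>t. killing (cscale (- \<i>) (bracket m a)) (\<gamma> t))"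
  proof
    fix t show "L_J \<gamma> (\<lambda>t. killing a (\<gamma> t)) t = killing (cscale (- \<i>) (bracket m a)) (\<gamma> t)"
      using killing_bracket_momentum(2)[OF D(2), of t "velocity \<gamma> t" a] cross_skew[of "velocity \<gamma> t" "killing a (\<gamma> t)"]
      by (simp add: L_J_def rot90_def m_t rotor_def)
  qed
  have cov: "covariant_along hyp_metric \<gamma> (\<lambda>t. killing b (\<gamma> t)) 0 = killing (bracket m b) x" for b
    using killing_along_geodesic(2)[OF \<gamma>, of b 0 0] by (simp add: m x_def)
  have "bracket m (cscale (- \<i>) (bracket m a)) = cscale (- \<i>) a" using assms mm by (simp add: bracket_cscale bracket_bracket)
  then have *: "L_G \<gamma> (\<lambda>t. killing a (\<gamma> t)) (\<lambda>t. killing b (\<gamma> t)) =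
     hyp_metric x (rotor (bracket m a) x) (killing (bracket m b) x) - hyp_metric x (killing b x) (rotor a x)"
    unfolding L_G_def J L_Omega_def cov by (simp add: x_def rotor_def)
  have "killing a x \<bullet> v = 0" "rotor b x \<bullet> v = 0"
    using kform_momentum[OF x, of v a] kform_momentum[OF x, of v b] assms x by (simp_all add: mx hyp_metric_def inner_commute)
  \<comment> \<open>Both factors are cross products with \<open>v\<close> of vectors orthogonal to
    \<open>v\<close>, an operation that preserves their inner product up to the factor
    \<open>v \<bullet> v\<close>.\<close>
  then have "hyp_metric x (rotor (bracket m a) x) (killing (bracket m b) x) = - (killing a x \<bullet> rotor b x) / (x $ 0)\<^sup>2"
    using x by (simp add: mx killing_bracket_momentum hyp_metric_def dot_cross vv power2_eq_square field_simps)
  with * Im_kform[of x a b] x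
  have "(x $ 0)\<^sup>2 * (L_G \<gamma> (\<lambda>t. killing a (\<gamma> t)) (\<lambda>t. killing b (\<gamma> t)) + Im (kform a b)) = 0"
    by (simp add: hyp_metric_def inner_commute field_simps)
  with x show ?thesis by simp
qed

section \<open>Families of geodesics and the metric in coordinates\<close>

text \<open>Injectivity is left to the extension \<open>injective_family\<close>, because the
  calculus developed here is what establishes it for the standard charts.\<close>

locale geodesic_family =
  fixes U :: "(real^4) set" and \<Phi> :: "real^4 \<Rightarrow> real \<Rightarrow> real^3"
  assumes open_U: "open U"
    and smooth: "smooth_on (U \<times> UNIV) (\<lambda>(u, t). \<Phi> u t)"
    and geodesic: "u \<in> U \<Longrightarrow> unit_geodesic (\<Phi> u)"
begin

definition mu :: "real^4 \<Rightarrow> sl2" where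
  "mu u = momentum (\<Phi> u 0) (velocity (\<Phi> u) 0)"

definition D :: "real^4 \<Rightarrow> real^4 \<Rightarrow> sl2" where
  "D u \<xi> = frechet_derivative mu (at u) \<xi>"

definition D2 :: "real^4 \<Rightarrow> real^4 \<Rightarrow> real^4 \<Rightarrow> sl2" where
  "D2 u \<xi> \<eta> = frechet_derivative (\<lambda>w. D w \<xi>) (at u) \<eta>"

lemma momentum_Phi: "u \<in> U \<Longrightarrow> momentum (\<Phi> u t) (velocity (\<Phi> u) t) = mu u"
  unfolding mu_def by (rule momentum_geodesic[OF geodesic])

lemma smooth_Phi: "smooth_on U (\<lambda>u. \<Phi> u t)"
  using smooth_on_affine[of "\<lambda>u. (u, 0)" "U \<times> UNIV" U "(0, t)", OF _ _ open_U _ smooth]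
  by (simp add: bounded_linear_Pair bounded_linear_ident bounded_linear_zero open_Times open_U)

lemma velocity_Phi:
  assumes "u \<in> U"
  shows "velocity (\<Phi> u) t = frechet_derivative (\<lambda>(u, t). \<Phi> u t) (at (u, t)) (0, 1)"
proof -
  let ?F = "\<lambda>(u, t). \<Phi> u t"
  have 1: "((\<lambda>t. (u, t)) has_derivative (\<lambda>r. (0, r))) (at t)"
    by (auto intro!: derivative_eq_intros)
  have 2: "(?F has_derivative frechet_derivative ?F (at (u, t))) (at (u, t))"
    using smooth_on_has_derivative[OF smooth] assms by auto
  have "(\<Phi> u has_derivative (\<lambda>r. frechet_derivative ?F (at (u, t)) (0, r))) (at t)"
    using has_derivative_compose[OF 1 2] by simp
  moreover have "(\<lambda>r. frechet_derivative ?F (at (u, t)) (0, r)) =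
      (\<lambda>r. r *\<^sub>R frechet_derivative ?F (at (u, t)) (0, 1))"
  proof
    fix r show "frechet_derivative ?F (at (u, t)) (0, r) = r *\<^sub>R frechet_derivative ?F (at (u, t)) (0, 1)"
      using linear_cmul[OF has_derivative_linear[OF 2], of r "(0, 1)"] by simp
  qed
  ultimately have "(\<Phi> u has_vector_derivative frechet_derivative ?F (at (u, t)) (0, 1)) (at t)"
    unfolding has_vector_derivative_def by (simp only:)
  then show ?thesis by (rule velocity_eqI)
qed

lemma smooth_velocity: "smooth_on U (\<lambda>u. velocity (\<Phi> u) t)"
proof -
  have "smooth_on U (\<lambda>u. frechet_derivative (\<lambda>(u, t). \<Phi> u t) (at ((0, t) + (u, 0))) (0, 1))"
    by (rule smooth_on_affine[OF _ _ open_U _ smooth_on_frechet_derivative[OF smooth]])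
      (simp_all add: bounded_linear_Pair bounded_linear_ident bounded_linear_zero open_Times open_U)
  then show ?thesis
    by (rule smooth_on_cong[OF _ open_U]) (simp add: velocity_Phi)
qed

lemma Phi_pos: "u \<in> U \<Longrightarrow> \<Phi> u t $ 0 > 0"
  using unit_geodesicD(2)[OF geodesic] .

lemma smooth_mu: "smooth_on U mu"
  using smooth_on_momentum[OF open_U smooth_Phi smooth_velocity Phi_pos, of 0 0] by (simp add: mu_def[abs_def])

lemma mu_has_derivative: "u \<in> U \<Longrightarrow> (mu has_derivative D u) (at u)"
  using smooth_on_has_derivative[OF smooth_mu] by (simp add: D_def[abs_def])

lemma linear_D: "u \<in> U \<Longrightarrow> linear (D u)"
  using has_derivative_linear mu_has_derivative by blast

lemma smooth_D: "smooth_on U (\<lambda>u. D u \<xi>)"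
  unfolding D_def by (rule smooth_on_frechet_derivative[OF smooth_mu])

lemma D_has_derivative_const: "u \<in> U \<Longrightarrow> ((\<lambda>w. D w \<xi>) has_derivative D2 u \<xi>) (at u)"
  using smooth_on_has_derivative[OF smooth_D] by (simp add: D2_def[abs_def])

lemma D2_commute: "u \<in> U \<Longrightarrow> D2 u \<xi> \<eta> = D2 u \<eta> \<xi>"
  using frechet_derivative_symmetric[OF smooth_mu open_U] by (simp add: D2_def D_def)

lemma rotor_D:
  assumes u: "u \<in> U"
  shows "rotor (D u \<xi>) (\<Phi> u t) = (1 / \<Phi> u t $ 0) *\<^sub>R
    cross3 (velocity (\<Phi> u) t) (frechet_derivative (\<lambda>w. \<Phi> w t) (at u) \<xi>)"
proof -
  have "((\<lambda>w. momentum (\<Phi> w t) (velocity (\<Phi> w) t)) has_derivative D u) (at u)"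
    by (rule has_derivative_transform_within_open[OF mu_has_derivative[OF u] open_U u]) (simp add: momentum_Phi)
  from momentum_has_derivative(2)[OF smooth_on_has_derivative[OF smooth_Phi u]
     smooth_on_has_derivative[OF smooth_velocity u] this Phi_pos[OF u]]
  show ?thesis .
qed

text \<open>The rotation part of \<open>D u \<xi>\<close> is the variation field turned by 90
  degrees about the velocity; bracketing with \<open>mu u\<close> turns it back and leaves the
  orthogonal part.\<close>

lemma jacobi_of_eq:
  assumes u: "u \<in> U"
  shows "jacobi_of \<Phi> u \<xi> t = killing (bracket (mu u) (D u \<xi>)) (\<Phi> u t)"
proof -
  let ?x = "\<Phi> u t" and ?v = "velocity (\<Phi> u) t" and ?W = "frechet_derivative (\<lambda>w. \<Phi> w t) (at u) \<xi>"
  have x: "?x $ 0 > 0" by (rule Phi_pos[OF u])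
  have "killing (bracket (mu u) (D u \<xi>)) ?x = (1 / ?x $ 0) *\<^sub>R cross3 ((1 / ?x $ 0) *\<^sub>R cross3 ?v ?W) ?v"
    using killing_bracket_momentum(1)[OF x, of ?v "D u \<xi>"] by (simp add: momentum_Phi[OF u] rotor_D[OF u])
  also have "\<dots> = ?W - hyp_metric ?x ?W ?v *\<^sub>R ?v"
    by (rule hyp_double_cross[OF x unit_geodesicD(3)[OF geodesic[OF u]]])
  finally show ?thesis by (simp add: jacobi_of_def Let_def)
qed

lemma kform_mu: "u \<in> U \<Longrightarrow> kform (mu u) (mu u) = 1"
  using kform_momentum_self unit_geodesicD(2,3)[OF geodesic] by (simp add: mu_def)

lemma kform_mu_D:
  assumes u: "u \<in> U"
  shows "kform (mu u) (D u \<xi>) = 0"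
proof -
  note M = mu_has_derivative[OF u]
  have "((\<lambda>w. kform (mu w) (mu w)) has_derivative (\<lambda>\<xi>. kform (mu u) (D u \<xi>) + kform (D u \<xi>) (mu u))) (at u)"
    by (rule bounded_bilinear.FDERIV[OF bounded_bilinear_kform M M])
  then have "((\<lambda>w. 1) has_derivative (\<lambda>\<xi>. kform (mu u) (D u \<xi>) + kform (D u \<xi>) (mu u))) (at u)"
    by (rule has_derivative_transform_within_open[OF _ open_U u]) (simp add: kform_mu)
  from fun_cong[OF has_derivative_unique[OF has_derivative_const this], of \<xi>]
  show ?thesis by (simp add: kform_commute)
qed

text \<open>Invariance of the form and the involution property give
  \<open>kform [m,w] [m,w'] = - kform w w'\<close>, and this sign cancels the one in
  \<open>L_G_killing\<close>.\<close>

lemma chart_metric_eq: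
  assumes u: "u \<in> U"
  shows "chart_metric \<Phi> u \<xi> \<eta> = Im (kform (D u \<xi>) (D u \<eta>))"
proof -
  have "jacobi_of \<Phi> u \<xi> = (\<lambda>t. killing (bracket (mu u) (D u \<xi>)) (\<Phi> u t))" for \<xi>
    using jacobi_of_eq[OF u] by blast
  then have "chart_metric \<Phi> u \<xi> \<eta> = - Im (kform (bracket (mu u) (D u \<xi>)) (bracket (mu u) (D u \<eta>)))"
    using L_G_killing[OF geodesic[OF u] mu_def, of "bracket (mu u) (D u \<xi>)" "bracket (mu u) (D u \<eta>)"]
    by (simp add: chart_metric_def)
  then show ?thesis
    by (simp add: kform_bracket bracket_bracket kform_mu[OF u] kform_mu_D[OF u])
qed

text \<open>\<open>D2\<close> differentiates \<open>D\<close> in a fixed direction, so the varying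
  \<open>X\<close> is expanded in coordinates; the symmetry of \<open>D2\<close> moves
  \<open>X\<close> into the slot where linearity reassembles the sum.\<close>

lemma D_has_derivative:
  assumes u: "(u has_derivative u') (at y)" "u y \<in> U" and X: "(X has_derivative X') (at y)"
  shows "((\<lambda>y. D (u y) (X y)) has_derivative (\<lambda>\<zeta>. D (u y) (X' \<zeta>) + D2 (u y) (X y) (u' \<zeta>))) (at y)"
proof -
  have sum: "L v = (\<Sum>i\<in>UNIV. v $ i *\<^sub>R L (axis i 1))" if "linear L" for L :: "real^4 \<Rightarrow> sl2" and v
  proof -
    have "L v = L (\<Sum>i\<in>UNIV. v $ i *\<^sub>R axis i 1)"
      by (simp add: basis_expansion flip: scalar_mult_eq_scaleR)
    then show ?thesis using that by (simp add: linear_sum linear_cmul)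
  qed
  have "((\<lambda>y. \<Sum>i\<in>UNIV. X y $ i *\<^sub>R D (u y) (axis i 1)) has_derivative
     (\<lambda>\<zeta>. \<Sum>i\<in>UNIV. X y $ i *\<^sub>R D2 (u y) (axis i 1) (u' \<zeta>) + X' \<zeta> $ i *\<^sub>R D (u y) (axis i 1))) (at y)"
    by (intro has_derivative_sum has_derivative_scaleR vec_nth_has_derivative X
        has_derivative_compose[OF u(1) D_has_derivative_const[OF u(2)]])
  moreover have "(\<Sum>i\<in>UNIV. X y $ i *\<^sub>R D2 (u y) (axis i 1) (u' \<zeta>) + X' \<zeta> $ i *\<^sub>R D (u y) (axis i 1))
      = D (u y) (X' \<zeta>) + D2 (u y) (X y) (u' \<zeta>)" for \<zeta>
    using sum[OF linear_D[OF u(2)], of "X' \<zeta>"]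
      sum[OF has_derivative_linear[OF D_has_derivative_const[OF u(2)]], of "u' \<zeta>" "X y"]
    by (simp add: D2_commute[OF u(2), of _ "u' \<zeta>"] sum.distrib)
  ultimately have *: "((\<lambda>y. \<Sum>i\<in>UNIV. X y $ i *\<^sub>R D (u y) (axis i 1)) has_derivative
    (\<lambda>\<zeta>. D (u y) (X' \<zeta>) + D2 (u y) (X y) (u' \<zeta>))) (at y)" by simp
  have "eventually (\<lambda>z. u z \<in> U) (at y)"
    using has_derivative_continuous[OF u(1)] open_U u(2)
    by (auto simp: continuous_within elim!: topological_tendstoD)
  then show ?thesis
    by (intro has_derivative_transform_eventually[OF *])
      (use sum[OF linear_D] u(2) in \<open>auto elim!: eventually_mono simp flip: sum[OF linear_D]\<close>)
qed

lemma frechet_chart_metric: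
  assumes u: "u \<in> U"
  shows "frechet_derivative (\<lambda>y. chart_metric \<Phi> y \<xi> \<eta>) (at u) \<zeta> =
    Im (kform (D2 u \<xi> \<zeta>) (D u \<eta>) + kform (D u \<xi>) (D2 u \<eta> \<zeta>))"
proof -
  have "((\<lambda>y. Im (kform (D y \<xi>) (D y \<eta>))) has_derivative
     (\<lambda>\<zeta>. Im (kform (D u \<xi>) (D2 u \<eta> \<zeta>) + kform (D2 u \<xi> \<zeta>) (D u \<eta>)))) (at u)"
    by (intro bounded_linear.has_derivative[OF bounded_linear_Im]
        bounded_bilinear.FDERIV[OF bounded_bilinear_kform] D_has_derivative_const u)
  then have "((\<lambda>y. chart_metric \<Phi> y \<xi> \<eta>) has_derivative
     (\<lambda>\<zeta>. Im (kform (D u \<xi>) (D2 u \<eta> \<zeta>) + kform (D2 u \<xi> \<zeta>) (D u \<eta>)))) (at u)"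
    by (rule has_derivative_transform_within_open[OF _ open_U u]) (simp add: chart_metric_eq)
  then show ?thesis by (simp add: frechet_derivative_eqI)
qed

end

lemma linear_injective_imp_surjective_dim:
  fixes f :: "'a::euclidean_space \<Rightarrow> 'b::euclidean_space"
  assumes "linear f" "inj f" "DIM('a) = DIM('b)"
  shows "surj f"
proof -
  have "dim (range f) = DIM('b)"
    using dim_image_eq[OF assms(1), of UNIV] assms(2,3) by simp
  then have "span (range f) = UNIV" by (simp add: dim_eq_full)
  moreover have "span (range f) = range f"
    using linear_span_image[OF assms(1), of UNIV] by simp
  ultimately show ?thesis by simp
qed

locale injective_family = geodesic_family +
  assumes inj_jacobi: "u \<in> U \<Longrightarrow> inj (jacobi_of \<Phi> u)"
begin

lemma inj_D:
  assumes u: "u \<in> U"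
  shows "inj (D u)"
proof (rule injI)
  fix \<xi> \<eta> assume "D u \<xi> = D u \<eta>"
  then have "jacobi_of \<Phi> u \<xi> = jacobi_of \<Phi> u \<eta>"
    by (intro ext) (simp add: jacobi_of_eq[OF u])
  then show "\<xi> = \<eta>" using inj_jacobi[OF u] by (simp add: inj_eq)
qed

lemma D_surj:
  assumes u: "u \<in> U" and w: "kform (mu u) w = 0"
  obtains \<xi> where "D u \<xi> = w"
proof -
  \<comment> \<open>A dimension count: \<open>L\<close> is an injective map between real vector spaces of dimension 6.\<close>
  define L where "L p = D u (fst p) + cscale (snd p) (mu u)" for p :: "(real^4) \<times> complex"
  have kform_L: "kform (mu u) (L p) = snd p" for p
    by (simp add: L_def kform_linear kform_mu_D[OF u] kform_cscale kform_mu[OF u])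
  have cscale_add: "cscale (c + d) a = cscale c a + cscale d a" "cscale (r *\<^sub>R c) a = r *\<^sub>R cscale c a" for c d a r
    by (simp_all add: sl2_simps algebra_simps)
  have L: "linear L"
    using linear_D[OF u] by (simp add: linear_iff L_def cscale_add algebra_simps)
  have "inj L"
  proof (subst linear_injective_0[OF L], intro allI impI)
    fix p assume p: "L p = 0"
    then have "snd p = 0" using kform_L[of p] by (simp add: kform_linear)
    with p have "D u (fst p) = D u 0" using linear_0[OF linear_D[OF u]] by (simp add: L_def)
    then have "fst p = 0" using inj_D[OF u] by (simp add: inj_eq)
    with \<open>snd p = 0\<close> show "p = 0" by (simp add: prod_eq_iff)
  qed
  then have "surj L" by (intro linear_injective_imp_surjective_dim L) simp_all
  then obtain p where p: "L p = w" by (metis surjD)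
  then have "snd p = 0" using kform_L[of p] w by simp
  then have "D u (fst p) = w" using p by (simp add: L_def)
  then show thesis by (rule that)
qed

text \<open>The tangent space is closed under multiplication by i, so testing the imaginary part on
  \<open>c\<close> and on i \<open>c\<close> kills the complex value; the missing direction
  \<open>mu u\<close> is orthogonal to \<open>w\<close> anyway.\<close>

lemma D_nondegenerate:
  assumes u: "u \<in> U" and eq: "\<And>\<zeta>. Im (kform (D u \<xi>) (D u \<zeta>)) = Im (kform (D u \<eta>) (D u \<zeta>))"
  shows "\<xi> = \<eta>"
proof -
  define w where "w = D u \<xi> - D u \<eta>"
  have mw: "kform (mu u) w = 0" by (simp add: w_def kform_linear kform_mu_D[OF u])
  have Im0: "Im (kform w b) = 0" if "kform (mu u) b = 0" for b
    using D_surj[OF u that] eq by (metis kform_linear(2) diff_self minus_complex.simps(2) w_def)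
  have "w = 0"
  proof (rule kform_nondegenerate)
    fix b
    define c where "c = b - cscale (kform (mu u) b) (mu u)"
    have c: "kform (mu u) c = 0" by (simp add: c_def kform_linear kform_cscale kform_mu[OF u])
    have "Im (kform w c) = 0" "Im (kform w (cscale \<i> c)) = 0"
      by (rule Im0, simp add: kform_cscale c)+
    then have "kform w c = 0" by (simp add: kform_cscale complex_eq_iff)
    then show "kform w b = 0" using mw by (simp add: c_def kform_linear kform_cscale kform_commute)
  qed
  then show ?thesis using inj_D[OF u] by (simp add: w_def inj_eq)
qed

text \<open>On the complex sphere the induced field is the adjoint action, m to
  \<open>bracket m a\<close>: the double bracket removes from \<open>a\<close> its component along
  m, exactly as the projection does.\<close>

lemma chart_field_eqI:
  assumes u: "u \<in> U" and \<xi>: "D u \<xi> = bracket (mu u) a"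
  shows "chart_field \<Phi> (killing_projection a) u = \<xi>"
proof -
  have eq: "jacobi_of \<Phi> u \<xi> t = killing_projection a (\<Phi> u t, velocity (\<Phi> u) t)" for t
    by (simp add: jacobi_of_eq[OF u] killing_projection_eq[OF Phi_pos[OF u]] momentum_Phi[OF u] \<xi> bracket_bracket kform_mu[OF u])
  show ?thesis
    unfolding chart_field_def
  proof (rule the_equality)
    fix \<eta> assume "\<forall>t. jacobi_of \<Phi> u \<eta> t = killing_projection a (\<Phi> u t, velocity (\<Phi> u) t)"
    then have "jacobi_of \<Phi> u \<eta> = jacobi_of \<Phi> u \<xi>" by (simp add: eq fun_eq_iff)
    then show "\<eta> = \<xi>" using inj_jacobi[OF u] by (simp add: inj_eq)
  qed (simp add: eq)
qed

lemma D_chart_field: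
  assumes u: "u \<in> U"
  shows "D u (chart_field \<Phi> (killing_projection a) u) = bracket (mu u) a"
proof -
  obtain \<xi> where "D u \<xi> = bracket (mu u) a" by (rule D_surj[OF u kform_bracket_left])
  then show ?thesis using chart_field_eqI[OF u] by simp
qed

lemma killing_on_chart_field: "killing_on (chart_metric \<Phi>) U (chart_field \<Phi> (killing_projection a))"
proof -
  let ?X = "chart_field \<Phi> (killing_projection a)"
  have smooth: "smooth_on U ?X"
    by (rule Gram_solution_smooth[OF open_U linear_D inj_D smooth_D _ D_chart_field])
      (auto intro: smooth_on_bilinear[OF bounded_bilinear_bracket] open_U smooth_mu smooth_on_const)
  have "frechet_derivative (\<lambda>y. chart_metric \<Phi> y \<xi> \<eta>) (at u) (?X u)
        + chart_metric \<Phi> u (frechet_derivative ?X (at u) \<xi>) \<eta>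
        + chart_metric \<Phi> u \<xi> (frechet_derivative ?X (at u) \<eta>) = 0" if u: "u \<in> U" for u \<xi> \<eta>
  proof -
    let ?X' = "frechet_derivative ?X (at u)"
    have "((\<lambda>y. D y (?X y)) has_derivative (\<lambda>\<zeta>. D u (?X' \<zeta>) + D2 u (?X u) \<zeta>)) (at u)"
      by (rule D_has_derivative[OF has_derivative_ident u smooth_on_has_derivative[OF smooth u]])
    then have 1: "((\<lambda>y. bracket (mu y) a) has_derivative (\<lambda>\<zeta>. D u (?X' \<zeta>) + D2 u (?X u) \<zeta>)) (at u)"
      by (rule has_derivative_transform_within_open[OF _ open_U u]) (simp add: D_chart_field)
    have 2: "((\<lambda>y. bracket (mu y) a) has_derivative (\<lambda>\<zeta>. bracket (D u \<zeta>) a)) (at u)"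
      using bounded_bilinear.FDERIV[OF bounded_bilinear_bracket mu_has_derivative[OF u] has_derivative_const]
      by (simp add: bracket_linear)
    \<comment> \<open>Obtained by differentiating \<open>D u (?X u) = bracket (mu u) a\<close>. In
      the Lie derivative the terms with \<open>?X'\<close> then cancel, and skewness of the bracket
      with \<open>a\<close> for \<open>kform\<close> remains.\<close>
    have D2: "D2 u \<zeta> (?X u) = bracket (D u \<zeta>) a - D u (?X' \<zeta>)" for \<zeta>
      using fun_cong[OF has_derivative_unique[OF 1 2], of \<zeta>]
      by (simp add: D2_commute[OF u, of "?X u"] algebra_simps)
    have "kform (bracket p a) q + kform p (bracket q a) = 0" for p q
      by (simp add: sl2_simps algebra_simps)
    then show ?thesis
      unfolding frechet_chart_metric[OF u] chart_metric_eq[OF u] D2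
      by (simp add: kform_linear flip: plus_complex.simps)
  qed
  with smooth show ?thesis by (simp add: killing_on_def)
qed

text \<open>Gauss formula for a submanifold of flat space: the connection is the tangential part of
  the second derivative. The normal space is the complex line of \<open>mu u\<close>, so a complex
  multiple is subtracted. The diagonal suffices for the geodesic equation.\<close>

lemma christoffel_chart_metric:
  assumes u: "u \<in> U"
  shows "D u (christoffel (chart_metric \<Phi>) u \<xi> \<xi>) = D2 u \<xi> \<xi> - cscale (kform (mu u) (D2 u \<xi> \<xi>)) (mu u)"
proof -
  have "kform (mu u) (D2 u \<xi> \<xi> - cscale (kform (mu u) (D2 u \<xi> \<xi>)) (mu u)) = 0"
    by (simp add: kform_linear kform_cscale kform_mu[OF u])
  then obtain \<omega> where \<omega>: "D u \<omega> = D2 u \<xi> \<xi> - cscale (kform (mu u) (D2 u \<xi> \<xi>)) (mu u)"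
    by (rule D_surj[OF u])
  have "christoffel (chart_metric \<Phi>) u \<xi> \<xi> = \<omega>"
  proof (rule christoffel_eqI)
    fix \<zeta> show "chart_metric \<Phi> u \<omega> \<zeta> = (frechet_derivative (\<lambda>y. chart_metric \<Phi> y \<xi> \<zeta>) (at u) \<xi>
      + frechet_derivative (\<lambda>y. chart_metric \<Phi> y \<xi> \<zeta>) (at u) \<xi>
      - frechet_derivative (\<lambda>y. chart_metric \<Phi> y \<xi> \<xi>) (at u) \<zeta>) / 2"
      unfolding frechet_chart_metric[OF u] chart_metric_eq[OF u] \<omega>
      by (simp add: kform_linear kform_cscale kform_mu_D[OF u] D2_commute[OF u, of \<zeta>] kform_commute[of "D u \<xi>"])
  next
    fix w w' assume "\<And>z. chart_metric \<Phi> u w z = chart_metric \<Phi> u w' z"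
    then show "w = w'" by (intro D_nondegenerate[OF u]) (simp add: chart_metric_eq[OF u])
  qed
  with \<omega> show ?thesis by simp
qed

lemma geodesic_mu:
  assumes S: "open S" "s \<in> S" and geo: "geodesic_on (chart_metric \<Phi>) S u" and U: "\<And>s. s \<in> S \<Longrightarrow> u s \<in> U"
  shows "((\<lambda>s. mu (u s)) has_vector_derivative D (u s) (velocity u s)) (at s)"
    and "\<exists>c. ((\<lambda>s. D (u s) (velocity u s)) has_vector_derivative cscale c (mu (u s))) (at s)"
proof -
  have smooth: "smooth_on S u" using geo by (simp add: geodesic_on_def)
  note u' = smooth_on_has_vector_derivative[OF smooth S(2), unfolded has_vector_derivative_def]
  note u'' = smooth_on_has_vector_derivative[OF smooth_on_velocity[OF smooth S(1)] S(2), unfolded has_vector_derivative_def]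
  note lin = linear_cmul[OF linear_D[OF U[OF S(2)]]]
  show "((\<lambda>s. mu (u s)) has_vector_derivative D (u s) (velocity u s)) (at s)"
    unfolding has_vector_derivative_def
    using has_derivative_compose[OF u' mu_has_derivative[OF U[OF S(2)]]] by (simp add: lin)
  let ?S = "D2 (u s) (velocity u s) (velocity u s)"
  have "velocity (velocity u) s = - christoffel (chart_metric \<Phi>) (u s) (velocity u s) (velocity u s)"
    using geo S(2) by (simp add: geodesic_on_def covariant_along_def eq_neg_iff_add_eq_0)
  then have eq: "D (u s) (velocity (velocity u) s) + ?S = cscale (kform (mu (u s)) ?S) (mu (u s))"
    using christoffel_chart_metric[OF U[OF S(2)]] by (simp add: linear_neg[OF linear_D[OF U[OF S(2)]]])
  have D2: "D2 (u s) \<xi> (r *\<^sub>R \<eta>) = r *\<^sub>R D2 (u s) \<xi> \<eta>" for \<xi> r \<eta>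
    by (rule linear_cmul[OF has_derivative_linear[OF D_has_derivative_const[OF U[OF S(2)]]]])
  have "((\<lambda>s. D (u s) (velocity u s)) has_vector_derivative D (u s) (velocity (velocity u) s) + ?S) (at s)"
    unfolding has_vector_derivative_def
    using D_has_derivative[OF u' U[OF S(2)] u''] by (simp add: lin D2 scaleR_add_right)
  then have "((\<lambda>s. D (u s) (velocity u s)) has_vector_derivative cscale (kform (mu (u s)) ?S) (mu (u s))) (at s)"
    unfolding eq .
  then show "\<exists>c. ((\<lambda>s. D (u s) (velocity u s)) has_vector_derivative cscale c (mu (u s))) (at s)" by blast
qed

end

lemma local_param_injective_family: "local_param U \<Phi> \<Longrightarrow> injective_family U \<Phi>"
  by unfold_locales (auto simp: local_param_def)

section \<open>Charts\<close>

text \<open>A Jacobi field determines \<open>D u \<xi>\<close> because its covariant derivative along the geodesic is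
  \<open>killing (D u \<xi>)\<close>.\<close>

lemma (in geodesic_family) inj_jacobi_of:
  assumes u: "u \<in> U" and inj: "inj (D u)"
  shows "inj (jacobi_of \<Phi> u)"
proof (rule injI)
  fix \<xi> \<eta> assume eq: "jacobi_of \<Phi> u \<xi> = jacobi_of \<Phi> u \<eta>"
  define w where "w = D u \<xi> - D u \<eta>"
  have mw: "kform (mu u) w = 0" by (simp add: w_def kform_linear kform_mu_D[OF u])
  have 0: "killing (bracket (mu u) w) (\<Phi> u t) = 0" for t
    using fun_cong[OF eq, of t] by (simp add: jacobi_of_eq[OF u] w_def bracket_linear killing_linear)
  have "covariant_along hyp_metric (\<Phi> u) (\<lambda>t. killing (bracket (mu u) w) (\<Phi> u t)) 0 = killing (bracket (mu u) (bracket (mu u) w)) (\<Phi> u 0)"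
    using killing_along_geodesic(2)[OF geodesic[OF u], of _ 0 0] by (simp add: momentum_Phi[OF u])
  moreover have "bracket (mu u) (bracket (mu u) w) = w" by (simp add: bracket_bracket mw kform_mu[OF u])
  ultimately have killing: "killing w (\<Phi> u 0) = 0"
    by (simp add: 0 covariant_along_hyp Phi_pos[OF u] hyp_Gamma_linear velocity_def)
  let ?x = "\<Phi> u 0" and ?v = "velocity (\<Phi> u) 0" 
  have x: "?x $ 0 > 0" by (rule Phi_pos[OF u])
  have vv: "?v \<bullet> ?v = (?x $ 0)\<^sup>2"
    using unit_geodesicD(3)[OF geodesic[OF u], of 0] x by (simp add: hyp_metric_def field_simps)
  \<comment> \<open>The rotation part is parallel to the velocity because the Jacobi field vanishes,
    and orthogonal to it because \<open>w\<close> is orthogonal to the momentum; so it is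
    zero.\<close>
  have "cross3 (rotor w ?x) ?v = 0"
    using 0[of 0] killing_bracket_momentum(1)[OF x, of ?v w] x by (simp add: momentum_Phi[OF u])
  moreover have "?v \<bullet> rotor w ?x = 0"
    using kform_momentum(2)[OF x, of ?v w] mw x by (simp add: momentum_Phi[OF u] hyp_metric_def)
  moreover have "cross3 v (cross3 r v) = (v \<bullet> v) *\<^sub>R r - (v \<bullet> r) *\<^sub>R v" for v r
    by (simp add: vec3_eq_iff inner_vec3 algebra_simps)
  ultimately have "rotor w ?x = 0" using vv x by (metis cross_zero_right diff_zero scaleR_eq_0_iff scaleR_zero_left power_eq_0_iff less_irrefl)
  then have "w = 0" using killing x killing_rotor_eq_0 by blast
  then show "\<xi> = \<eta>" using inj by (simp add: w_def inj_eq)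
qed

section \<open>Shifts and uniqueness of unit speed geodesics\<close>

lemma unit_geodesic_shift:
  assumes "unit_geodesic \<gamma>"
  shows "unit_geodesic (\<lambda>t. \<gamma> (a + t))" "velocity (\<lambda>t. \<gamma> (a + t)) t = velocity \<gamma> (a + t)"
proof -
  note \<gamma> = unit_geodesicD[OF assms]
  have shift: "((\<lambda>t. f (a + t)) has_vector_derivative f') (at t)" if "(f has_vector_derivative f') (at (a + t))"
    for f :: "real \<Rightarrow> real^3" and f' t
  proof -
    have "((\<lambda>t. a + t) has_vector_derivative 1) (at t)"
      unfolding has_real_derivative_iff_has_vector_derivative[symmetric]
      by (auto intro!: derivative_eq_intros)
    from vector_diff_chain_at[OF this that] show ?thesis by (simp add: o_def)
  qed
  have v: "velocity (\<lambda>t. \<gamma> (a + t)) = (\<lambda>t. velocity \<gamma> (a + t))"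
    by (intro ext velocity_eqI shift \<gamma>)
  then show "velocity (\<lambda>t. \<gamma> (a + t)) t = velocity \<gamma> (a + t)" by simp
  have "velocity (\<lambda>t. velocity \<gamma> (a + t)) t = - hyp_Gamma (\<gamma> (a + t)) (velocity \<gamma> (a + t)) (velocity \<gamma> (a + t))" for t
    by (intro velocity_eqI shift \<gamma>)
  moreover have "smooth_on UNIV (\<lambda>t. \<gamma> (a + t))"
    by (rule smooth_on_affine[where A = "\<lambda>t. t", OF bounded_linear_ident open_UNIV open_UNIV _ \<gamma>(1)]) simp
  ultimately show "unit_geodesic (\<lambda>t. \<gamma> (a + t))"
    using \<gamma>(2,3) by (simp add: unit_geodesic_def geodesic_on_def covariant_along_hyp v)
qed

lemma orbit_of_shift:
  assumes "unit_geodesic \<gamma>"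
  shows "orbit_of (\<lambda>t. \<gamma> (a + t)) = orbit_of \<gamma>"
proof -
  have "range (\<lambda>t. (\<gamma> (a + t), velocity \<gamma> (a + t))) = (\<lambda>t. (\<gamma> t, velocity \<gamma> t)) ` range (\<lambda>t. a + t)"
    by (simp only: image_image)
  also have "range (\<lambda>t. a + t) = (UNIV :: real set)"
    by (metis surj_plus)
  finally show ?thesis by (simp add: orbit_of_def unit_geodesic_shift(2)[OF assms])
qed

text \<open>The reciprocal height is a linear coordinate in the hyperboloid model, hence satisfies
  y'' = y along unit speed geodesics.\<close>

lemma inverse_height_derivatives:
  assumes "unit_geodesic \<gamma>"
  shows "((\<lambda>t. 1 / \<gamma> t $ 0) has_real_derivative - velocity \<gamma> t $ 0 / (\<gamma> t $ 0)\<^sup>2) (at t)"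
    and "((\<lambda>t. - velocity \<gamma> t $ 0 / (\<gamma> t $ 0)\<^sup>2) has_real_derivative 1 / \<gamma> t $ 0) (at t)"
proof -
  note \<gamma> = unit_geodesicD[OF assms]
  have pos: "\<gamma> t $ 0 > 0" by (rule \<gamma>)
  have nth: "((\<lambda>t. f t $ 0) has_real_derivative f' $ 0) (at t)" if "(f has_vector_derivative f') (at t)" for f f'
    using vec_nth_has_derivative[OF that[unfolded has_vector_derivative_def], of 0]
    by (simp add: has_field_derivative_def mult.commute[of _ "f' $ 0"])
  note [derivative_intros] = nth[OF \<gamma>(4)] nth[OF \<gamma>(5)]
  show "((\<lambda>t. 1 / \<gamma> t $ 0) has_real_derivative - velocity \<gamma> t $ 0 / (\<gamma> t $ 0)\<^sup>2) (at t)"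
    using pos by (auto intro!: derivative_eq_intros simp: power2_eq_square)
  have vv: "velocity \<gamma> t \<bullet> velocity \<gamma> t = (\<gamma> t $ 0)\<^sup>2"
    using \<gamma>(3)[of t] pos by (simp add: hyp_metric_def field_simps)
  have "(- (- hyp_Gamma (\<gamma> t) (velocity \<gamma> t) (velocity \<gamma> t)) $ 0 * (\<gamma> t $ 0)\<^sup>2 +
      velocity \<gamma> t $ 0 * (2 * \<gamma> t $ 0 * velocity \<gamma> t $ 0)) / ((\<gamma> t $ 0)\<^sup>2 * (\<gamma> t $ 0)\<^sup>2) = 1 / \<gamma> t $ 0"
    using pos by (simp add: hyp_Gamma_def vv field_simps power2_eq_square)
  then show "((\<lambda>t. - velocity \<gamma> t $ 0 / (\<gamma> t $ 0)\<^sup>2) has_real_derivative 1 / \<gamma> t $ 0) (at t)"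
    using pos by (intro derivative_eq_intros refl) (auto simp: power2_eq_square)
qed

lemma real_derivative_zero_constant:
  "(\<And>t. (f has_real_derivative 0) (at t)) \<Longrightarrow> f t = f s" for f :: "real \<Rightarrow> real"
  using DERIV_isconst_all[of f t s] by blast

lemma unit_geodesic_unique:
  assumes \<gamma>: "unit_geodesic \<gamma>" and \<delta>: "unit_geodesic \<delta>"
    and eq: "\<gamma> 0 = \<delta> 0" "velocity \<gamma> 0 = velocity \<delta> 0"
  shows "\<gamma> = \<delta>"
proof -
  define d where "d t = 1 / \<gamma> t $ 0 - 1 / \<delta> t $ 0" for t
  define d' where "d' t = - velocity \<gamma> t $ 0 / (\<gamma> t $ 0)\<^sup>2 - (- velocity \<delta> t $ 0 / (\<delta> t $ 0)\<^sup>2)" for t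
  have [derivative_intros]: "(d has_real_derivative d' t) (at t)" "(d' has_real_derivative d t) (at t)" for t
    unfolding d_def[abs_def] d'_def[abs_def]
    by (rule DERIV_diff inverse_height_derivatives \<gamma> \<delta>)+
  have 0: "d 0 = 0" "d' 0 = 0" by (simp_all add: d_def d'_def eq)
  \<comment> \<open>First integrals of d'' = d; with zero initial data both combinations vanish
    identically.\<close>
  have "((\<lambda>t. exp (- t) * (d t + d' t)) has_real_derivative 0) (at t)" for t
    by (auto intro!: derivative_eq_intros simp: algebra_simps)
  from real_derivative_zero_constant[OF this, of _ 0] have 1: "d t + d' t = 0" for t
    using 0 by simp
  have "((\<lambda>t. exp t * (d t - d' t)) has_real_derivative 0) (at t)" for t
    by (auto intro!: derivative_eq_intros simp: algebra_simps)
  from real_derivative_zero_constant[OF this, of _ 0] have 2: "d t - d' t = 0" for t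
    using 0 by simp
  have height: "\<gamma> t $ 0 = \<delta> t $ 0" for t
    using 1[of t] 2[of t] unit_geodesicD(2)[OF \<gamma>, of t] unit_geodesicD(2)[OF \<delta>, of t]
    by (simp add: d_def)
  \<comment> \<open>The last component of the conserved momentum gives the horizontal velocity once
    the height is known.\<close>
  have horiz_v: "horiz (velocity \<gamma> t) = horiz (velocity \<delta> t)" for t
  proof -
    have "momentum (\<gamma> t) (velocity \<gamma> t) = momentum (\<delta> t) (velocity \<delta> t)"
      using momentum_geodesic[OF \<gamma>, of t 0] momentum_geodesic[OF \<delta>, of t 0] eq by simp
    then show ?thesis
      using unit_geodesicD(2)[OF \<delta>, of t] by (simp add: momentum_def Let_def height)
  qed
  have deriv: "((\<lambda>t. horiz (\<gamma> t)) has_vector_derivative horiz (velocity \<gamma> t)) (at t)" if "unit_geodesic \<gamma>" for \<gamma> t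
    by (rule bounded_linear.has_vector_derivative[OF bounded_linear_horiz unit_geodesicD(4)[OF that]])
  have "((\<lambda>t. horiz (\<gamma> t) - horiz (\<delta> t)) has_vector_derivative 0) (at t)" for t
    using has_vector_derivative_diff[OF deriv[OF \<gamma>] deriv[OF \<delta>], of t] by (simp add: horiz_v)
  then obtain c where c: "\<And>t. horiz (\<gamma> t) - horiz (\<delta> t) = c"
    using has_vector_derivative_zero_constant[of UNIV "\<lambda>t. horiz (\<gamma> t) - horiz (\<delta> t)"]
    by (metis convex_UNIV has_vector_derivative_at_within UNIV_I)
  have "horiz (\<gamma> t) = horiz (\<delta> t)" for t using c[of t] c[of 0] eq by simp
  then show ?thesis using height by (auto simp: fun_eq_iff vec3_eq_iff horiz_def)
qed

section \<open>Explicit geodesics and the standard charts\<close>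

lemma smooth_on_height_vec:
  assumes "open S" "smooth_on S r" "smooth_on S z"
  shows "smooth_on S (\<lambda>y. height_vec (r y) (z y))"
  using smooth_on_bounded_linear[OF bounded_linear_height_vec assms(1) smooth_on_Pair[OF assms]] by simp

lemma smooth_on_cosh_sinh:
  fixes f :: "'a::euclidean_space \<Rightarrow> real"
  assumes "open S" "smooth_on S f"
  shows "smooth_on S (\<lambda>x. cosh (f x))" "smooth_on S (\<lambda>x. sinh (f x))"
  unfolding cosh_def sinh_def
  by (intro smooth_on_scaleR smooth_on_const smooth_on_add smooth_on_diff smooth_on_exp smooth_on_minus assms)+

text \<open>The solution of y'' = y with y(0) = 1 and y'(0) = - \<open>\<nu>\<close>: the reciprocal
  height, normalised at the start.\<close>

definition den :: "real \<Rightarrow> real \<Rightarrow> real" where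
  "den \<nu> t = cosh t - \<nu> * sinh t"

lemma den_pos:
  assumes "\<bar>\<nu>\<bar> \<le> 1"
  shows "den \<nu> t > 0"
proof -
  have "\<nu> * sinh t \<le> \<bar>\<nu> * sinh t\<bar>" by simp
  also have "\<dots> \<le> \<bar>sinh t\<bar>" using assms by (simp add: abs_mult mult_left_le_one_le)
  also have "\<dots> < cosh t" by (simp add: abs_less_iff sinh_less_cosh_real) (metis cosh_minus sinh_less_cosh_real sinh_minus)
  finally show ?thesis by (simp add: den_def)
qed

text \<open>The geodesic from height \<open>e\<close> over \<open>h\<close> with initial velocity
  \<open>e\<close> times (\<open>\<nu>\<close>, \<open>w\<close>). Conservation of horizontal
  velocity over squared height forces the horizontal velocity
  \<open>e / (den \<nu> t)\<^sup>2\<close> times \<open>w\<close>, which is integrated here.\<close>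

definition std_geodesic :: "real \<Rightarrow> complex \<Rightarrow> real \<Rightarrow> complex \<Rightarrow> real \<Rightarrow> real^3" where
  "std_geodesic e h \<nu> w t = height_vec (e / den \<nu> t) (h + (e * sinh t / den \<nu> t) *\<^sub>R w)"

lemma smooth_on_std_geodesic:
  assumes "open S" "smooth_on S h" "smooth_on S \<nu>" "smooth_on S w" "smooth_on S \<tau>"
    "\<And>x. x \<in> S \<Longrightarrow> \<bar>\<nu> x\<bar> \<le> 1"
  shows "smooth_on S (\<lambda>x. std_geodesic e (h x) (\<nu> x) (w x) (\<tau> x))"
proof -
  have den: "smooth_on S (\<lambda>x. den (\<nu> x) (\<tau> x))"
    unfolding den_def by (intro smooth_on_diff smooth_on_mult smooth_on_cosh_sinh assms)
  have nz: "den (\<nu> x) (\<tau> x) \<noteq> 0" if "x \<in> S" for x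
    using den_pos[OF assms(6)[OF that], of "\<tau> x"] by simp
  show ?thesis
    unfolding std_geodesic_def
    by (intro smooth_on_height_vec smooth_on_divide smooth_on_const smooth_on_add smooth_on_scaleR smooth_on_mult
        smooth_on_cosh_sinh den nz assms)
qed

lemma std_geodesic:
  assumes e: "e > 0" and \<nu>: "\<nu>\<^sup>2 + (norm w)\<^sup>2 = 1"
  shows "unit_geodesic (std_geodesic e h \<nu> w)"
    and "velocity (std_geodesic e h \<nu> w) 0 = height_vec (e * \<nu>) (e *\<^sub>R w)"
proof -
  let ?\<gamma> = "std_geodesic e h \<nu> w"
  define d' where "d' t = sinh t - \<nu> * cosh t" for t
  have \<nu>1: "\<bar>\<nu>\<bar> \<le> 1" using \<nu> by (metis abs_le_square_iff abs_one le_add_same_cancel1 one_power2 zero_le_power2)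
  have pos: "den \<nu> t > 0" for t by (rule den_pos[OF \<nu>1])
  have nz: "den \<nu> t \<noteq> 0" for t using pos[of t] by simp
  have [derivative_intros]: "(den \<nu> has_real_derivative d' t) (at t)" "(d' has_real_derivative den \<nu> t) (at t)" for t
    unfolding den_def[abs_def] d'_def[abs_def]
    by (auto intro!: derivative_eq_intros)
  \<comment> \<open>A Wronskian and a first integral of y'' = y; they give the horizontal velocity
    and the unit length.\<close>
  have cs: "cosh t * den \<nu> t - sinh t * d' t = 1" for t
    using cosh_square_eq[of t] by (simp add: den_def d'_def algebra_simps power2_eq_square)
  have dd: "(den \<nu> t)\<^sup>2 - (d' t)\<^sup>2 = (norm w)\<^sup>2" for t
    using cosh_square_eq[of t] \<nu> unfolding den_def d'_def by algebra
  have height_vec: "((\<lambda>t. height_vec (r t) (h + z t *\<^sub>R w)) has_vector_derivative height_vec r' (z' *\<^sub>R w)) (at t)"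
    if "(r has_real_derivative r') (at t)" "(z has_real_derivative z') (at t)" for r z r' z' t h
  proof -
    have "((\<lambda>t. h + z t *\<^sub>R w) has_vector_derivative z' *\<^sub>R w) (at t)"
      using that(2) by (auto intro!: derivative_eq_intros simp: has_real_derivative_iff_has_vector_derivative)
    with that(1) show ?thesis
      unfolding has_vector_derivative_def has_field_derivative_def
      by (intro has_derivative_eq_rhs[OF height_vec_has_derivative]) (auto simp: fun_eq_iff vec3_eq_iff)
  qed
  define \<gamma>' where "\<gamma>' t = height_vec (- e * d' t / (den \<nu> t)\<^sup>2) ((e / (den \<nu> t)\<^sup>2) *\<^sub>R w)" for t
  have \<gamma>': "(?\<gamma> has_vector_derivative \<gamma>' t) (at t)" for t
    unfolding std_geodesic_def[abs_def] \<gamma>'_def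
  proof (rule height_vec)
    show "((\<lambda>t. e / den \<nu> t) has_real_derivative - e * d' t / (den \<nu> t)\<^sup>2) (at t)"
      using nz by (auto intro!: derivative_eq_intros simp: power2_eq_square)
    have "(e * cosh t * den \<nu> t - e * sinh t * d' t) / (den \<nu> t * den \<nu> t) = e / (den \<nu> t)\<^sup>2"
      using cs[of t] by (simp add: power2_eq_square mult.assoc flip: right_diff_distrib)
    then show "((\<lambda>t. e * sinh t / den \<nu> t) has_real_derivative e / (den \<nu> t)\<^sup>2) (at t)"
      using nz by (intro derivative_eq_intros refl) auto
  qed
  have v: "velocity ?\<gamma> = \<gamma>'" by (intro ext velocity_eqI \<gamma>')
  then show "velocity ?\<gamma> 0 = height_vec (e * \<nu>) (e *\<^sub>R w)"
    by (simp add: \<gamma>'_def den_def d'_def)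
  define \<gamma>'' where "\<gamma>'' t = height_vec (- e * ((den \<nu> t)\<^sup>2 - 2 * (d' t)\<^sup>2) / (den \<nu> t) ^ 3) ((- 2 * e * d' t / (den \<nu> t) ^ 3) *\<^sub>R w)" for t
  have "((\<lambda>t. height_vec (- e * d' t / (den \<nu> t)\<^sup>2) (0 + (e / (den \<nu> t)\<^sup>2) *\<^sub>R w)) has_vector_derivative \<gamma>'' t) (at t)" for t
    unfolding \<gamma>''_def
  proof (rule height_vec)
    show "((\<lambda>t. - e * d' t / (den \<nu> t)\<^sup>2) has_real_derivative - e * ((den \<nu> t)\<^sup>2 - 2 * (d' t)\<^sup>2) / (den \<nu> t) ^ 3) (at t)"
      using nz[of t] by (auto intro!: derivative_eq_intros simp: field_simps power2_eq_square power3_eq_cube)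
    show "((\<lambda>t. e / (den \<nu> t)\<^sup>2) has_real_derivative - 2 * e * d' t / (den \<nu> t) ^ 3) (at t)"
      using nz[of t] by (auto intro!: derivative_eq_intros simp: field_simps power2_eq_square power3_eq_cube)
  qed
  then have v': "velocity \<gamma>' t = \<gamma>'' t" for t
    unfolding \<gamma>'_def[abs_def] by (intro velocity_eqI) simp
  have p: "?\<gamma> t $ 0 > 0" for t using pos e by (simp add: std_geodesic_def)
  have norm_w: "(Re w)\<^sup>2 + (Im w)\<^sup>2 = (den \<nu> t)\<^sup>2 - (d' t)\<^sup>2" for t
    by (simp add: dd cmod_power2)
  have "\<gamma>' t \<bullet> \<gamma>' t = e\<^sup>2 * ((d' t)\<^sup>2 + ((Re w)\<^sup>2 + (Im w)\<^sup>2)) / (den \<nu> t) ^ 4" for t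
    using nz[of t] by (simp add: \<gamma>'_def inner_vec3 field_simps power2_eq_square power4_eq_xxxx)
  then have vv: "\<gamma>' t \<bullet> \<gamma>' t = e\<^sup>2 / (den \<nu> t)\<^sup>2" for t
    unfolding norm_w[of t] using nz[of t] by (simp add: field_simps power2_eq_square power4_eq_xxxx)
  have unit: "hyp_metric (?\<gamma> t) (\<gamma>' t) (\<gamma>' t) = 1" for t
    using e nz[of t] by (simp add: hyp_metric_def vv) (simp add: std_geodesic_def power_divide)
  have "\<gamma>'' t + hyp_Gamma (?\<gamma> t) (\<gamma>' t) (\<gamma>' t) = 0" for t
    using nz[of t] e unfolding hyp_Gamma_def vv
    by (simp add: vec3_eq_iff \<gamma>''_def \<gamma>'_def std_geodesic_def field_simps power2_eq_square power3_eq_cube)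
  moreover have "smooth_on UNIV ?\<gamma>"
    using smooth_on_std_geodesic[of UNIV "\<lambda>_. h" "\<lambda>_. \<nu>" "\<lambda>_. w" "\<lambda>t. t" e] \<nu>1
    by (auto intro: smooth_on_const smooth_on_ident)
  ultimately show "unit_geodesic ?\<gamma>"
    using p unit by (simp add: unit_geodesic_def geodesic_on_def covariant_along_hyp v v')
qed

lemma velocity_vertical_somewhere:
  assumes "unit_geodesic \<gamma>"
  obtains t where "velocity \<gamma> t $ 0 \<noteq> 0"
proof -
  have "\<exists>t. velocity \<gamma> t $ 0 \<noteq> 0"
  proof (rule ccontr)
    assume "\<nexists>t. velocity \<gamma> t $ 0 \<noteq> 0"
    then have "((\<lambda>t. 0) has_real_derivative 1 / \<gamma> 0 $ 0) (at 0)"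
      using inverse_height_derivatives(2)[OF assms, of 0] by simp
    then have "1 / \<gamma> 0 $ 0 = 0" by (metis DERIV_const DERIV_unique)
    then show False using unit_geodesicD(2)[OF assms, of 0] by simp
  qed
  then show thesis using that by blast
qed

definition chart_base :: "real^4 \<Rightarrow> complex" where
  "chart_base u = Complex (u $ 1) (u $ 2)"

definition chart_dir :: "real^4 \<Rightarrow> complex" where
  "chart_dir u = Complex (u $ 3) (u $ 4)"

definition chart_slope :: "real \<Rightarrow> real^4 \<Rightarrow> real" where
  "chart_slope \<sigma> u = \<sigma> * sqrt (1 - (norm (chart_dir u))\<^sup>2)"

text \<open>The geodesics crossing the height \<open>e\<close> transversally, upwards or downwards according to the
  sign \<open>\<sigma>\<close>, parametrised by the crossing point and the horizontal part of the direction there.\<close>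

definition std_chart :: "real \<Rightarrow> real \<Rightarrow> real^4 \<Rightarrow> real \<Rightarrow> real^3" where
  "std_chart e \<sigma> u = std_geodesic e (chart_base u) (chart_slope \<sigma> u) (chart_dir u)"

definition std_chart_domain :: "(real^4) set" where
  "std_chart_domain = {u. norm (chart_dir u) < 1}"

lemma chart_linear: "bounded_linear chart_base" "bounded_linear chart_dir"
  by (intro linear_conv_bounded_linear[THEN iffD1] linearI;
      simp add: complex_eq_iff chart_base_def chart_dir_def)+

lemma chart_base_dir_eqI: "chart_base u = chart_base v \<Longrightarrow> chart_dir u = chart_dir v \<Longrightarrow> u = v"
  by (simp add: chart_base_def chart_dir_def vec_eq_iff forall_4)

lemma open_std_chart_domain: "open std_chart_domain"
  unfolding std_chart_domain_def
  by (intro open_Collect_less continuous_intros linear_continuous_on chart_linear)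

lemma chart_slope:
  assumes "u \<in> std_chart_domain" "\<bar>\<sigma>\<bar> = 1"
  shows "(chart_slope \<sigma> u)\<^sup>2 + (norm (chart_dir u))\<^sup>2 = 1" "chart_slope \<sigma> u \<noteq> 0" "\<bar>chart_slope \<sigma> u\<bar> \<le> 1"
proof -
  have "(norm (chart_dir u))\<^sup>2 < 1"
    using assms(1) by (simp add: std_chart_domain_def abs_square_less_1)
  moreover have "\<sigma>\<^sup>2 = 1" using assms(2) by (metis power2_abs one_power2)
  ultimately show 1: "(chart_slope \<sigma> u)\<^sup>2 + (norm (chart_dir u))\<^sup>2 = 1" "chart_slope \<sigma> u \<noteq> 0"
    using assms(2) by (auto simp: chart_slope_def power_mult_distrib)
  from 1(1) show "\<bar>chart_slope \<sigma> u\<bar> \<le> 1"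
    by (metis abs_le_square_iff abs_one le_add_same_cancel1 one_power2 zero_le_power2)
qed

lemma geodesic_family_std_chart:
  assumes e: "e > 0" and \<sigma>: "\<bar>\<sigma>\<bar> = 1"
  shows "geodesic_family std_chart_domain (std_chart e \<sigma>)"
proof
  show "open std_chart_domain" by (rule open_std_chart_domain)
  show "unit_geodesic (std_chart e \<sigma> u)" if "u \<in> std_chart_domain" for u
    unfolding std_chart_def by (rule std_geodesic(1)[OF e chart_slope(1)[OF that \<sigma>]])
  have o: "open (std_chart_domain \<times> (UNIV :: real set))"
    by (intro open_Times open_std_chart_domain open_UNIV)
  have sq: "(norm z)\<^sup>2 = Re z * Re z + Im z * Im z" for z
    unfolding cmod_power2 by (simp add: power2_eq_square)
  note lin = smooth_on_bounded_linear[OF _ o smooth_on_fst[OF o smooth_on_ident]]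
  have "smooth_on (std_chart_domain \<times> UNIV) (\<lambda>p::(real^4) \<times> real.
      std_geodesic e (chart_base (fst p)) (chart_slope \<sigma> (fst p)) (chart_dir (fst p)) (snd p))"
  proof (rule smooth_on_std_geodesic[OF o])
    show "smooth_on (std_chart_domain \<times> UNIV) (\<lambda>p::(real^4) \<times> real. chart_slope \<sigma> (fst p))"
      unfolding chart_slope_def sq
    proof (intro smooth_on_mult smooth_on_const smooth_on_sqrt smooth_on_diff smooth_on_add o
          smooth_on_bounded_linear[OF bounded_linear_Re] smooth_on_bounded_linear[OF bounded_linear_Im]
          lin chart_linear)
      fix p :: "(real^4) \<times> real" assume "p \<in> std_chart_domain \<times> UNIV"
      then show "0 < 1 - (Re (chart_dir (fst p)) * Re (chart_dir (fst p)) + Im (chart_dir (fst p)) * Im (chart_dir (fst p)))"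
        by (auto simp: std_chart_domain_def abs_square_less_1 simp flip: sq)
    qed
  qed (auto intro: lin chart_linear smooth_on_snd[OF o smooth_on_ident] chart_slope(3)[OF _ \<sigma>])
  then show "smooth_on (std_chart_domain \<times> UNIV) (\<lambda>(u, t). std_chart e \<sigma> u t)"
    by (simp add: std_chart_def case_prod_unfold)
qed

lemma mu_std_chart:
  assumes e: "e > 0" and \<sigma>: "\<bar>\<sigma>\<bar> = 1" and u: "u \<in> std_chart_domain"
  shows "geodesic_family.mu (std_chart e \<sigma>) u =
    (let h = chart_base u; \<nu> = of_real (chart_slope \<sigma> u); w = chart_dir u; g = - cnj w / of_real (2 * e)
     in (e *\<^sub>R w / 2 - \<nu> * h + g * h\<^sup>2, \<nu> - 2 * g * h, g))"
proof -
  have "std_chart e \<sigma> u 0 = height_vec e (chart_base u)"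
    by (simp add: std_chart_def std_geodesic_def den_def)
  moreover have "velocity (std_chart e \<sigma> u) 0 = height_vec (e * chart_slope \<sigma> u) (e *\<^sub>R chart_dir u)"
    unfolding std_chart_def by (rule std_geodesic(2)[OF e chart_slope(1)[OF u \<sigma>]])
  moreover have "horiz (height_vec r z) = z" for r z by (simp add: complex_eq_iff)
  ultimately show ?thesis
    using e by (simp add: geodesic_family.mu_def[OF geodesic_family_std_chart[OF e \<sigma>]] momentum_def Let_def
        power2_eq_square scaleR_conv_of_real)
qed

text \<open>The momentum is read backwards: its last component gives the direction and thereby the
  slope; the base point follows from the middle component if the direction is nonzero, and otherwise
  from the first, since the slope does not vanish. Injectivity of the derivative follows the same
  pattern along a line.\<close>

lemma local_param_std_chart:
  assumes e: "e > 0" and \<sigma>: "\<bar>\<sigma>\<bar> = 1"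
  shows "local_param std_chart_domain (std_chart e \<sigma>)"
proof -
  let ?U = std_chart_domain and ?\<Phi> = "std_chart e \<sigma>"
  interpret geodesic_family ?U ?\<Phi> by (rule geodesic_family_std_chart[OF e \<sigma>])
  note mu = mu_std_chart[OF e \<sigma>, unfolded Let_def]
  note slope = chart_slope(2)[OF _ \<sigma>]
  have mu_inj: "u = v" if u: "u \<in> ?U" and v: "v \<in> ?U" and eq: "mu u = mu v" for u v
  proof -
    have w: "chart_dir u = chart_dir v"
      using eq e by (simp add: mu[OF u] mu[OF v])
    then have \<nu>: "chart_slope \<sigma> u = chart_slope \<sigma> v" by (simp add: chart_slope_def)
    show ?thesis
    proof (cases "chart_dir u = 0")
      case True
      then have "chart_base u = chart_base v"
        using eq slope[OF v] w by (simp add: mu[OF u] mu[OF v] \<nu>)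
      with w show ?thesis by (rule chart_base_dir_eqI[rotated])
    next
      case False
      then have "chart_base u = chart_base v"
        using eq w e by (simp add: mu[OF u] mu[OF v] \<nu>)
      with w show ?thesis by (rule chart_base_dir_eqI[rotated])
    qed
  qed
  have "inj_on (\<lambda>u. orbit_of (?\<Phi> u)) ?U"
  proof (rule inj_onI)
    fix u v assume u: "u \<in> ?U" and v: "v \<in> ?U" and eq: "orbit_of (?\<Phi> u) = orbit_of (?\<Phi> v)"
    have "(?\<Phi> u 0, velocity (?\<Phi> u) 0) \<in> orbit_of (?\<Phi> v)"
      unfolding eq[symmetric] by (simp add: orbit_of_def)
    then obtain t where "?\<Phi> u 0 = ?\<Phi> v t" "velocity (?\<Phi> u) 0 = velocity (?\<Phi> v) t"
      by (auto simp: orbit_of_def)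
    then have "mu u = mu v" using momentum_Phi[OF v, of t] by (simp add: mu_def)
    then show "u = v" by (rule mu_inj[OF u v])
  qed
  moreover have "inj (jacobi_of ?\<Phi> u)" if u: "u \<in> ?U" for u
  proof (rule inj_jacobi_of[OF u], subst linear_injective_0[OF linear_D[OF u]], intro allI impI)
    fix \<zeta> assume D0: "D u \<zeta> = 0"
    have line: "((\<lambda>\<tau>. u + \<tau> *\<^sub>R \<zeta>) has_derivative (\<lambda>r. r *\<^sub>R \<zeta>)) (at 0)"
      by (auto intro!: derivative_eq_intros)
    have deriv: "((\<lambda>\<tau>. mu (u + \<tau> *\<^sub>R \<zeta>)) has_vector_derivative 0) (at 0)"
      using has_derivative_compose[OF line, of mu "D u"] mu_has_derivative[OF u]
        linear_cmul[OF linear_D[OF u]] D0 by (simp add: has_vector_derivative_def)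
    have "open {\<tau>. u + \<tau> *\<^sub>R \<zeta> \<in> ?U}"
      using open_vimage[OF open_U, of "\<lambda>\<tau>. u + \<tau> *\<^sub>R \<zeta>"] by (simp add: vimage_def continuous_intros)
    note transform = has_vector_derivative_transform_within_open[OF _ this, of _ _ 0]
    note uniq = vector_derivative_unique_at
    define h h' w w' where "h = chart_base u" "h' = chart_base \<zeta>" "w = chart_dir u" "w' = chart_dir \<zeta>"
    note def = this
    have base: "chart_base (u + \<tau> *\<^sub>R \<zeta>) = h + \<tau> *\<^sub>R h'" and dir: "chart_dir (u + \<tau> *\<^sub>R \<zeta>) = w + \<tau> *\<^sub>R w'" for \<tau>
      by (simp_all add: def linear_add linear_cmul bounded_linear.linear chart_linear)
    have "((\<lambda>\<tau>. snd (snd (mu (u + \<tau> *\<^sub>R \<zeta>)))) has_vector_derivative 0) (at 0)"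
      using bounded_linear.has_vector_derivative[OF bounded_linear_snd
          bounded_linear.has_vector_derivative[OF bounded_linear_snd deriv]] by simp
    then have "((\<lambda>\<tau>. - cnj (w + \<tau> *\<^sub>R w') / of_real (2 * e)) has_vector_derivative 0) (at 0)"
      by (rule transform) (use u in \<open>auto simp: mu dir\<close>)
    moreover have "((\<lambda>\<tau>. - cnj (w + \<tau> *\<^sub>R w') / of_real (2 * e)) has_vector_derivative - cnj w' / of_real (2 * e)) (at 0)"
      by (auto intro!: derivative_eq_intros has_vector_derivative_cnj)
    ultimately have "- cnj w' / of_real (2 * e) = 0" by (rule uniq[rotated])
    then have w': "w' = 0" using e by simp
    define g where "g = - cnj w / of_real (2 * e)"
    define \<nu> where "\<nu> = complex_of_real (chart_slope \<sigma> u)"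
    \<comment> \<open>As the direction is now constant along the line, so is the slope, and the
      square root need not be differentiated.\<close>
    have \<nu>: "of_real (chart_slope \<sigma> (u + \<tau> *\<^sub>R \<zeta>)) = \<nu>" for \<tau>
      using dir[of \<tau>] w' by (simp add: \<nu>_def chart_slope_def def)
    have "((\<lambda>\<tau>. fst (snd (mu (u + \<tau> *\<^sub>R \<zeta>)))) has_vector_derivative 0) (at 0)"
      using bounded_linear.has_vector_derivative[OF bounded_linear_fst
          bounded_linear.has_vector_derivative[OF bounded_linear_snd deriv]] by simp
    then have "((\<lambda>\<tau>. \<nu> - 2 * g * (h + \<tau> *\<^sub>R h')) has_vector_derivative 0) (at 0)"
      by (rule transform) (use u w' in \<open>auto simp: mu dir base \<nu> g_def\<close>)
    moreover have "((\<lambda>\<tau>. \<nu> - 2 * g * (h + \<tau> *\<^sub>R h')) has_vector_derivative - (2 * g * h')) (at 0)"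
      by (auto intro!: derivative_eq_intros)
    ultimately have "- (2 * g * h') = 0" by (rule uniq[rotated])
    then have gh: "g * h' = 0" by simp
    have "((\<lambda>\<tau>. fst (mu (u + \<tau> *\<^sub>R \<zeta>))) has_vector_derivative 0) (at 0)"
      using bounded_linear.has_vector_derivative[OF bounded_linear_fst deriv] by simp
    then have "((\<lambda>\<tau>. e *\<^sub>R w / 2 - \<nu> * (h + \<tau> *\<^sub>R h') + g * (h + \<tau> *\<^sub>R h')\<^sup>2) has_vector_derivative 0) (at 0)"
      by (rule transform) (use u w' in \<open>auto simp: mu dir base \<nu> g_def\<close>)
    moreover have "((\<lambda>\<tau>. e *\<^sub>R w / 2 - \<nu> * (h + \<tau> *\<^sub>R h') + g * (h + \<tau> *\<^sub>R h')\<^sup>2) has_vector_derivative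
        - (\<nu> * h') + g * (2 * h * h')) (at 0)"
      unfolding power2_eq_square by (auto intro!: derivative_eq_intros simp: algebra_simps)
    ultimately have "- (\<nu> * h') + g * (2 * h * h') = 0" by (rule uniq[rotated])
    then have "\<nu> * h' = 0" using gh by algebra
    then have "h' = 0" using slope[OF u] by (simp add: \<nu>_def)
    with w' show "\<zeta> = 0"
      using chart_base_dir_eqI[of \<zeta> 0] by (simp add: def linear_0 bounded_linear.linear chart_linear)
  qed
  ultimately show ?thesis
    by (simp add: local_param_def open_U smooth geodesic)
qed

text \<open>The parameter is shifted to a point where the velocity is not horizontal, and the height
  there becomes \<open>e\<close>; by uniqueness the shifted geodesic is a member of that standard
  chart.\<close>

lemma local_param_exists:
  assumes \<gamma>: "unit_geodesic \<gamma>"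
  obtains U \<Phi> where "local_param U \<Phi>" "orbit_of \<gamma> \<in> (\<lambda>u. orbit_of (\<Phi> u)) ` U"
proof -
  note D = unit_geodesicD[OF \<gamma>]
  obtain a where a: "velocity \<gamma> a $ 0 \<noteq> 0" by (rule velocity_vertical_somewhere[OF \<gamma>])
  define e h v \<sigma> where "e = \<gamma> a $ 0" "h = horiz (\<gamma> a)" "v = velocity \<gamma> a" "\<sigma> = sgn (velocity \<gamma> a $ 0)"
  note def = this
  have e: "e > 0" using D by (simp add: def)
  have \<sigma>: "\<bar>\<sigma>\<bar> = 1" using a by (simp add: def abs_sgn_eq)
  define w where "w = horiz v /\<^sub>R e"
  have "v \<bullet> v = e\<^sup>2" using D(3)[of a] e by (simp add: def hyp_metric_def field_simps)
  then have "(v $ 0)\<^sup>2 + (norm (horiz v))\<^sup>2 = e\<^sup>2"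
    unfolding cmod_power2 by (simp add: inner_vec3 power2_eq_square)
  then have nw: "(v $ 0 / e)\<^sup>2 + (norm w)\<^sup>2 = 1"
    using e by (simp add: w_def power_divide field_simps)
  define u :: "real^4" where "u = (\<chi> i. if i = 1 then Re h else if i = 2 then Im h else if i = 3 then Re w else Im w)"
  have u: "chart_base u = h" "chart_dir u = w"
    by (simp_all add: u_def chart_base_def chart_dir_def complex_eq_iff)
  have v0: "v $ 0 / e \<noteq> 0" using a e by (simp add: def)
  then have "(v $ 0 / e)\<^sup>2 > 0" by simp
  then have "(norm w)\<^sup>2 < 1" using nw by linarith
  then have uU: "u \<in> std_chart_domain"
    by (simp add: std_chart_domain_def u abs_square_less_1)
  have "sqrt (1 - (norm w)\<^sup>2) = \<bar>v $ 0 / e\<bar>" using nw by (simp add: eq_diff_eq flip: real_sqrt_abs)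
  then have slope: "chart_slope \<sigma> u = v $ 0 / e"
    using e by (simp add: chart_slope_def u def sgn_mult_abs mult.commute[of "sgn _"] abs_mult_sgn abs_div)
  have "(\<lambda>t. \<gamma> (a + t)) = std_chart e \<sigma> u"
  proof (rule unit_geodesic_unique[OF unit_geodesic_shift(1)[OF \<gamma>]])
    show "unit_geodesic (std_chart e \<sigma> u)"
      using geodesic_family.geodesic[OF geodesic_family_std_chart[OF e \<sigma>] uU] .
    show "\<gamma> (a + 0) = std_chart e \<sigma> u 0"
      by (simp add: std_chart_def std_geodesic_def den_def u vec3_eq_iff) (simp add: def)
    have "velocity (std_chart e \<sigma> u) 0 = height_vec (e * (v $ 0 / e)) (e *\<^sub>R w)"
      unfolding std_chart_def slope[symmetric] u(2)[symmetric]
      by (rule std_geodesic(2)[OF e chart_slope(1)[OF uU \<sigma>]])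
    then show "velocity (\<lambda>t. \<gamma> (a + t)) 0 = velocity (std_chart e \<sigma> u) 0"
      using e by (simp add: unit_geodesic_shift(2)[OF \<gamma>] vec3_eq_iff w_def) (simp add: def)
  qed
  then have "orbit_of \<gamma> = orbit_of (std_chart e \<sigma> u)"
    using orbit_of_shift[OF \<gamma>, of a] by simp
  then show thesis
    using that[OF local_param_std_chart[OF e \<sigma>]] uU by blast
qed

section \<open>Geodesics and ruled surfaces\<close>

definition momentum_orbit :: "oriented_geodesic \<Rightarrow> sl2" where
  "momentum_orbit l = (let p = SOME p. p \<in> l in momentum (fst p) (snd p))"

lemma momentum_orbit:
  assumes "unit_geodesic \<gamma>"
  shows "momentum_orbit (orbit_of \<gamma>) = momentum (\<gamma> t) (velocity \<gamma> t)"
proof -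
  have "(SOME p. p \<in> orbit_of \<gamma>) \<in> orbit_of \<gamma>"
    by (rule someI[of _ "(\<gamma> 0, velocity \<gamma> 0)"]) (simp add: orbit_of_def)
  then obtain s where "(SOME p. p \<in> orbit_of \<gamma>) = (\<gamma> s, velocity \<gamma> s)"
    by (auto simp: orbit_of_def)
  then show ?thesis using momentum_geodesic[OF assms, of s t] by (simp add: momentum_orbit_def)
qed

locale geodesic_curve =
  fixes I :: "real set" and c :: "real \<Rightarrow> oriented_geodesic"
  assumes is_geodesic: "L_geodesic I c"
begin

text \<open>A chart-free form of the curve, so that constancy arguments run over the whole interval
  at once.\<close>

definition z :: "real \<Rightarrow> sl2" where
  "z s = momentum_orbit (c s)"

lemma open_I: "open I" and convex_I: "convex I"
  using is_geodesic by (auto simp: L_geodesic_def is_interval_convex)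

lemma chart_curve:
  assumes "s \<in> chart_domain U \<Phi> I c"
  shows "chart_curve U \<Phi> c s \<in> U" "orbit_of (\<Phi> (chart_curve U \<Phi> c s)) = c s"
proof -
  have "c s \<in> (\<lambda>u. orbit_of (\<Phi> u)) ` U" using assms by (simp add: chart_domain_def)
  then show "chart_curve U \<Phi> c s \<in> U" "orbit_of (\<Phi> (chart_curve U \<Phi> c s)) = c s"
    unfolding chart_curve_def by (rule inv_into_into, rule f_inv_into_f)
qed

lemma chart_at:
  assumes "s \<in> I"
  obtains U \<Phi> where "local_param U \<Phi>" "s \<in> chart_domain U \<Phi> I c"
proof -
  obtain \<gamma> where \<gamma>: "unit_geodesic \<gamma>" "c s = orbit_of \<gamma>"
    using is_geodesic assms by (auto simp: L_geodesic_def LH3_def)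
  obtain U \<Phi> where "local_param U \<Phi>" "orbit_of \<gamma> \<in> (\<lambda>u. orbit_of (\<Phi> u)) ` U"
    by (rule local_param_exists[OF \<gamma>(1)])
  then show thesis by (intro that) (simp_all add: chart_domain_def assms \<gamma>(2))
qed

lemma
  assumes lp: "local_param U \<Phi>" and s: "s \<in> chart_domain U \<Phi> I c"
  shows z_chart: "z s = geodesic_family.mu \<Phi> (chart_curve U \<Phi> c s)"
    and velocity_z_chart:
      "(z has_vector_derivative geodesic_family.D \<Phi> (chart_curve U \<Phi> c s) (velocity (chart_curve U \<Phi> c) s)) (at s)"
      "velocity z s = geodesic_family.D \<Phi> (chart_curve U \<Phi> c s) (velocity (chart_curve U \<Phi> c) s)"
    and velocity2_z_chart: "\<exists>k. (velocity z has_vector_derivative cscale k (z s)) (at s)"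
    and has_velocity_chart: "(chart_curve U \<Phi> c has_vector_derivative velocity (chart_curve U \<Phi> c) s) (at s)"
proof -
  interpret injective_family U \<Phi> by (rule local_param_injective_family[OF lp])
  let ?u = "chart_curve U \<Phi> c" and ?S = "chart_domain U \<Phi> I c"
  have S: "open ?S" and geo: "geodesic_on (chart_metric \<Phi>) ?S ?u"
    using is_geodesic lp by (auto simp: L_geodesic_def)
  have z: "mu (?u s) = z s" if "s \<in> ?S" for s
    unfolding z_def mu_def momentum_orbit[OF geodesic[OF chart_curve(1)[OF that]], of 0, unfolded chart_curve(2)[OF that]] ..
  then show "z s = mu (?u s)" using s by simp
  note g = geodesic_mu[OF S _ geo chart_curve(1)]
  have z': "(z has_vector_derivative D (?u s) (velocity ?u s)) (at s)" if "s \<in> ?S" for s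
    by (rule has_vector_derivative_transform_within_open[OF g(1)[OF that] S that]) (simp_all add: z)
  then show "(z has_vector_derivative D (?u s) (velocity ?u s)) (at s)" using s by blast
  have v: "velocity z s = D (?u s) (velocity ?u s)" if "s \<in> ?S" for s
    using z'[OF that] by (rule velocity_eqI)
  then show "velocity z s = D (?u s) (velocity ?u s)" using s by blast
  obtain k where k: "((\<lambda>s. D (?u s) (velocity ?u s)) has_vector_derivative cscale k (mu (?u s))) (at s)"
    using g(2)[OF s] by blast
  have "(velocity z has_vector_derivative cscale k (mu (?u s))) (at s)"
    by (rule has_vector_derivative_transform_within_open[OF k S s]) (simp_all add: v)
  then show "\<exists>k. (velocity z has_vector_derivative cscale k (z s)) (at s)" using z[OF s] by metis
  have "smooth_on ?S ?u" using geo by (simp add: geodesic_on_def)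
  then show "(?u has_vector_derivative velocity ?u s) (at s)"
    using s by (rule smooth_on_has_vector_derivative)
qed

lemma z_has_velocity:
  assumes "s \<in> I"
  shows "(z has_vector_derivative velocity z s) (at s)"
proof -
  obtain U \<Phi> where lp: "local_param U \<Phi>" and s: "s \<in> chart_domain U \<Phi> I c"
    using chart_at[OF assms] .
  show ?thesis
    using velocity_z_chart(1)[OF lp s] unfolding velocity_z_chart(2)[OF lp s] .
qed

lemma kform_z:
  assumes "s \<in> I"
  shows "kform (z s) (z s) = 1" "kform (z s) (velocity z s) = 0"
proof -
  obtain U \<Phi> where lp: "local_param U \<Phi>" and s: "s \<in> chart_domain U \<Phi> I c"
    using chart_at[OF assms] .
  interpret injective_family U \<Phi> by (rule local_param_injective_family[OF lp])
  show "kform (z s) (z s) = 1" "kform (z s) (velocity z s) = 0"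
    unfolding z_chart[OF lp s] velocity_z_chart(2)[OF lp s]
    by (rule kform_mu kform_mu_D chart_curve(1)[OF s])+
qed

text \<open>The conserved angular momentum of the curve on the complex sphere. For empty
  \<open>I\<close> the choice is arbitrary.\<close>

definition generator :: sl2 where
  "generator = (SOME a. \<forall>s\<in>I. bracket (z s) (velocity z s) = a)"

lemma generator_eq:
  assumes "s \<in> I"
  shows "bracket (z s) (velocity z s) = generator"
proof -
  have "((\<lambda>s. bracket (z s) (velocity z s)) has_vector_derivative 0) (at s within I)" if s: "s \<in> I" for s
  proof -
    obtain k where k: "(velocity z has_vector_derivative cscale k (z s)) (at s)"
      by (rule chart_at[OF s]) (use velocity2_z_chart in blast)
    have "((\<lambda>s. bracket (z s) (velocity z s)) has_vector_derivative
        bracket (z s) (cscale k (z s)) + bracket (velocity z s) (velocity z s)) (at s)"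
      by (rule bounded_bilinear.has_vector_derivative[OF bounded_bilinear_bracket z_has_velocity[OF s] k])
    moreover have "bracket (z s) (cscale k (z s)) + bracket (velocity z s) (velocity z s) = 0"
      by (simp add: bracket_cscale cscale_linear)
    ultimately show ?thesis by (metis has_vector_derivative_at_within)
  qed
  then have "\<exists>a. \<forall>s\<in>I. bracket (z s) (velocity z s) = a"
    by (rule has_vector_derivative_zero_constant[OF convex_I]) auto
  then have "\<forall>s\<in>I. bracket (z s) (velocity z s) = generator"
    unfolding generator_def by (rule someI_ex)
  then show ?thesis using assms by blast
qed

lemma velocity_z:
  assumes "s \<in> I"
  shows "velocity z s = bracket (z s) generator"
proof -
  have "bracket (z s) (bracket (z s) (velocity z s)) = velocity z s"
    unfolding bracket_bracket kform_z[OF assms] by simp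
  then show ?thesis unfolding generator_eq[OF assms] by (rule sym)
qed

lemma kform_velocity_z:
  assumes "s \<in> I"
  shows "kform (velocity z s) (velocity z s) = - kform generator generator"
proof -
  have "kform (z s) generator = 0"
    using kform_bracket_left[of "z s" "velocity z s"] unfolding generator_eq[OF assms] .
  then have "kform (bracket (z s) generator) (bracket (z s) generator) = - kform generator generator"
    unfolding kform_bracket bracket_bracket kform_z(1)[OF assms] by simp
  then show ?thesis unfolding velocity_z[OF assms] .
qed

lemma integral_curve: "L_integral_curve (killing_projection generator) I c"
  unfolding L_integral_curve_def
proof (intro allI impI ballI)
  fix U \<Phi> s assume lp: "local_param U \<Phi>" and s: "s \<in> chart_domain U \<Phi> I c"
  interpret injective_family U \<Phi> by (rule local_param_injective_family[OF lp])
  have "s \<in> I" using s by (simp add: chart_domain_def)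
  then have "chart_field \<Phi> (killing_projection generator) (chart_curve U \<Phi> c s) = velocity (chart_curve U \<Phi> c) s"
    by (intro chart_field_eqI[OF chart_curve(1)[OF s]])
      (simp only: velocity_z flip: z_chart[OF lp s] velocity_z_chart(2)[OF lp s])
  then show "(chart_curve U \<Phi> c has_vector_derivative
      chart_field \<Phi> (killing_projection generator) (chart_curve U \<Phi> c s)) (at s)"
    using has_velocity_chart[OF lp s] by simp
qed

lemma chart_metric_velocity:
  assumes lp: "local_param U \<Phi>" and s: "s \<in> chart_domain U \<Phi> I c"
  shows "chart_metric \<Phi> (chart_curve U \<Phi> c s) (velocity (chart_curve U \<Phi> c) s) (velocity (chart_curve U \<Phi> c) s)
      = - Im (kform generator generator)"
proof -
  interpret injective_family U \<Phi> by (rule local_param_injective_family[OF lp])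
  have "s \<in> I" using s by (simp add: chart_domain_def)
  from kform_velocity_z[OF this] show ?thesis
    unfolding chart_metric_eq[OF chart_curve(1)[OF s]] velocity_z_chart(2)[OF lp s] by simp
qed

text \<open>The square length of the velocity is one constant for the whole curve. Over an empty
  \<open>I\<close> nullity is vacuous, hence the alternative, which recurs in
  \<open>totally_geodesic_iff\<close>.\<close>

lemma L_null_iff: "L_null I c \<longleftrightarrow> I = {} \<or> Im (kform generator generator) = 0"
proof
  assume null: "L_null I c"
  have "Im (kform generator generator) = 0" if s: "s \<in> I" for s
  proof -
    obtain U \<Phi> where lp: "local_param U \<Phi>" and s: "s \<in> chart_domain U \<Phi> I c"
      using chart_at[OF s] .
    then have "chart_metric \<Phi> (chart_curve U \<Phi> c s) (velocity (chart_curve U \<Phi> c) s) (velocity (chart_curve U \<Phi> c) s) = 0"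
      using null unfolding L_null_def by blast
    then show ?thesis unfolding chart_metric_velocity[OF lp s] by simp
  qed
  then show "I = {} \<or> Im (kform generator generator) = 0" by blast
next
  assume "I = {} \<or> Im (kform generator generator) = 0"
  then show "L_null I c"
    unfolding L_null_def by (auto simp: chart_metric_velocity) (auto simp: chart_domain_def)
qed

end

lemma L_killing_field_projection: "L_killing_field (killing_projection a)"
  unfolding L_killing_field_def
  using killing_projection_jacobi injective_family.killing_on_chart_field[OF local_param_injective_family]
  by blast

section \<open>The ruled surface and its second fundamental form\<close>

lemma smooth_on_hyp_metric:
  assumes S: "open S" and f: "smooth_on S f" and u: "smooth_on S u" and v: "smooth_on S v"
    and pos: "\<And>x. x \<in> S \<Longrightarrow> f x $ 0 > 0"
  shows "smooth_on S (\<lambda>x. hyp_metric (f x) (u x) (v x))"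
  unfolding hyp_metric_def
proof (intro smooth_on_divide smooth_on_inner smooth_on_power smooth_on_vec_nth S f u v)
  fix x assume "x \<in> S" then show "(f x $ 0)\<^sup>2 \<noteq> 0" using pos[of x] by simp
qed

lemma frechet_derivative_pair:
  fixes f :: "real \<times> real \<Rightarrow> 'b::euclidean_space"
  assumes "smooth_on S f" "p \<in> S"
  shows "frechet_derivative f (at p) b =
    fst b *\<^sub>R frechet_derivative f (at p) (1, 0) + snd b *\<^sub>R frechet_derivative f (at p) (0, 1)"
proof -
  have lin: "linear (frechet_derivative f (at p))"
    using smooth_on_has_derivative[OF assms] by (rule has_derivative_linear)
  have "b = fst b *\<^sub>R (1, 0) + snd b *\<^sub>R (0, 1)" by (simp add: prod_eq_iff)
  then have "frechet_derivative f (at p) b = frechet_derivative f (at p) (fst b *\<^sub>R (1, 0) + snd b *\<^sub>R (0, 1))"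
    by simp
  then show ?thesis by (simp only: linear_add[OF lin] linear_cmul[OF lin])
qed

locale ruled = geodesic_curve +
  fixes f :: "real \<times> real \<Rightarrow> real^3"
  assumes ruled_surface: "ruled_surface I c f"
begin

abbreviation a :: sl2 where "a \<equiv> generator"

definition fr :: "real \<times> real \<Rightarrow> real^3" where
  "fr p = frechet_derivative f (at p) (1, 0)"

definition fs :: "real \<times> real \<Rightarrow> real^3" where
  "fs p = frechet_derivative f (at p) (0, 1)"

text \<open>It reflects the choice of the starting points on the rulings, which \<open>f\<close>
  leaves free.\<close>

definition \<mu> :: "real \<times> real \<Rightarrow> real" where
  "\<mu> p = hyp_metric (f p) (fs p) (fr p)"

abbreviation S :: "(real \<times> real) set" where "S \<equiv> UNIV \<times> I"

lemma open_S: "open S"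
  by (intro open_Times open_UNIV open_I)

lemma smooth: "smooth_on S f" "smooth_on S fr" "smooth_on S fs"
proof -
  show f: "smooth_on S f" using ruled_surface by (simp add: ruled_surface_def)
  show "smooth_on S fr" "smooth_on S fs"
    unfolding fr_def[abs_def] fs_def[abs_def] by (rule smooth_on_frechet_derivative[OF f])+
qed

lemma frechet_f: "p \<in> S \<Longrightarrow> frechet_derivative f (at p) \<xi> = fst \<xi> *\<^sub>R fr p + snd \<xi> *\<^sub>R fs p"
  unfolding fr_def fs_def by (rule frechet_derivative_pair[OF smooth(1)])

lemma ruling: "s \<in> I \<Longrightarrow> unit_geodesic (\<lambda>r. f (r, s))" "s \<in> I \<Longrightarrow> orbit_of (\<lambda>r. f (r, s)) = c s"
  using ruled_surface by (auto simp: ruled_surface_def)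

lemma velocity_ruling:
  assumes "s \<in> I"
  shows "velocity (\<lambda>r. f (r, s)) r = fr (r, s)"
proof (rule velocity_eqI)
  have p: "(r, s) \<in> S" using assms by simp
  have 1: "((\<lambda>r. (r, s)) has_derivative (\<lambda>t. (t, 0))) (at r)"
    by (auto intro!: derivative_eq_intros)
  show "((\<lambda>r. f (r, s)) has_vector_derivative fr (r, s)) (at r)"
    unfolding has_vector_derivative_def
    using has_derivative_compose[OF 1 smooth_on_has_derivative[OF smooth(1) p]]
    by (simp add: frechet_f[OF p])
qed

lemma pos: "p \<in> S \<Longrightarrow> f p $ 0 > 0"
  using unit_geodesicD(2)[OF ruling(1), of "snd p" "fst p"] by (simp add: mem_Times_iff)

lemma unit_fr: "p \<in> S \<Longrightarrow> hyp_metric (f p) (fr p) (fr p) = 1"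
  using unit_geodesicD(3)[OF ruling(1), of "snd p" "fst p"] velocity_ruling[of "snd p" "fst p"]
  by (simp add: mem_Times_iff)

lemma z_eq: "p \<in> S \<Longrightarrow> momentum (f p) (fr p) = z (snd p)"
  using momentum_orbit[OF ruling(1), of "snd p" "fst p"] ruling(2)[of "snd p"] velocity_ruling[of "snd p" "fst p"]
  by (simp add: z_def mem_Times_iff)

lemma geodesic_ruling:
  assumes p: "p \<in> S"
  shows "frechet_derivative fr (at p) (1, 0) + hyp_Gamma (f p) (fr p) (fr p) = 0"
proof -
  obtain r s where rs: "p = (r, s)" by (cases p)
  with p have s: "s \<in> I" by simp
  have 1: "((\<lambda>r. (r, s)) has_derivative (\<lambda>t. (t, 0))) (at r)"
    by (auto intro!: derivative_eq_intros)
  note fr' = smooth_on_has_derivative[OF smooth(2) p, unfolded rs]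
  have "((\<lambda>r. fr (r, s)) has_derivative (\<lambda>t. frechet_derivative fr (at (r, s)) (t, 0))) (at r)"
    using has_derivative_compose[OF 1 fr'] by simp
  moreover have "((\<lambda>r. fr (r, s)) has_derivative (\<lambda>t. t *\<^sub>R - hyp_Gamma (f (r, s)) (fr (r, s)) (fr (r, s)))) (at r)"
    using unit_geodesicD(5)[OF ruling(1)[OF s], of r]
    by (simp add: velocity_ruling[OF s, abs_def] has_vector_derivative_def)
  ultimately have "(\<lambda>t. frechet_derivative fr (at (r, s)) (t, 0)) =
      (\<lambda>t. t *\<^sub>R - hyp_Gamma (f (r, s)) (fr (r, s)) (fr (r, s)))"
    by (rule has_derivative_unique)
  from fun_cong[OF this, of 1] show ?thesis by (simp add: rs)
qed

text \<open>Differentiating \<open>momentum (f p) (fr p) = z (snd p)\<close> in s: the value part is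
  the covariant derivative of \<open>fr\<close>, and the rotation part determines \<open>fs\<close>
  up to its component along the ruling.\<close>

lemma
  assumes p: "p \<in> S"
  shows killing_velocity: "killing (velocity z (snd p)) (f p) = frechet_derivative fr (at p) (0, 1) + hyp_Gamma (f p) (fs p) (fr p)"
    and fs_eq: "fs p = killing a (f p) + \<mu> p *\<^sub>R fr p"
proof -
  have sI: "snd p \<in> I" using p by auto
  have "((\<lambda>q. z (snd q)) has_derivative (\<lambda>\<xi>. snd \<xi> *\<^sub>R velocity z (snd p))) (at p)"
    using has_derivative_compose[OF has_derivative_snd[OF has_derivative_ident]
        z_has_velocity[OF sI, unfolded has_vector_derivative_def]] .
  then have m: "((\<lambda>q. momentum (f q) (fr q)) has_derivative (\<lambda>\<xi>. snd \<xi> *\<^sub>R velocity z (snd p))) (at p)"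
    by (rule has_derivative_transform_within_open[OF _ open_S p]) (simp add: z_eq)
  note * = momentum_has_derivative[OF smooth_on_has_derivative[OF smooth(1) p]
      smooth_on_has_derivative[OF smooth(2) p] m pos[OF p], of "(0, 1)"]
  show "killing (velocity z (snd p)) (f p) = frechet_derivative fr (at p) (0, 1) + hyp_Gamma (f p) (fs p) (fr p)"
    using *(1) by (simp add: frechet_f[OF p])
  have rotor: "rotor (velocity z (snd p)) (f p) = (1 / f p $ 0) *\<^sub>R cross3 (fr p) (fs p)"
    using *(2) by (simp add: frechet_f[OF p])
  have "killing a (f p) = (1 / f p $ 0) *\<^sub>R cross3 (rotor (velocity z (snd p)) (f p)) (fr p)"
    using killing_bracket_momentum(1)[OF pos[OF p]] unfolding generator_eq[OF sI, symmetric] z_eq[OF p, symmetric] .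
  also have "\<dots> = fs p - \<mu> p *\<^sub>R fr p"
    unfolding rotor \<mu>_def by (rule hyp_double_cross[OF pos[OF p] unit_fr[OF p]])
  finally show "fs p = killing a (f p) + \<mu> p *\<^sub>R fr p" by simp
qed

lemma perp:
  assumes p: "p \<in> S"
  shows "killing a (f p) \<bullet> fr p = 0" "rotor a (f p) \<bullet> fr p = 0"
proof -
  have sI: "snd p \<in> I" using p by auto
  have "kform (z (snd p)) a = 0" unfolding generator_eq[OF sI, symmetric] by (rule kform_bracket_left)
  then show "killing a (f p) \<bullet> fr p = 0" "rotor a (f p) \<bullet> fr p = 0"
    using kform_momentum[OF pos[OF p], of "fr p" a] pos[OF p]
    by (simp_all add: z_eq[OF p] hyp_metric_def inner_commute)
qed

lemma killing_velocity_cross: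
  assumes p: "p \<in> S"
  shows "killing (velocity z (snd p)) (f p) = (1 / f p $ 0) *\<^sub>R cross3 (rotor a (f p)) (fr p)"
proof -
  have sI: "snd p \<in> I" using p by auto
  show ?thesis
    using killing_bracket_momentum(1)[OF pos[OF p]] unfolding velocity_z[OF sI] z_eq[OF p, symmetric] .
qed

lemma smooth_\<mu>: "smooth_on S \<mu>"
  unfolding \<mu>_def[abs_def] by (intro smooth_on_hyp_metric open_S smooth pos)

text \<open>The product rule for the decomposition \<open>fs_eq\<close>. Its last term is tangent to
  the ruling and drops out against the normal.\<close>

lemma frechet_fs:
  assumes p: "p \<in> S"
  shows "frechet_derivative fs (at p) \<xi> + hyp_Gamma (f p) (frechet_derivative f (at p) \<xi>) (fs p) =
    (1 / f p $ 0) *\<^sub>R cross3 (rotor a (f p)) (frechet_derivative f (at p) \<xi>)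
    + \<mu> p *\<^sub>R (frechet_derivative fr (at p) \<xi> + hyp_Gamma (f p) (frechet_derivative f (at p) \<xi>) (fr p))
    + frechet_derivative \<mu> (at p) \<xi> *\<^sub>R fr p"
proof -
  have "((\<lambda>q. killing a (f q) + \<mu> q *\<^sub>R fr q) has_derivative (\<lambda>\<xi>.
      (killing 0 (f p) + ((1 / f p $ 0) *\<^sub>R cross3 (rotor a (f p)) (frechet_derivative f (at p) \<xi>)
        - hyp_Gamma (f p) (frechet_derivative f (at p) \<xi>) (killing a (f p))))
      + (\<mu> p *\<^sub>R frechet_derivative fr (at p) \<xi> + frechet_derivative \<mu> (at p) \<xi> *\<^sub>R fr p))) (at p)"
    using pos[OF p] by (intro has_derivative_add killing_has_derivative has_derivative_const has_derivative_scaleR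
        smooth_on_has_derivative[OF _ p] smooth smooth_\<mu>) simp
  then have "(fs has_derivative (\<lambda>\<xi>.
      (killing 0 (f p) + ((1 / f p $ 0) *\<^sub>R cross3 (rotor a (f p)) (frechet_derivative f (at p) \<xi>)
        - hyp_Gamma (f p) (frechet_derivative f (at p) \<xi>) (killing a (f p))))
      + (\<mu> p *\<^sub>R frechet_derivative fr (at p) \<xi> + frechet_derivative \<mu> (at p) \<xi> *\<^sub>R fr p))) (at p)"
    by (rule has_derivative_transform_within_open[OF _ open_S p]) (simp add: fs_eq)
  then show ?thesis
    by (simp add: frechet_derivative_eqI fs_eq[OF p] hyp_Gamma_linear killing_linear scaleR_add_right)
qed

text \<open>\<open>fs\<close> may be replaced by the Killing field, as they differ by a multiple of
  \<open>fr\<close>. Where that field vanishes both sides are zero, so the formulas built on this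
  hold at every point.\<close>

lemma unit_normal_eq:
  assumes p: "p \<in> S"
  obtains k where "unit_normal f p = k *\<^sub>R cross3 (fr p) (killing a (f p))"
    "killing a (f p) \<noteq> 0 \<Longrightarrow> k \<noteq> 0"
proof -
  let ?n = "cross3 (fr p) (killing a (f p))"
  have n: "cross3 (fr p) (fs p) = ?n"
    by (simp add: fs_eq[OF p] cross_add_right cross_mult_right cross_refl)
  have "unit_normal f p = (f p $ 0 / norm ?n) *\<^sub>R ?n"
    by (simp add: unit_normal_def Let_def n flip: fr_def fs_def)
  moreover have "f p $ 0 / norm ?n \<noteq> 0" if "killing a (f p) \<noteq> 0"
  proof -
    have "?n \<bullet> ?n = (fr p \<bullet> fr p) * (killing a (f p) \<bullet> killing a (f p))"
      using perp(1)[OF p] by (simp add: dot_cross inner_commute)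
    moreover have "fr p \<noteq> 0" using unit_fr[OF p] by (auto simp: hyp_metric_def)
    ultimately have "?n \<noteq> 0" using that by auto
    then show ?thesis using pos[OF p] by simp
  qed
  ultimately show thesis by (rule that)
qed

lemma second_form_eqs:
  assumes p: "p \<in> S"
  shows "second_form f p (1, 0) (1, 0) = 0"
    and "second_form f p (1, 0) (0, 1) = hyp_metric (f p) (killing (velocity z (snd p)) (f p)) (unit_normal f p)"
    and "second_form f p (0, 1) (1, 0) = second_form f p (1, 0) (0, 1)"
    and "second_form f p (0, 1) (0, 1) = 2 * \<mu> p * second_form f p (1, 0) (0, 1)"
proof -
  let ?K = "killing a (f p)" and ?R = "rotor a (f p)" and ?N = "unit_normal f p" and ?w = "killing (velocity z (snd p)) (f p)"
  obtain k where k: "?N = k *\<^sub>R cross3 (fr p) ?K" by (rule unit_normal_eq[OF p])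
  have N: "hyp_metric (f p) (fr p) ?N = 0" "hyp_metric (f p) (cross3 ?R ?K) ?N = 0"
    using perp[OF p] by (simp_all add: k hyp_metric_def dot_cross dot_cross_self inner_commute)
  have hyp: "hyp_metric x (u + v) w = hyp_metric x u w + hyp_metric x v w"
    "hyp_metric x (r *\<^sub>R u) w = r * hyp_metric x u w" "hyp_metric x 0 w = 0" for x u v w r
    by (simp_all add: hyp_metric_def inner_left_distrib add_divide_distrib)
  have D: "frechet_derivative f (at p) (1, 0) = fr p" "frechet_derivative f (at p) (0, 1) = fs p"
    "(\<lambda>q. frechet_derivative f (at q) (1, 0)) = fr" "(\<lambda>q. frechet_derivative f (at q) (0, 1)) = fs"
    by (simp_all add: fr_def fs_def fun_eq_iff)
  note sf = second_form_def christoffel_hyp[OF pos[OF p]] D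
  show "second_form f p (1, 0) (1, 0) = 0"
    by (simp add: sf geodesic_ruling[OF p] hyp)
  show 12: "second_form f p (1, 0) (0, 1) = hyp_metric (f p) ?w ?N"
    unfolding sf frechet_fs[OF p, of "(1, 0)", unfolded D] geodesic_ruling[OF p] killing_velocity_cross[OF p]
    by (simp add: hyp N)
  have "second_form f p (0, 1) (1, 0) = hyp_metric (f p) ?w ?N"
    unfolding killing_velocity[OF p] sf ..
  then show "second_form f p (0, 1) (1, 0) = second_form f p (1, 0) (0, 1)"
    unfolding 12 .
  have "cross3 ?R (fs p) = cross3 ?R ?K + \<mu> p *\<^sub>R cross3 ?R (fr p)"
    by (simp add: fs_eq[OF p] cross_add_right cross_mult_right)
  then have "(1 / f p $ 0) *\<^sub>R cross3 ?R (fs p) = (1 / f p $ 0) *\<^sub>R cross3 ?R ?K + \<mu> p *\<^sub>R ?w"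
    unfolding killing_velocity_cross[OF p] by (simp add: scaleR_add_right)
  \<comment> \<open>One \<open>\<mu> p\<close> comes from the component of \<open>fs\<close> along
    the ruling inside the cross product with \<open>?R\<close>, the other from the product rule;
    \<open>cross3 ?R ?K\<close> is orthogonal to the normal.\<close>
  then have "second_form f p (0, 1) (0, 1) = 2 * \<mu> p * hyp_metric (f p) ?w ?N"
    unfolding sf frechet_fs[OF p, of "(0, 1)", unfolded D] killing_velocity[OF p, symmetric]
    by (simp only: hyp N)
  then show "second_form f p (0, 1) (0, 1) = 2 * \<mu> p * second_form f p (1, 0) (0, 1)"
    unfolding 12 .
qed

text \<open>With E = 1, F = \<open>\<mu> p\<close>, e = 0 and n = 2 \<open>\<mu> p\<close> m, the
  numerator E n - 2 F m + G e cancels whatever m is.\<close>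

lemma minimal: "minimal_surface S f"
  unfolding minimal_surface_def
proof (intro ballI impI)
  fix p assume p: "p \<in> S"
  have "first_form f p (1, 0) (1, 0) = 1" "first_form f p (1, 0) (0, 1) = \<mu> p"
    unfolding first_form_def fr_def[symmetric] fs_def[symmetric] \<mu>_def
    by (rule unit_fr[OF p], simp add: hyp_metric_def inner_commute)
  then show "mean_curvature f p = 0"
    by (simp add: mean_curvature_def Let_def second_form_eqs(1,4)[OF p])
qed

lemma second_form_expand:
  assumes p: "p \<in> S"
  shows "second_form f p u v = fst u * fst v * second_form f p (1, 0) (1, 0)
    + fst u * snd v * second_form f p (1, 0) (0, 1) + snd u * fst v * second_form f p (0, 1) (1, 0)
    + snd u * snd v * second_form f p (0, 1) (0, 1)"
proof -
  have "((\<lambda>q. fst v *\<^sub>R fr q + snd v *\<^sub>R fs q) has_derivative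
     (\<lambda>\<xi>. fst v *\<^sub>R frechet_derivative fr (at p) \<xi> + snd v *\<^sub>R frechet_derivative fs (at p) \<xi>)) (at p)"
    by (intro has_derivative_add has_derivative_scaleR_right smooth_on_has_derivative[OF _ p] smooth)
  then have "((\<lambda>q. frechet_derivative f (at q) v) has_derivative
     (\<lambda>\<xi>. fst v *\<^sub>R frechet_derivative fr (at p) \<xi> + snd v *\<^sub>R frechet_derivative fs (at p) \<xi>)) (at p)"
    by (rule has_derivative_transform_within_open[OF _ open_S p]) (simp add: frechet_f)
  then have D2: "frechet_derivative (\<lambda>q. frechet_derivative f (at q) v) (at p) u =
      fst v *\<^sub>R frechet_derivative fr (at p) u + snd v *\<^sub>R frechet_derivative fs (at p) u"
    by (simp add: frechet_derivative_eqI)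
  have D: "(\<lambda>q. frechet_derivative f (at q) (1, 0)) = fr" "(\<lambda>q. frechet_derivative f (at q) (0, 1)) = fs"
    by (simp_all add: fr_def fs_def fun_eq_iff)
  show ?thesis
    unfolding second_form_def christoffel_hyp[OF pos[OF p]] D2 D frechet_f[OF p]
      frechet_derivative_pair[OF smooth(2) p, of u] frechet_derivative_pair[OF smooth(3) p, of u]
    by (simp add: hyp_Gamma_linear hyp_metric_def inner_left_distrib add_divide_distrib algebra_simps)
qed

lemma second_form_mixed:
  assumes p: "p \<in> S" and k: "unit_normal f p = k *\<^sub>R cross3 (fr p) (killing a (f p))"
  shows "second_form f p (1, 0) (0, 1) = - k * f p $ 0 * Im (kform a a) / 2"
proof -
  have x: "f p $ 0 > 0" by (rule pos[OF p])
  have vv: "fr p \<bullet> fr p = (f p $ 0)\<^sup>2" using unit_fr[OF p] x by (simp add: hyp_metric_def field_simps)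
  have "cross3 (rotor a (f p)) (fr p) \<bullet> cross3 (fr p) (killing a (f p)) = - (killing a (f p) \<bullet> rotor a (f p)) * (f p $ 0)\<^sup>2"
    using perp[OF p] by (simp add: dot_cross vv inner_commute)
  then have "second_form f p (1, 0) (0, 1) = - k * (killing a (f p) \<bullet> rotor a (f p)) / f p $ 0"
    using x by (simp add: second_form_eqs(2)[OF p] killing_velocity_cross[OF p] k hyp_metric_def)
  moreover have "killing a (f p) \<bullet> rotor a (f p) = (f p $ 0)\<^sup>2 * Im (kform a a) / 2"
    using Im_kform[of "f p" a a] by (simp add: inner_commute)
  ultimately show ?thesis using x by (simp add: power2_eq_square)
qed

lemma immersion:
  assumes p: "p \<in> S" and K: "killing a (f p) \<noteq> 0"
  shows "immersion_at f p"
  unfolding immersion_at_def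
proof (subst linear_injective_0[OF has_derivative_linear[OF smooth_on_has_derivative[OF smooth(1) p]]],
    intro allI impI)
  fix \<xi> assume "frechet_derivative f (at p) \<xi> = 0"
  then have 0: "(fst \<xi> + snd \<xi> * \<mu> p) *\<^sub>R fr p + snd \<xi> *\<^sub>R killing a (f p) = 0"
    by (simp add: frechet_f[OF p] fs_eq[OF p] algebra_simps)
  then have "((fst \<xi> + snd \<xi> * \<mu> p) *\<^sub>R fr p + snd \<xi> *\<^sub>R killing a (f p)) \<bullet> killing a (f p) = 0" by simp
  then have "snd \<xi> * (killing a (f p) \<bullet> killing a (f p)) = 0"
    using perp(1)[OF p] by (simp add: inner_left_distrib inner_commute[of "fr p"])
  then have "snd \<xi> = 0" using K by simp
  moreover have "fr p \<noteq> 0" using unit_fr[OF p] by (auto simp: hyp_metric_def)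
  ultimately show "\<xi> = 0" using 0 by (simp add: prod_eq_iff)
qed

lemma totally_geodesic_iff: "totally_geodesic S f \<longleftrightarrow> I = {} \<or> Im (kform a a) = 0"
proof
  assume tg: "totally_geodesic S f"
  have "Im (kform a a) = 0" if "s \<in> I" for s
  proof (rule ccontr)
    assume nz: "Im (kform a a) \<noteq> 0"
    have p: "(0, s) \<in> S" using that by simp
    \<comment> \<open>Up to a positive factor \<open>Im (kform a a)\<close> is the product of the
      Killing field with its rotation part, so neither vanishes; in particular the surface is
      immersed here and the hypothesis applies.\<close>
    have K: "killing a (f (0, s)) \<noteq> 0"
      using Im_kform[of "f (0, s)" a a] nz pos[OF p] by auto
    obtain k where k: "unit_normal f (0, s) = k *\<^sub>R cross3 (fr (0, s)) (killing a (f (0, s)))" "k \<noteq> 0"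
      using unit_normal_eq[OF p] K by metis
    have "second_form f (0, s) (1, 0) (0, 1) = 0"
      using tg immersion[OF p K] p by (simp add: totally_geodesic_def)
    then show False
      using second_form_mixed[OF p k(1)] nz k(2) pos[OF p] by simp
  qed
  then show "I = {} \<or> Im (kform a a) = 0" by blast
next
  assume *: "I = {} \<or> Im (kform a a) = 0"
  show "totally_geodesic S f"
    unfolding totally_geodesic_def
  proof (intro ballI impI allI)
    fix p u v assume p: "p \<in> S"
    obtain k where k: "unit_normal f p = k *\<^sub>R cross3 (fr p) (killing a (f p))" by (rule unit_normal_eq[OF p])
    have "Im (kform a a) = 0" using * p by auto
    then have "second_form f p (1, 0) (0, 1) = 0" by (simp add: second_form_mixed[OF p k])
    then show "second_form f p u v = 0"
      by (subst second_form_expand[OF p]) (simp add: second_form_eqs(1,3,4)[OF p])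
  qed
qed

end

theorem theorem4:
  fixes I :: "real set" and c :: "real \<Rightarrow> oriented_geodesic"
  assumes "L_geodesic I c"
  shows "(\<exists>V. L_killing_field V \<and> L_integral_curve V I c) \<and>
    (\<not> c constant_on I \<longrightarrow>
      (\<forall>f. ruled_surface I c f \<longrightarrow>
        minimal_surface (UNIV \<times> I) f \<and>
        (L_null I c \<longleftrightarrow> totally_geodesic (UNIV \<times> I) f)))"
proof -
  interpret geodesic_curve I c by unfold_locales (rule assms)
  have "minimal_surface (UNIV \<times> I) f \<and> (L_null I c \<longleftrightarrow> totally_geodesic (UNIV \<times> I) f)"
    if "ruled_surface I c f" for f
  proof -
    interpret ruled I c f by unfold_locales (rule that)
    show ?thesis using minimal totally_geodesic_iff L_null_iff by simp
  qed
  then show ?thesis using L_killing_field_projection integral_curve by blast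
qed

end
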